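(* Let $p\in(2,3]$. Assume that $\mu$ is strictly contracting and admits a moment of order $p$. Let $W_0$ be a random variable with law $\nu$, independent of $(Y_n)_{n\in\mathbb N}$, let $s^2=\lim_{n\to+\infty}\frac1n\mathbb E[(\sigma(A_n,W_0)-n\lambda_\mu)^2]$, and assume that $s^2>0$. Then, setting $v_n=\big(\frac1n\big)^{p/2-1}$, we have $$\sup_{t\in\mathbb R}\Big|\mathbb P\big(\sigma(A_n,W_0)-n\lambda_\mu\le t\sqrt n\big)-\Phi(t/s)\Big|=O(v_n),$$ $$\sup_{x\in S^+}\sup_{t\in\mathbb R}\Big|\mathbb P\big(\sigma(A_n,x)-n\lambda_\mu\le t\sqrt n\big)-\Phi(t/s)\Big|=O(v_n),$$ $$\sup_{t\in\mathbb R}\Big|\mathbb P\big(\log\|A_n\|-n\lambda_\mu\le t\sqrt n\big)-\Phi(t/s)\Big|=O(v_n).$$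
   Context: Let $d\ge 2$ be an integer and $\mathbb N=\{1,2,\dots\}$. $\|\cdot\|$ denotes the $\ell^1$ norm on $\mathbb R^d$ and also the associated operator norm on $d\times d$ matrices. $G$ is the semigroup of $d\times d$ real matrices with nonnegative entries such that every row and every column contains a strictly positive entry, with the topology induced by the norm; $G^+\subset G$ is the set of matrices all of whose entries are strictly positive. $S^+=\{x\in\mathbb R^d:\|x\|=1,\ x_i\ge 0\ \forall i\}$, equipped with the metric $\mathbf d(x,y)=\varphi(m(x,y)m(y,x))$, where $\varphi(s)=\frac{1-s}{1+s}$ and $m(x,y)=\inf\{x_i/y_i: 1\le i\le d,\ y_i>0\}$; Borel sets of $S^+$ refer to $\mathbf d$. For $g\in G$: $v(g)=\inf_{x\in S^+}\|gx\|$, $N(g)=\max(\|g\|,1/v(g))$. For $(g,x)\in G\times S^+$, $g\cdot x=gx/\|gx\|$ and $\sigma(g,x)=\log\|gx\|$. $\mu$ is a Borel probability measure on $G$; $\mu^{*r}$ is its $r$-fold convolution (the law of a product of $r$ independent matrices of law $\mu$). $\mu$ is strictly contracting if $\mu^{*r}(G^+)>0$ for some $r\in\mathbb N$. $\mu$ admits a moment of order $p\ge1$ if $\int_G(\log N(g))^p\,d\mu(g)<\infty$. When $\mu$ is strictly contracting there is a unique $\mu$-invariant Borel probability measure $\nu$ on $S^+$, i.e. $\int f(g\cdot x)\,d\mu(g)d\nu(x)=\int f\,d\nu$ for all nonnegative Borel $f$. $(Y_n)_{n\in\mathbb N}$ are iid with law $\mu$ and $A_n=Y_n\cdots Y_1$.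 $\lambda_\mu\in\mathbb R$ is the almost sure (and $L^1$) limit of $\frac1n\log\|A_n\|$, which exists and is constant as soon as $\int_G|\log\|g\||\,d\mu(g)<\infty$. If $\mu$ is strictly contracting and admits a moment of order $2$, the limit defining $s^2$ exists in $[0,\infty)$; $s=\sqrt{s^2}$. $\Phi$ is the standard normal distribution function. *)

theory Defs
  imports "HOL-Probability.Probability" "HOL-Library.Landau_Symbols"
begin

definition norm1 :: "real ^ 'd \<Rightarrow> real" where
  "norm1 x = (\<Sum>i\<in>UNIV. \<bar>x $ i\<bar>)"

definition opnorm1 :: "real ^ 'd ^ 'd \<Rightarrow> real" where
  "opnorm1 g = Sup {norm1 (g *v x) | x. norm1 x = 1}"

definition G :: "(real ^ 'd ^ 'd) set" where
  "G = {g. (\<forall>i j. 0 \<le> g $ i $ j) \<and> (\<forall>i. \<exists>j. 0 < g $ i $ j) \<and> (\<forall>j. \<exists>i. 0 < g $ i $ j)}"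

definition Gplus :: "(real ^ 'd ^ 'd) set" where
  "Gplus = {g \<in> G. \<forall>i j. 0 < g $ i $ j}"

text \<open>All norms on a finite-dimensional space induce the same topology, so the Borel sets of
  \<open>G\<close> are the traces of the library's Borel sets of matrices.\<close>

definition borel_G :: "(real ^ 'd ^ 'd) measure" where
  "borel_G = restrict_space borel G"

definition Splus :: "(real ^ 'd) set" where
  "Splus = {x. norm1 x = 1 \<and> (\<forall>i. 0 \<le> x $ i)}"

definition mratio :: "real ^ 'd \<Rightarrow> real ^ 'd \<Rightarrow> real" where
  "mratio x y = Inf {x $ i / y $ i | i. 0 < y $ i}"

definition phi :: "real \<Rightarrow> real" where
  "phi s = (1 - s) / (1 + s)"

text \<open>The value \<open>0\<close> outside \<open>Splus\<close> is a dummy: the locale \<^locale>\<open>Metric_space\<close> requires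
  nonnegativity and symmetry on the whole type.\<close>

definition dist_S :: "real ^ 'd \<Rightarrow> real ^ 'd \<Rightarrow> real" where
  "dist_S x y = (if x \<in> Splus \<and> y \<in> Splus then phi (mratio x y * mratio y x) else 0)"

definition borel_S :: "(real ^ 'd) measure" where
  "borel_S = sigma Splus {U. openin (Metric_space.mtopology Splus dist_S) U}"

definition vinf :: "real ^ 'd ^ 'd \<Rightarrow> real" where
  "vinf g = (INF x\<in>Splus. norm1 (g *v x))"

definition Nsize :: "real ^ 'd ^ 'd \<Rightarrow> real" where
  "Nsize g = max (opnorm1 g) (1 / vinf g)"

definition act :: "real ^ 'd ^ 'd \<Rightarrow> real ^ 'd \<Rightarrow> real ^ 'd" where
  "act g x = (1 / norm1 (g *v x)) *\<^sub>R (g *v x)"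

definition cocycle :: "real ^ 'd ^ 'd \<Rightarrow> real ^ 'd \<Rightarrow> real" where
  "cocycle g x = ln (norm1 (g *v x))"

definition mconv :: "(real ^ 'd ^ 'd) measure \<Rightarrow> (real ^ 'd ^ 'd) measure \<Rightarrow> (real ^ 'd ^ 'd) measure" where
  "mconv \<mu> \<kappa> = distr (\<mu> \<Otimes>\<^sub>M \<kappa>) borel_G (\<lambda>(g, h). g ** h)"

primrec mconv_pow :: "(real ^ 'd ^ 'd) measure \<Rightarrow> nat \<Rightarrow> (real ^ 'd ^ 'd) measure" where
  "mconv_pow \<mu> 0 = return borel_G (mat 1)"
| "mconv_pow \<mu> (Suc r) = mconv \<mu> (mconv_pow \<mu> r)"

definition strictly_contracting :: "(real ^ 'd ^ 'd) measure \<Rightarrow> bool" where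
  "strictly_contracting \<mu> \<longleftrightarrow> (\<exists>r\<ge>1. 0 < measure (mconv_pow \<mu> r) Gplus)"

definition has_moment :: "(real ^ 'd ^ 'd) measure \<Rightarrow> real \<Rightarrow> bool" where
  "has_moment \<mu> p \<longleftrightarrow> (\<integral>\<^sup>+ g. ennreal (ln (Nsize g) powr p) \<partial>\<mu>) < \<infinity>"

definition invariant_measure :: "(real ^ 'd ^ 'd) measure \<Rightarrow> (real ^ 'd) measure \<Rightarrow> bool" where
  "invariant_measure \<mu> \<nu> \<longleftrightarrow>
     (\<forall>f :: real ^ 'd \<Rightarrow> ennreal. f \<in> borel_measurable borel_S \<longrightarrow>
        (\<integral>\<^sup>+ x. (\<integral>\<^sup>+ g. f (act g x) \<partial>\<mu>) \<partial>\<nu>) = (\<integral>\<^sup>+ x. f x \<partial>\<nu>))"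

primrec walk :: "(nat \<Rightarrow> 'w \<Rightarrow> real ^ 'd ^ 'd) \<Rightarrow> nat \<Rightarrow> 'w \<Rightarrow> real ^ 'd ^ 'd" where
  "walk Y 0 \<omega> = mat 1"
| "walk Y (Suc n) \<omega> = Y (Suc n) \<omega> ** walk Y n \<omega>"

definition Phi :: "real \<Rightarrow> real" where
  "Phi = cdf std_normal_distribution"

lemma mratio_facts:
  fixes x y :: "real ^ 'd"
  assumes x: "x \<in> Splus" and y: "y \<in> Splus"
  shows mratio_mult_le: "mratio x y * y $ i \<le> x $ i"
    and mratio_nonneg: "0 \<le> mratio x y"
    and mratio_le_one: "mratio x y \<le> 1"
    and mratio_greatest: "(\<And>i. 0 < y $ i \<Longrightarrow> c * y $ i \<le> x $ i) \<Longrightarrow> c \<le> mratio x y"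
proof -
  let ?A = "{x $ i / y $ i | i. 0 < y $ i}"
  have x0: "\<And>i. 0 \<le> x $ i" and y0: "\<And>i. 0 \<le> y $ i"
    using x y by (auto simp: Splus_def)
  have sx: "(\<Sum>i\<in>UNIV. x $ i) = 1" and sy: "(\<Sum>i\<in>UNIV. y $ i) = 1"
    using x y by (auto simp: Splus_def norm1_def)
  have "\<exists>i. 0 < y $ i"
  proof (rule ccontr)
    assume "\<not> ?thesis"
    then have "\<And>i. y $ i = 0" using y0 by (metis order_le_less)
    then show False using sy by simp
  qed
  then have ne: "?A \<noteq> {}" by blast
  have bdd: "bdd_below ?A" using x0 y0 by (auto intro!: bdd_belowI[of _ 0])
  show nn: "0 \<le> mratio x y"
    unfolding mratio_def using x0 y0 by (intro cInf_greatest ne) auto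
  have le: "mratio x y * y $ i \<le> x $ i" for i
  proof (cases "0 < y $ i")
    case True
    then have "mratio x y \<le> x $ i / y $ i"
      unfolding mratio_def by (intro cInf_lower bdd) auto
    then show ?thesis using True by (simp add: field_simps)
  next
    case False
    then have "y $ i = 0" using y0[of i] by simp
    then show ?thesis using x0 by simp
  qed
  show "mratio x y * y $ i \<le> x $ i" by (rule le)
  have "mratio x y * (\<Sum>i\<in>UNIV. y $ i) \<le> (\<Sum>i\<in>UNIV. x $ i)"
    unfolding sum_distrib_left by (intro sum_mono le)
  then show "mratio x y \<le> 1" using sx sy by simp
  show "c \<le> mratio x y" if "\<And>i. 0 < y $ i \<Longrightarrow> c * y $ i \<le> x $ i"
    unfolding mratio_def using that by (intro cInf_greatest ne) (auto simp: field_simps)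
qed

lemma phi_mono: "0 \<le> a \<Longrightarrow> a \<le> b \<Longrightarrow> phi b \<le> phi a"
  unfolding phi_def by (simp add: divide_simps) (simp add: algebra_simps)

lemma phi_mult_le:
  assumes "0 \<le> a" "a \<le> 1" "0 \<le> b" "b \<le> 1"
  shows "phi (a * b) \<le> phi a + phi b"
proof -
  have ab: "0 \<le> a * b" "a * b \<le> 1" using assms by (auto simp: mult_le_one)
  have "phi a + phi b = 2 * (1 - a * b) / ((1 + a) * (1 + b))"
    unfolding phi_def using assms by (simp add: field_simps)
  moreover have "phi (a * b) = 2 * (1 - a * b) / (2 * (1 + a * b))"
    unfolding phi_def using ab by (simp add: field_simps)
  moreover have "(1 + a) * (1 + b) \<le> 2 * (1 + a * b)"
    using mult_nonneg_nonneg[of "1 - a" "1 - b"] assms by (simp add: algebra_simps)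
  moreover have "0 < (1 + a) * (1 + b)" using assms by simp
  ultimately show ?thesis using ab by (simp add: frac_le)
qed

lemma Metric_space_dist_S: "Metric_space (Splus :: (real ^ 'd) set) dist_S"
proof
  fix x y z :: "real ^ 'd"
  have prod01: "0 \<le> mratio a b * mratio b a \<and> mratio a b * mratio b a \<le> 1"
    if "a \<in> Splus" "b \<in> Splus" for a b :: "real ^ 'd"
    using that by (simp add: mratio_nonneg mratio_le_one mult_le_one)
  show "0 \<le> dist_S x y"
    using prod01[of x y] by (auto simp: dist_S_def phi_def)
  show "dist_S x y = dist_S y x"
    by (auto simp: dist_S_def mult.commute)
  show "dist_S x y = 0 \<longleftrightarrow> x = y" if xy: "x \<in> Splus" "y \<in> Splus"
  proof
    assume "dist_S x y = 0"
    then have "mratio x y * mratio y x = 1"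
      using prod01[OF xy] xy by (auto simp: dist_S_def phi_def)
    moreover have "mratio x y * mratio y x \<le> mratio x y" "mratio x y * mratio y x \<le> mratio y x"
      using mratio_nonneg[OF xy] mratio_nonneg[OF xy(2,1)] mratio_le_one[OF xy]
        mratio_le_one[OF xy(2,1)] by (simp_all add: mult_left_le mult_left_le_one_le)
    ultimately have "mratio x y = 1" "mratio y x = 1"
      using mratio_le_one[OF xy] mratio_le_one[OF xy(2,1)] by linarith+
    then have "x $ i = y $ i" for i
      using mratio_mult_le[OF xy, of i] mratio_mult_le[OF xy(2,1), of i] by simp
    then show "x = y" by (simp add: vec_eq_iff)
  next
    assume "x = y"
    have "1 \<le> mratio x x" using xy by (intro mratio_greatest) auto
    then have "mratio x x = 1" using mratio_le_one[OF xy(1) xy(1)] by simp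
    then show "dist_S x y = 0" using \<open>x = y\<close> by (simp add: dist_S_def phi_def)
  qed
  show "dist_S x z \<le> dist_S x y + dist_S y z" if xyz: "x \<in> Splus" "y \<in> Splus" "z \<in> Splus"
  proof -
    have sub: "mratio a b * mratio b c \<le> mratio a c"
      if abc: "a \<in> Splus" "b \<in> Splus" "c \<in> Splus" for a b c :: "real ^ 'd"
    proof (rule mratio_greatest[OF abc(1,3)])
      fix i
      have "mratio a b * (mratio b c * c $ i) \<le> mratio a b * b $ i"
        using mratio_mult_le[OF abc(2,3)] mratio_nonneg[OF abc(1,2)] by (rule mult_left_mono)
      also have "\<dots> \<le> a $ i" using mratio_mult_le[OF abc(1,2)] .
      finally show "mratio a b * mratio b c * c $ i \<le> a $ i" by (simp add: mult.assoc)
    qed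
    have "(mratio x y * mratio y z) * (mratio z y * mratio y x) \<le> mratio x z * mratio z x"
      using xyz by (intro mult_mono sub) (auto simp: mratio_nonneg)
    then have "(mratio x y * mratio y x) * (mratio y z * mratio z y) \<le> mratio x z * mratio z x"
      by (simp add: mult_ac)
    then have "phi (mratio x z * mratio z x)
        \<le> phi ((mratio x y * mratio y x) * (mratio y z * mratio z y))"
      using prod01[OF xyz(1,2)] prod01[OF xyz(2,3)] by (intro phi_mono) auto
    also have "\<dots> \<le> phi (mratio x y * mratio y x) + phi (mratio y z * mratio z y)"
      using prod01[OF xyz(1,2)] prod01[OF xyz(2,3)] by (intro phi_mult_le) auto
    finally show ?thesis using xyz by (simp add: dist_S_def)
  qed
qed

end

theory Submission
  imports Defs
begin

text \<open>The proof is elementary: no spectral perturbation theory is used. The function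
  \<open>1 - sqrt (m(x,y) m(y,x))\<close> is contracted by every matrix, and strictly by matrices with positive
  entries; averaged over finitely many steps it gives a distance which the random action contracts
  in mean. Poisson equations for Lipschitz functions then replace the cocycle, up to a bounded
  coboundary, by a martingale with increments of conditional variance \<open>V\<close>, and provide \<open>U\<close> with
  \<open>U - PU = V - s\<^sup>2\<close>. For the twisted operators \<open>P\<^sub>t\<close>, the function \<open>1 - t\<^sup>2 U / 2\<close> is an eigenfunction
  for the value \<open>1 - s\<^sup>2 t\<^sup>2 / 2\<close> up to an error \<open>O(|t|\<^sup>p)\<close> in Lipschitz norm. Iterating this \<open>K / t\<^sup>2\<close> times
  shows that \<open>P\<^sub>t\<^sup>n\<close> decays like \<open>exp (- c n t\<^sup>2)\<close>, whence
  \<open>|P\<^sub>t\<^sup>n 1 - exp (- n s\<^sup>2 t\<^sup>2 / 2)| \<le> C (t\<^sup>2 + n |t|\<^sup>p) exp (- c n t\<^sup>2)\<close> for small \<open>t\<close>. Esseen's smoothing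
  inequality turns this into the rate \<open>n powr (1 - p / 2)\<close>; bounded perturbations only cost
  \<open>O(1 / sqrt n)\<close>, which covers both the coboundary and the passage from \<open>|A\<^sub>n x|\<close> to \<open>\<parallel>A\<^sub>n\<parallel>\<close>.\<close>

section \<open>Esseen's smoothing inequality\<close>

text \<open>The obstacle is integrability on the Fourier side. With
  \<open>t = u / sqrt (v n)\<close>, Esseen's inequality wants the error
  \<open>t^2 + n |t|^p\<close> below a multiple of \<open>|u| / (1 + u^2)\<close> for all
  \<open>|u|\<close> up to order \<open>sqrt n\<close>. Only the extra factor
  \<open>exp (- c n t^2)\<close> achieves this, and it must hold for the twisted powers of every
  Lipschitz function, because the defect of the eigenfunction is fed back into them. The decay is
  bootstrapped from an undamped bound: summed against the geometric series of ratio
  \<open>1 - v t^2 / 2\<close>, the defects contribute only \<open>|t| powr (p - 2)\<close>, which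
  is small because \<open>p > 2\<close>. The bound \<open>p \<le> 3\<close> makes
  \<open>1 / sqrt n\<close>, the cost of the cutoff and of bounded perturbations, at most the rate.
  On matrices, the cocycle is Lipschitz with a constant linear in \<open>ln (Nsize g)\<close>, so
  the moment of order \<open>p\<close> controls sizes and Lipschitz constants alike. The centering
  and the variance that come out of the Poisson equations are matched with \<open>lam\<close> and
  \<open>s2\<close> through second moments.\<close>

lemma integrable_pair_dominated:
  fixes f :: "'a \<times> 'b \<Rightarrow> 'c::{banach, second_countable_topology}"
  assumes "sigma_finite_measure M1" "prob_space N" and g: "integrable M1 (g :: 'a \<Rightarrow> real)"
    and f: "f \<in> borel_measurable (M1 \<Otimes>\<^sub>M N)" and le: "\<And>x y. norm (f (x, y)) \<le> g x"
  shows "integrable (M1 \<Otimes>\<^sub>M N) f"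
proof -
  interpret M1: sigma_finite_measure M1 by fact
  interpret N: prob_space N by fact
  interpret P: pair_sigma_finite M1 N ..
  have gm [measurable]: "g \<in> borel_measurable M1" using g by auto
  have "integrable (M1 \<Otimes>\<^sub>M N) (\<lambda>p. g (fst p))"
    by (rule P.Fubini_integrable) (use g in \<open>auto simp: N.prob_space\<close>)
  then show ?thesis
    by (rule Bochner_Integration.integrable_bound[OF _ f])
       (use le in \<open>auto intro!: AE_I2 simp: split_beta intro: order_trans[OF _ abs_ge_self]\<close>)
qed

lemma norm_integral_le:
  fixes f :: "'a \<Rightarrow> 'b::{banach, second_countable_topology}"
  assumes "integrable M f" "integrable M g" "\<And>x. x \<in> space M \<Longrightarrow> norm (f x) \<le> g x"
  shows "norm (\<integral>x. f x \<partial>M) \<le> (\<integral>x. g x \<partial>M)"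
  using integral_norm_bound[of M f] integral_mono[OF integrable_norm[OF assms(1)] assms(2,3)] by linarith

section \<open>The Fejer kernel\<close>

definition tri :: "real \<Rightarrow> real" where
  "tri t = indicator {-1..1} t * (1 - \<bar>t\<bar>)"

text \<open>Defining the kernel through its compactly supported Fourier transform makes the convolution
  formula a plain application of Fubini's theorem; no inversion formula is needed.\<close>

definition fejer :: "real \<Rightarrow> real" where
  "fejer u = (LINT t|lborel. tri t * cos (t * u))"

lemma tri_bounds: "0 \<le> tri t" "tri t \<le> indicator {-1..1} t"
  by (auto simp: tri_def indicator_def)

lemma tri_measurable [measurable]: "tri \<in> borel_measurable borel"
  unfolding tri_def by measurable

lemma fejer_measurable [measurable]: "fejer \<in> borel_measurable borel"
  unfolding fejer_def by measurable

lemma integrable_indicator_interval: "integrable lborel (\<lambda>t::real. indicator {-1..1} t :: real)"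
  by (intro integrable_real_indicator) auto

lemma tri_cos_integrable: "integrable lborel (\<lambda>t. tri t * cos (t * u))"
  by (rule Bochner_Integration.integrable_bound[OF integrable_indicator_interval])
     (auto intro!: AE_I2 simp: tri_def indicator_def abs_mult mult_le_one)

lemma fejer_le_2: "\<bar>fejer u\<bar> \<le> 2"
proof -
  have "norm (fejer u) \<le> (LINT t|lborel. indicator {-1..1::real} t)"
    unfolding fejer_def
    by (rule norm_integral_le[OF tri_cos_integrable integrable_indicator_interval])
       (auto simp: tri_def indicator_def abs_mult mult_le_one)
  then show ?thesis by simp
qed

text \<open>On each half of the support the absolute value is affine, so an explicit antiderivative
  does the integral. The closed form shows nonnegativity and decay of order \<open>1 / u^2\<close>,
  neither of which is visible in the Fourier definition.\<close>

lemma fejer_eq: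
  assumes u: "u \<noteq> 0"
  shows "fejer u = 2 * (1 - cos u) / u\<^sup>2"
proof -
  have 1: "((\<lambda>t. (1 - t) * cos (t * u)) has_integral
        (((1 - 1) * sin (1 * u) / u - cos (1 * u) / u\<^sup>2) - ((1 - 0) * sin (0 * u) / u - cos (0 * u) / u\<^sup>2)))
            {0..1}"
    by (rule fundamental_theorem_of_calculus)
       (use u in \<open>auto intro!: derivative_eq_intros simp: has_real_derivative_iff_has_vector_derivative[symmetric]
          power2_eq_square field_simps\<close>)
  have 2: "((\<lambda>t. (1 + t) * cos (t * u)) has_integral
        (((1 + 0) * sin (0 * u) / u + cos (0 * u) / u\<^sup>2) - ((1 + -1) * sin (-1 * u) / u + cos (-1 * u) /
            u\<^sup>2))) {-1..0}"
    by (rule fundamental_theorem_of_calculus)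
       (use u in \<open>auto intro!: derivative_eq_intros simp: has_real_derivative_iff_has_vector_derivative[symmetric]
          power2_eq_square field_simps\<close>)
  have F1: "((\<lambda>t. (1 - \<bar>t\<bar>) * cos (t * u)) has_integral ((1 - cos u) / u\<^sup>2)) {0..1}"
    using 1 by (rule has_integral_eq_rhs[OF has_integral_eq[rotated]]) (auto simp: diff_divide_distrib)
  have F2: "((\<lambda>t. (1 - \<bar>t\<bar>) * cos (t * u)) has_integral ((1 - cos u) / u\<^sup>2)) {-1..0}"
    using 2 by (rule has_integral_eq_rhs[OF has_integral_eq[rotated]]) (auto simp: diff_divide_distrib)
  have "((\<lambda>t. (1 - \<bar>t\<bar>) * cos (t * u)) has_integral ((1 - cos u) / u\<^sup>2 + (1 - cos u) / u\<^sup>2)) {-1..1}"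
    by (rule has_integral_combine[OF _ _ F2 F1]) auto
  then have "((\<lambda>t. if t \<in> {-1..1} then (1 - \<bar>t\<bar>) * cos (t * u) else 0) has_integral ((1 - cos u) / u\<^sup>2 + (1
      - cos u) / u\<^sup>2)) UNIV"
    by (subst has_integral_restrict_UNIV)
  moreover have "(\<lambda>t. if t \<in> {-1..1} then (1 - \<bar>t\<bar>) * cos (t * u) else 0) = (\<lambda>t. tri t * cos (t * u))"
    by (auto simp: tri_def fun_eq_iff)
  moreover have "((\<lambda>t. tri t * cos (t * u)) has_integral fejer u) UNIV"
    unfolding fejer_def by (rule has_integral_integral_lborel[OF tri_cos_integrable])
  ultimately have "fejer u = (1 - cos u) / u\<^sup>2 + (1 - cos u) / u\<^sup>2"
    by (auto dest: has_integral_unique)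
  then show ?thesis by (simp add: field_simps)
qed

lemma fejer_nonneg: "0 \<le> fejer u"
proof (cases "u = 0")
  case True
  then show ?thesis unfolding fejer_def by (auto intro!: integral_nonneg_AE simp: tri_bounds)
next
  case False
  then show ?thesis by (simp add: fejer_eq)
qed

text \<open>The bound 2 on the kernel and the bound 4 on \<open>u^2\<close> times the kernel add up
  to 6. The right-hand side is a multiple of the Cauchy density, hence an integrable
  majorant.\<close>

lemma fejer_le: "fejer u \<le> 6 * inverse (1 + u\<^sup>2)"
proof (cases "u = 0")
  case True
  then show ?thesis using fejer_le_2[of u] by simp
next
  case False
  have "fejer u * u\<^sup>2 = 2 * (1 - cos u)" using fejer_eq[OF False] False by simp
  also have "\<dots> \<le> 4" using cos_ge_minus_one[of u] by argo
  finally have "fejer u * (1 + u\<^sup>2) \<le> 6" using fejer_le_2[of u] by (simp add: algebra_simps)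
  then show ?thesis by (simp add: field_simps add_pos_nonneg)
qed

lemma integrable_inverse_1_plus_square_lborel: "integrable lborel (\<lambda>x::real. inverse (1 + x\<^sup>2))"
  using integrable_inverse_1_plus_square
  by (simp add: set_integrable_def einterval_def)

lemma fejer_integrable: "integrable lborel fejer"
  by (rule Bochner_Integration.integrable_bound[OF integrable_mult_right[OF
      integrable_inverse_1_plus_square_lborel, of 6]])
     (auto intro!: AE_I2 simp: fejer_nonneg fejer_le)

text \<open>A nonnegative function with zero integral vanishes almost everywhere, whereas
  \<open>cos u < 1\<close> on the interval (0, 1). The integral serves below as the normalisation of
  the kernel.\<close>

lemma fejer_integral_pos: "0 < (LINT u|lborel. fejer u)"
proof -
  have "(LINT u|lborel. fejer u) \<noteq> 0"
  proof
    assume "(LINT u|lborel. fejer u) = 0"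
    then have "AE u in lborel. fejer u = 0"
      using integral_nonneg_eq_0_iff_AE[OF fejer_integrable] by (simp add: fejer_nonneg)
    moreover have "AE u in lborel. fejer u = 0 \<longrightarrow> u \<notin> {0<..<1}"
    proof (intro AE_I2 impI)
      fix u :: real assume "fejer u = 0"
      show "u \<notin> {0<..<1}"
      proof
        assume u: "u \<in> {0<..<1}"
        then have "cos u < cos 0" using pi_gt3 by (intro cos_monotone_0_pi) auto
        then show False using \<open>fejer u = 0\<close> u by (simp add: fejer_eq)
      qed
    qed
    ultimately have "AE u in lborel. u \<notin> {0<..<1::real}"
      by (rule AE_mp)
    then have "emeasure lborel {0<..<1::real} = 0"
      by (subst (asm) AE_iff_measurable[OF _ refl]) (auto simp: greaterThanLessThan_def greaterThan_def
          lessThan_def Int_def)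
    then show False by simp
  qed
  moreover have "0 \<le> (LINT u|lborel. fejer u)" by (intro integral_nonneg_AE) (simp add: fejer_nonneg)
  ultimately show ?thesis by simp
qed

text \<open>The window must outweigh the tails. Three quarters of the mass, paired with a point
  where the discrepancy exceeds two thirds of its supremum, leaves
  \<open>3/4 * 2/3 - 1/4 = 1/4\<close> in Esseen's argument.\<close>

lemma fejer_tail:
  obtains L where "0 < L" "(LINT u|lborel. indicator {-L..L} u * fejer u) \<ge> 3/4 * (LINT u|lborel. fejer u)"
proof -
  let ?c = "LINT u|lborel. fejer u"
  have "(\<lambda>n. LINT u|lborel. indicator {- real n..real n} u * fejer u) \<longlonglongrightarrow> ?c"
  proof (rule integral_dominated_convergence[where w=fejer])
    show "AE u in lborel. (\<lambda>n. indicator {- real n..real n} u * fejer u) \<longlonglongrightarrow> fejer u"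
    proof (rule AE_I2)
      fix u :: real
      obtain N where N: "\<bar>u\<bar> \<le> real N" using real_arch_simple by blast
      have "eventually (\<lambda>n. fejer u = indicator {- real n..real n} u * fejer u) sequentially"
        using eventually_ge_at_top[of N]
        by eventually_elim (use N in \<open>auto simp: indicator_def\<close>)
      then show "(\<lambda>n. indicator {- real n..real n} u * fejer u) \<longlonglongrightarrow> fejer u"
        by (rule tendsto_eventually[OF eventually_mono]) auto
    qed
  qed (auto simp: fejer_integrable fejer_nonneg indicator_def)
  then have "eventually (\<lambda>n. (LINT u|lborel. indicator {- real n..real n} u * fejer u) > 3/4
      * ?c) sequentially"
    by (rule order_tendstoD) (use fejer_integral_pos in simp)
  with eventually_gt_at_top[of 0] have "eventually (\<lambda>n. 0 < n
      \<and> (LINT u|lborel. indicator {- real n..real n} u * fejer u) > 3/4 * ?c) sequentially"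
    by eventually_elim auto
  then obtain n where "0 < n" "(LINT u|lborel. indicator {- real n..real n} u * fejer u) > 3/4 * ?c"
    by (auto simp: eventually_sequentially)
  then show thesis by (intro that[of "real n"]) auto
qed

section \<open>Smoothed distribution functions on the Fourier side\<close>

definition expint :: "real \<Rightarrow> real \<Rightarrow> real \<Rightarrow> complex" where
  "expint l r t = (CLINT v|lborel. indicator {l<..r} v *\<^sub>R iexp (t * v))"

lemma expint_measurable [measurable]: "expint l r \<in> borel_measurable borel"
  unfolding expint_def by measurable

lemma integrable_indicator_Ioc: "integrable lborel (\<lambda>v::real. indicator {l<..r} v :: real)"
  by (cases "l \<le> r") (auto intro!: integrable_real_indicator)

lemma integrable_expint: "integrable lborel (\<lambda>v. indicator {l<..r} v *\<^sub>R iexp (t * v))"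
  by (rule Bochner_Integration.integrable_bound[OF integrable_indicator_Ioc[of l r]])
     (auto intro!: AE_I2 simp: indicator_def)

text \<open>The bound does not depend on the length of the interval. This uniformity later lets the
  lower endpoint go to minus infinity; the pole at 0 is compensated by the factor \<open>|s|\<close>
  in Esseen's hypothesis.\<close>

lemma norm_expint_le:
  assumes "l \<le> r" "t \<noteq> 0"
  shows "norm (expint l r t) \<le> 2 / \<bar>t\<bar>"
proof -
  have [simp]: "- (\<i> * (z * \<i>)) = z" for z by (simp add: complex_eq_iff)
  have "((\<lambda>v. iexp (t * v)) has_integral (iexp (t * r) / (\<i> * t) - iexp (t * l) / (\<i> * t))) {l..r}"
    by (rule fundamental_theorem_of_calculus)
       (use assms in \<open>auto intro!: derivative_eq_intros has_vector_derivative_real_field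
         simp: has_vector_derivative_def[symmetric] scaleR_conv_of_real\<close>)
  then have "((\<lambda>v. if v \<in> {l..r} then iexp (t * v) else 0) has_integral (iexp (t * r) / (\<i> * t) - iexp (t
      * l) / (\<i> * t))) UNIV"
    by (subst has_integral_restrict_UNIV)
  then have "((\<lambda>v. indicator {l<..r} v *\<^sub>R iexp (t * v)) has_integral (iexp (t * r) / (\<i> * t) - iexp (t
      * l) / (\<i> * t))) UNIV"
    by (rule has_integral_spike[OF negligible_sing[of l], rotated]) (auto simp: indicator_def)
  moreover have "((\<lambda>v. indicator {l<..r} v *\<^sub>R iexp (t * v)) has_integral expint l r t) UNIV"
    unfolding expint_def by (rule has_integral_integral_lborel[OF integrable_expint])
  ultimately have "expint l r t = iexp (t * r) / (\<i> * t) - iexp (t * l) / (\<i> * t)"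
    by (rule has_integral_unique[symmetric])
  then have "norm (expint l r t) \<le> norm (iexp (t * r) / (\<i> * t)) + norm (iexp (t * l) / (\<i> * t))"
    by (simp add: norm_triangle_ineq4)
  also have "\<dots> = 2 / \<bar>t\<bar>" by (simp add: norm_divide norm_mult)
  finally show ?thesis .
qed

text \<open>After the substitution \<open>v = u + T * y\<close> the smoothed increment is the
  integral over a bounded interval of \<open>q\<close>, the convolution of the kernel with the law
  of \<open>T * y\<close>. Writing the kernel as the transform of \<open>tri\<close> brings in the
  characteristic function of \<open>N\<close>, at frequencies of size at most \<open>T\<close>.
  Increments are used rather than a single distribution function because the bounded interval makes
  Fubini applicable.\<close>

lemma fejer_smoothing:
  assumes "real_distribution N" and T: "0 < T" and ba: "b \<le> a"
  shows "(LINT u|lborel. fejer u * (cdf N (a - u / T) - cdf N (b - u / T)))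
     = (LINT t|lborel. tri t * Re (expint (T * b) (T * a) t * char N (- (t * T))))"
    and "integrable lborel (\<lambda>t. tri t * Re (expint (T * b) (T * a) t * char N (- (t * T))))"
proof -
  interpret N: real_distribution N by fact
  interpret P: pair_sigma_finite lborel N ..
  have sN [measurable_cong]: "sets N = sets borel" by simp
  let ?I = "{T * b<..T * a}"
  have fin: "emeasure lborel ?I < \<infinity>" using T ba by auto
  define q where "q v = (LINT y|N. fejer (v - T * y))" for v
  have iI: "integrable lborel (\<lambda>v. 2 * indicator ?I v :: real)"
    using fin by simp
  have int1: "integrable (lborel \<Otimes>\<^sub>M N) (\<lambda>(v, y). indicator ?I v * fejer (v - T * y))"
    by (rule integrable_pair_dominated[OF _ _ iI])
       (auto intro!: lborel.sigma_finite_measure_axioms N.prob_space_axioms simp: indicator_def abs_mult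
           fejer_le_2)
  have "(LINT u|lborel. fejer u * (cdf N (a - u / T) - cdf N (b - u / T)))
      = (LINT u|lborel. LINT y|N. fejer u * indicator ?I (u + T * y))"
  proof (rule Bochner_Integration.integral_cong[OF refl])
    fix u :: real
    have "(LINT y|N. fejer u * indicator ?I (u + T * y))
        = fejer u * (LINT y|N. indicator {b - u / T<..a - u / T} y)"
      using T by (subst integral_mult_right_zero[symmetric], intro Bochner_Integration.integral_cong)
         (auto simp: indicator_def field_simps)
    also have "\<dots> = fejer u * measure N {b - u / T<..a - u / T}" by simp
    also have "\<dots> = fejer u * (cdf N (a - u / T) - cdf N (b - u / T))"
      using ba T by (cases "b = a") (simp_all add: N.cdf_diff_eq)
    finally show "fejer u * (cdf N (a - u / T) - cdf N (b - u / T))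
        = (LINT y|N. fejer u * indicator ?I (u + T * y))" ..
  qed
  also have "\<dots> = (LINT y|N. LINT u|lborel. fejer u * indicator ?I (u + T * y))"
    by (rule P.Fubini_integral[symmetric], rule integrable_pair_dominated[OF _ _ fejer_integrable])
       (auto intro!: lborel.sigma_finite_measure_axioms N.prob_space_axioms simp: indicator_def
           fejer_nonneg)
  also have "\<dots> = (LINT y|N. LINT v|lborel. indicator ?I v * fejer (v - T * y))"
  proof (rule Bochner_Integration.integral_cong[OF refl])
    fix y
    show "(LINT u|lborel. fejer u * indicator ?I (u + T * y))
        = (LINT v|lborel. indicator ?I v * fejer (v - T * y))"
      by (subst lborel_integral_real_affine[where c=1 and t="- (T * y)"]) (auto simp: algebra_simps)
  qed
  also have "\<dots> = (LINT v|lborel. LINT y|N. indicator ?I v * fejer (v - T * y))"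
    by (rule P.Fubini_integral[OF int1])
  finally have lhs: "(LINT u|lborel. fejer u * (cdf N (a - u / T) - cdf N (b - u / T)))
      = (LINT v|lborel. indicator ?I v * q v)"
    by (simp add: q_def)
  have q: "q v = (LINT t|lborel. tri t * Re (iexp (t * v) * char N (- (t * T))))" for v
  proof -
    have "q v = (LINT y|N. LINT t|lborel. tri t * cos (t * (v - T * y)))"
      unfolding q_def fejer_def ..
    also have "\<dots> = (LINT t|lborel. LINT y|N. tri t * cos (t * (v - T * y)))"
      by (rule P.Fubini_integral, rule integrable_pair_dominated[OF _ _ integrable_indicator_interval])
         (auto intro!: lborel.sigma_finite_measure_axioms N.prob_space_axioms mult_le_one
            simp: indicator_def tri_def abs_mult)
    also have "\<dots> = (LINT t|lborel. tri t * Re (iexp (t * v) * char N (- (t * T))))"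
    proof (rule Bochner_Integration.integral_cong[OF refl])
      fix t
      have e: "iexp (t * v) * iexp (- (t * T) * y) = iexp (t * (v - T * y))" for y
        by (simp add: exp_add[symmetric] algebra_simps)
      have "Re (iexp (t * v) * char N (- (t * T))) = Re (CLINT y|N. iexp (t * v) * iexp (- (t * T) * y))"
        unfolding char_def by (subst integral_mult_right_zero) simp
      also have "\<dots> = (LINT y|N. Re (iexp (t * v) * iexp (- (t * T) * y)))"
        by (rule integral_Re[symmetric], intro integrable_mult_right N.integrable_iexp) auto
      also have "\<dots> = (LINT y|N. cos (t * (v - T * y)))"
        unfolding e by (simp add: Re_exp)
      finally show "(LINT y|N. tri t * cos (t * (v - T * y)))
          = tri t * Re (iexp (t * v) * char N (- (t * T)))"
        by simp
    qed
    finally show ?thesis .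
  qed
  have cm [measurable]: "(\<lambda>t. char N (- (t * T))) \<in> borel_measurable borel"
    by (rule measurable_compose[OF _ N.char_measurable]) simp
  have nb: "\<bar>Re (iexp s * char N s')\<bar> \<le> 1" for s s'
    using abs_Re_le_cmod[of "iexp s * char N s'"] N.cmod_char_le_1[of s'] by (simp add: norm_mult)
  \<comment> \<open>The dominating function is the indicator of a bounded rectangle:
    \<open>tri\<close> cuts off in \<open>t\<close>, the increment cuts off in
    \<open>v\<close>.\<close>
  have int2: "integrable (lborel \<Otimes>\<^sub>M lborel) (\<lambda>(t, v). indicator ?I v * (tri t * Re (iexp (t * v)
      * char N (- (t * T)))))"
  proof (rule Bochner_Integration.integrable_bound)
    show "integrable (lborel \<Otimes>\<^sub>M lborel) (\<lambda>p. indicator ({-1..1::real} \<times> ?I) p :: real)"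
    proof (rule integrable_real_indicator)
      show "{-1..1::real} \<times> ?I \<in> sets (lborel \<Otimes>\<^sub>M lborel)" by (intro pair_measureI) auto
      have "emeasure (lborel \<Otimes>\<^sub>M lborel) ({-1..1::real} \<times> ?I)
          = emeasure lborel {-1..1::real} * emeasure lborel ?I"
        by (rule lborel.emeasure_pair_measure_Times) auto
      then show "emeasure (lborel \<Otimes>\<^sub>M lborel) ({-1..1::real} \<times> ?I) < \<infinity>"
        using fin by (simp add: ennreal_mult_less_top)
    qed
    show "AE p in lborel \<Otimes>\<^sub>M lborel. norm ((\<lambda>(t, v). indicator ?I v * (tri t * Re (iexp (t * v)
        * char N (- (t * T))))) p)
        \<le> norm (indicator ({-1..1::real} \<times> ?I) p :: real)"
      by (intro AE_I2) (auto simp: indicator_def tri_def abs_mult simp del: Re_exp times_complex.sel intro!: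
          mult_le_one nb[of "_ * _", unfolded of_real_mult])
  qed measurable
  have "(LINT v|lborel. indicator ?I v * q v)
     = (LINT v|lborel. LINT t|lborel. indicator ?I v * (tri t * Re (iexp (t * v) * char N (- (t * T)))))"
    unfolding q by simp
  also have "\<dots> = (LINT t|lborel. LINT v|lborel. indicator ?I v * (tri t * Re (iexp (t * v) * char N (- (t
      * T)))))"
    by (rule lborel_pair.Fubini_integral[OF int2])
  finally have rhs: "(LINT v|lborel. indicator ?I v * q v)
     = (LINT t|lborel. LINT v|lborel. indicator ?I v * (tri t * Re (iexp (t * v) * char N (- (t * T)))))" .
  have *: "(LINT v|lborel. indicator ?I v * (tri t * Re (iexp (t * v) * char N (- (t * T)))))
     = tri t * Re (expint (T * b) (T * a) t * char N (- (t * T)))" for t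
  proof -
    have "(LINT v|lborel. indicator ?I v * (tri t * Re (iexp (t * v) * char N (- (t * T)))))
       = (LINT v|lborel. tri t * Re ((indicator ?I v *\<^sub>R iexp (t * v)) * char N (- (t * T))))"
      by (intro Bochner_Integration.integral_cong) (auto simp: indicator_def)
    also have "\<dots> = tri t * Re (expint (T * b) (T * a) t * char N (- (t * T)))"
      using integral_Re[OF integrable_mult_left[OF integrable_expint], of "T * b" "T * a" t "char N (- (t
          * T))"]
      by (simp only: integral_mult_right_zero integral_mult_left_zero expint_def)
    finally show ?thesis .
  qed
  show "(LINT u|lborel. fejer u * (cdf N (a - u / T) - cdf N (b - u / T)))
     = (LINT t|lborel. tri t * Re (expint (T * b) (T * a) t * char N (- (t * T))))"
    unfolding lhs rhs * ..
  show "integrable lborel (\<lambda>t. tri t * Re (expint (T * b) (T * a) t * char N (- (t * T))))"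
    using lborel_pair.integrable_fst'[OF int2] by (simp only: prod.case *)
qed


section \<open>Comparison with the normal distribution function\<close>

lemma normal_density_le: "std_normal_density x \<le> 1"
proof -
  have "1 \<le> sqrt (2 * pi)" using pi_gt3 by simp
  then have "1 / sqrt (2 * pi) * exp (- x\<^sup>2 / 2) \<le> 1 * 1"
    by (intro mult_mono) (auto simp: field_simps)
  then show ?thesis by (simp add: std_normal_density_def)
qed

lemma cdf_std_normal_Lipschitz:
  assumes "x \<le> y"
  shows "cdf std_normal_distribution y \<le> cdf std_normal_distribution x + (y - x)"
proof (cases "x = y")
  case False
  interpret G: real_distribution std_normal_distribution by (rule real_dist_normal_dist)
  have "cdf std_normal_distribution y - cdf std_normal_distribution x
      = measure std_normal_distribution {x<..y}"
    using assms False by (simp add: G.cdf_diff_eq)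
  also have "\<dots> \<le> y - x"
  proof -
    have "emeasure std_normal_distribution {x<..y}
        = (\<integral>\<^sup>+ u. ennreal (std_normal_density u) * indicator {x<..y} u \<partial>lborel)"
      by (subst emeasure_density) auto
    also have "\<dots> \<le> (\<integral>\<^sup>+ u. indicator {x<..y} u \<partial>lborel)"
      by (intro nn_integral_mono) (auto simp: indicator_def normal_density_le)
    also have "\<dots> = ennreal (y - x)" using assms by simp
    finally show ?thesis using assms by (simp add: G.emeasure_eq_measure)
  qed
  finally show ?thesis by simp
qed simp

text \<open>The \<open>|s|\<close> in the hypothesis cancels the pole of \<open>expint\<close>; what
  remains is a rescaled \<open>1 / (1 + t^2)\<close> of integral \<open>pi\<close>, hence the
  constant \<open>2 * pi\<close>. The estimate is made for increments first, then the lower endpoint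
  is sent to minus infinity.\<close>

lemma smoothed_cdf_diff_le:
  assumes N: "real_distribution N" and T: "0 < T" and eps: "0 \<le> \<epsilon>"
    and ch: "\<And>s. \<bar>s\<bar> \<le> T \<Longrightarrow> norm (char N s - char std_normal_distribution s) \<le> \<epsilon> * \<bar>s\<bar> / (1 + s\<^sup>2)"
  shows "\<bar>LINT u|lborel. fejer u * (cdf N (a - u / T) - cdf std_normal_distribution (a - u / T))\<bar>
      \<le> 2 * pi * \<epsilon>"
proof -
  let ?G = "std_normal_distribution"
  interpret N: real_distribution N by fact
  interpret G: real_distribution ?G by (rule real_dist_normal_dist)
  define H where "H b = (LINT u|lborel. fejer u * (cdf N (b - u / T) - cdf ?G (b - u / T)))" for b
  have cm [measurable]: "cdf N \<in> borel_measurable borel" "cdf ?G \<in> borel_measurable borel"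
    by (auto intro!: borel_measurable_mono monoI N.cdf_nondecreasing G.cdf_nondecreasing)
  have dom: "\<bar>fejer u * (cdf N c - cdf ?G c')\<bar> \<le> fejer u" for u c c'
    using N.cdf_nonneg[of c] N.cdf_bounded_prob[of c] G.cdf_nonneg[of c'] G.cdf_bounded_prob[of c']
    by (auto simp: abs_mult fejer_nonneg intro!: mult_left_le)
  have domN: "\<bar>fejer u * (cdf N c - cdf N c')\<bar> \<le> fejer u" for u c c'
    using N.cdf_nonneg[of c] N.cdf_bounded_prob[of c] N.cdf_nonneg[of c'] N.cdf_bounded_prob[of c']
    by (auto simp: abs_mult fejer_nonneg intro!: mult_left_le)
  have domG: "\<bar>fejer u * (cdf ?G c - cdf ?G c')\<bar> \<le> fejer u" for u c c'
    using G.cdf_nonneg[of c] G.cdf_bounded_prob[of c] G.cdf_nonneg[of c'] G.cdf_bounded_prob[of c']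
    by (auto simp: abs_mult fejer_nonneg intro!: mult_left_le)
  have int: "integrable lborel (\<lambda>u. fejer u * (cdf N (b - u / T) - cdf ?G (b - u / T)))" for b
    by (rule Bochner_Integration.integrable_bound[OF fejer_integrable]) (auto simp: dom fejer_nonneg)
  have intN: "integrable lborel (\<lambda>u. fejer u * (cdf N (b - u / T) - cdf N (c - u / T)))" for b c
    by (rule Bochner_Integration.integrable_bound[OF fejer_integrable]) (auto simp: domN fejer_nonneg)
  have intG: "integrable lborel (\<lambda>u. fejer u * (cdf ?G (b - u / T) - cdf ?G (c - u / T)))" for b c
    by (rule Bochner_Integration.integrable_bound[OF fejer_integrable]) (auto simp: domG fejer_nonneg)
  have step: "\<bar>H a - H b\<bar> \<le> 2 * pi * \<epsilon>" if ba: "b \<le> a" for b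
  proof -
    let ?f = "\<lambda>N t. tri t * Re (expint (T * b) (T * a) t * char N (- (t * T)))"
    have "H a - H b = (LINT u|lborel. fejer u * (cdf N (a - u / T) - cdf N (b - u / T)) - fejer u
        * (cdf ?G (a - u / T) - cdf ?G (b - u / T)))"
      unfolding H_def by (subst Bochner_Integration.integral_diff[symmetric, OF int int]) (simp add:
          algebra_simps)
    also have "\<dots> = (LINT t|lborel. ?f N t) - (LINT t|lborel. ?f ?G t)"
      by (subst Bochner_Integration.integral_diff[OF intN intG])
         (simp add: fejer_smoothing(1)[OF N T ba] fejer_smoothing(1)[OF real_dist_normal_dist T ba])
    also have "\<dots> = (LINT t|lborel. ?f N t - ?f ?G t)"
      by (rule Bochner_Integration.integral_diff[symmetric])
         (rule fejer_smoothing(2)[OF N T ba] fejer_smoothing(2)[OF real_dist_normal_dist T ba])+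
    finally have eq: "H a - H b = (LINT t|lborel. ?f N t - ?f ?G t)" .
    have "norm (LINT t|lborel. ?f N t - ?f ?G t) \<le> (LINT t|lborel. 2 * T * \<epsilon> * inverse (1 + (T * t)\<^sup>2))"
    proof (rule norm_integral_le)
      show "integrable lborel (\<lambda>t. ?f N t - ?f ?G t)"
        by (rule Bochner_Integration.integrable_diff)
           (rule fejer_smoothing(2)[OF N T ba] fejer_smoothing(2)[OF real_dist_normal_dist T ba])+
      show "integrable lborel (\<lambda>t. 2 * T * \<epsilon> * inverse (1 + (T * t)\<^sup>2))"
        by (intro integrable_mult_right lborel_integrable_real_affine[OF
            integrable_inverse_1_plus_square_lborel, of T 0, unfolded add_0]) (use T in auto)
      show "norm (?f N t - ?f ?G t) \<le> 2 * T * \<epsilon> * inverse (1 + (T * t)\<^sup>2)" for t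
      proof (cases "t \<in> {-1..1} \<and> t \<noteq> 0")
        case True
        have "norm (?f N t - ?f ?G t) = tri t * \<bar>Re (expint (T * b) (T * a) t * (char N (- (t * T))
            - char ?G (- (t * T))))\<bar>"
        proof -
          have "?f N t - ?f ?G t = tri t * Re (expint (T * b) (T * a) t * (char N (- (t * T))
              - char ?G (- (t * T))))"
            by (simp add: algebra_simps)
          then show ?thesis using tri_bounds(1)[of t] by (simp only: real_norm_def abs_mult abs_of_nonneg)
        qed
        also have "\<dots> \<le> 1 * norm (expint (T * b) (T * a) t * (char N (- (t * T)) - char ?G (- (t * T))))"
          using tri_bounds[of t] by (intro mult_mono abs_Re_le_cmod) (auto simp: tri_def indicator_def)
        also have "\<dots> \<le> (2 / \<bar>t\<bar>) * (\<epsilon> * \<bar>- (t * T)\<bar> / (1 + (- (t * T))\<^sup>2))"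
          unfolding norm_mult mult_1_left
          using True T by (intro mult_mono norm_expint_le[OF mult_left_mono[OF ba]] ch) (auto simp: abs_mult
              mult_left_le_one_le)
        also have "\<dots> = 2 * T * \<epsilon> * inverse (1 + (T * t)\<^sup>2)"
          using True T by (simp add: abs_mult field_simps)
        finally show ?thesis .
      next
        case False
        show ?thesis
        proof (cases "t = 0")
          case True
          have "char N 0 = 1" "char ?G 0 = 1" by (rule N.char_zero, rule G.char_zero)
          with True show ?thesis using T eps by simp
        next
          case False
          with \<open>\<not> (t \<in> {-1..1} \<and> t \<noteq> 0)\<close> show ?thesis using T eps by (simp add: tri_def)
        qed
      qed
    qed
    also have "\<dots> = 2 * T * \<epsilon> * (LINT t|lborel. inverse (1 + (T * t)\<^sup>2))"
      by (rule integral_mult_right_zero)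
    finally have le: "\<bar>H a - H b\<bar> \<le> 2 * T * \<epsilon> * (LINT t|lborel. inverse (1 + (T * t)\<^sup>2))"
      unfolding eq real_norm_def .
    have "T * (LINT t|lborel. inverse (1 + (T * t)\<^sup>2)) = (LINT t|lborel. inverse (1 + t\<^sup>2))"
      using T lborel_integral_real_affine[of T "\<lambda>t. inverse (1 + t\<^sup>2)" 0] by simp
    also have "\<dots> = pi"
      using LBINT_inverse_1_plus_square
        by (simp add: interval_lebesgue_integral_def set_lebesgue_integral_def einterval_def)
    finally have I: "T * (LINT t|lborel. inverse (1 + (T * t)\<^sup>2)) = pi" .
    have "2 * T * \<epsilon> * z = 2 * \<epsilon> * (T * z)" for z by simp
    from le[unfolded this I] show ?thesis by (simp only: mult_ac)
  qed
  \<comment> \<open>Both distribution functions vanish at minus infinity. Dominated convergence with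
    majorant \<open>fejer\<close> removes the lower endpoint from \<open>step\<close>, whose bound
    is uniform in it.\<close>
  have "(\<lambda>n. H (- real n)) \<longlonglongrightarrow> (LINT (u::real)|lborel. 0)"
    unfolding H_def
  proof (rule integral_dominated_convergence[where w=fejer])
    show "AE u in lborel. (\<lambda>n. fejer u * (cdf N (- real n - u / T) - cdf ?G (- real n - u / T))) \<longlonglongrightarrow> 0"
    proof (rule AE_I2)
      fix u
      have l: "filterlim (\<lambda>n. - real n - u / T) at_bot sequentially"
        unfolding filterlim_at_bot
      proof
        fix Z
        obtain k where k: "- Z - u / T \<le> real k" using real_arch_simple by blast
        show "\<forall>\<^sub>F n in sequentially. - real n - u / T \<le> Z"
          using eventually_ge_at_top[of k] by eventually_elim (use k in linarith)
      qed
      have "(\<lambda>n. fejer u * (cdf N (- real n - u / T) - cdf ?G (- real n - u / T))) \<longlonglongrightarrow> fejer u * (0 - 0)"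
        by (intro tendsto_intros filterlim_compose[OF N.cdf_lim_at_bot l] filterlim_compose[OF
            G.cdf_lim_at_bot l])
      then show "(\<lambda>n. fejer u * (cdf N (- real n - u / T) - cdf ?G (- real n - u / T))) \<longlonglongrightarrow> 0" by simp
    qed
  qed (auto simp: fejer_integrable dom)
  then have "(\<lambda>n. \<bar>H a - H (- real n)\<bar>) \<longlonglongrightarrow> \<bar>H a - 0\<bar>"
    by (intro tendsto_intros) simp
  then have "\<bar>H a - 0\<bar> \<le> 2 * pi * \<epsilon>"
  proof (rule LIMSEQ_le_const2)
    obtain k where k: "- a \<le> real k" using real_arch_simple by blast
    have "\<bar>H a - H (- real n)\<bar> \<le> 2 * pi * \<epsilon>" if "k \<le> n" for n
      using that k by (intro step) linarith
    then show "\<exists>k. \<forall>n\<ge>k. \<bar>H a - H (- real n)\<bar> \<le> 2 * pi * \<epsilon>" by blast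
  qed
  then show ?thesis by (simp add: H_def)
qed

text \<open>Near a point where the discrepancy almost attains its supremum \<open>\<eta>\<close>,
  monotonicity of \<open>cdf N\<close> and the Lipschitz bound for the normal law keep it large,
  with constant sign, on a one-sided window of length \<open>2 * L / T\<close>. Centering the kernel
  on that window bounds the smoothed discrepancy from below, while the characteristic functions
  bound it from above.\<close>

theorem esseen_inequality:
  obtains C where "0 < C"
    "\<And>N \<epsilon> T x. real_distribution N \<Longrightarrow> 0 < T \<Longrightarrow> 0 \<le> \<epsilon> \<Longrightarrow>
      (\<And>s. \<bar>s\<bar> \<le> T \<Longrightarrow> norm (char N s - char std_normal_distribution s) \<le> \<epsilon> * \<bar>s\<bar> / (1 + s\<^sup>2)) \<Longrightarrow>
      \<bar>cdf N x - cdf std_normal_distribution x\<bar> \<le> C * (\<epsilon> + 1 / T)"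
proof -
  let ?G = "std_normal_distribution"
  let ?c = "LINT u|lborel. fejer u"
  have c0: "0 < ?c" by (rule fejer_integral_pos)
  obtain L where L: "0 < L" and tail: "(LINT u|lborel. indicator {-L..L} u * fejer u) \<ge> 3/4 * ?c"
    by (rule fejer_tail)
  interpret G: real_distribution ?G by (rule real_dist_normal_dist)
  let ?C = "8 * pi / ?c + 6 * L"
  show thesis
  proof (rule that[of ?C])
    show "0 < ?C" using c0 L by (auto intro!: add_nonneg_pos)
    fix N :: "real measure" and \<epsilon> T x :: real
    assume N: "real_distribution N" and T: "0 < T" and eps: "0 \<le> \<epsilon>"
      and ch: "\<And>s. \<bar>s\<bar> \<le> T \<Longrightarrow> norm (char N s - char ?G s) \<le> \<epsilon> * \<bar>s\<bar> / (1 + s\<^sup>2)"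
    interpret N: real_distribution N by fact
    let ?D = "\<lambda>x. cdf N x - cdf ?G x"
    have cm [measurable]: "cdf N \<in> borel_measurable borel" "cdf ?G \<in> borel_measurable borel"
      by (auto intro!: borel_measurable_mono monoI N.cdf_nondecreasing G.cdf_nondecreasing)
    have D1: "\<bar>?D y\<bar> \<le> 1" for y
      using N.cdf_nonneg[of y] N.cdf_bounded_prob[of y] G.cdf_nonneg[of y] G.cdf_bounded_prob[of y] by auto
    define \<eta> where "\<eta> = (SUP y. \<bar>?D y\<bar>)"
    have bdd: "bdd_above (range (\<lambda>y. \<bar>?D y\<bar>))" by (rule bdd_aboveI2[OF D1])
    have le_eta: "\<bar>?D y\<bar> \<le> \<eta>" for y unfolding \<eta>_def by (rule cSUP_upper[OF _ bdd]) simp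
    have eta0: "0 \<le> \<eta>" using le_eta[of 0] by linarith
    have int: "integrable lborel (\<lambda>u. fejer u * ?D (a - u / T))" for a
      by (rule Bochner_Integration.integrable_bound[OF fejer_integrable])
         (auto simp: abs_mult fejer_nonneg D1 intro!: mult_left_le)
    have int_ind: "integrable lborel (\<lambda>u. indicator {-L..L} u * fejer u)"
      by (rule Bochner_Integration.integrable_bound[OF fejer_integrable])
         (auto simp: indicator_def fejer_nonneg)
    \<comment> \<open>Inside the window the signed discrepancy is at least \<open>z\<close>, outside
      at least \<open>- \<eta>\<close>. Subtracting \<open>\<eta>\<close> times the full mass puts
      both cases into one integrand.\<close>
    have lower: "z * (3/4 * ?c) - \<eta> * (?c / 4) \<le> \<bar>LINT u|lborel. fejer u * ?D (a - u / T)\<bar>"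
      if z: "0 \<le> z" and sg: "\<bar>sg\<bar> = 1" and D: "\<And>u. \<bar>u\<bar> \<le> L \<Longrightarrow> z \<le> sg * ?D (a - u / T)" for z a sg
    proof -
      have "(z + \<eta>) * (3/4 * ?c) - \<eta> * ?c
          \<le> (z + \<eta>) * (LINT u|lborel. indicator {-L..L} u * fejer u) - \<eta> * ?c"
        using z eta0 tail by (intro diff_right_mono mult_left_mono) auto
      also have "\<dots> = (LINT u|lborel. (z + \<eta>) * (indicator {-L..L} u * fejer u) - \<eta> * fejer u)"
        by (subst Bochner_Integration.integral_diff) (auto intro!: int_ind fejer_integrable
            integrable_mult_right)
      also have "\<dots> \<le> (LINT u|lborel. sg * (fejer u * ?D (a - u / T)))"
      proof (rule integral_mono)
        fix u
        have "sg * ?D (a - u / T) \<ge> - \<eta>"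
          using le_eta[of "a - u / T"] sg by (auto simp: abs_if split: if_splits)
        then have "fejer u * (if \<bar>u\<bar> \<le> L then z else - \<eta>) \<le> fejer u * (sg * ?D (a - u / T))"
          by (intro mult_left_mono fejer_nonneg) (auto intro: D)
        then show "(z + \<eta>) * (indicator {-L..L} u * fejer u) - \<eta> * fejer u
            \<le> sg * (fejer u * ?D (a - u / T))"
          by (auto simp: indicator_def abs_le_iff algebra_simps split: if_splits)
      qed (auto intro!: int_ind fejer_integrable integrable_mult_right int
          Bochner_Integration.integrable_diff)
      also have "\<dots> \<le> \<bar>LINT u|lborel. fejer u * ?D (a - u / T)\<bar>"
        using sg by (auto simp: abs_if split: if_splits)
      finally show ?thesis by (simp add: algebra_simps)
    qed
    have key: "\<eta> * (?c / 4) \<le> 2 * pi * \<epsilon> + 3/2 * ?c * L / T"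
    proof (cases "\<eta> = 0")
      case True
      then show ?thesis using eps c0 L T by simp
    next
      case False
      then have "2/3 * \<eta> < \<eta>" using eta0 by simp
      then obtain y where y: "2/3 * \<eta> < \<bar>?D y\<bar>"
        unfolding \<eta>_def using less_cSUP_iff[OF _ bdd] by blast
      \<comment> \<open>Across a window of length \<open>2 * L / T\<close> the normal distribution
        function moves by at most that length. If nothing is left after this loss,
        \<open>\<eta>\<close> itself is of order \<open>1 / T\<close>.\<close>
      define z where "z = \<bar>?D y\<bar> - 2 * L / T"
      show ?thesis
      proof (cases "0 \<le> z")
        case False
        then have "\<eta> \<le> 3 * L / T" using y by (simp add: z_def)
        then have "\<eta> * (?c / 4) \<le> 3 * L / T * (?c / 4)" using c0 by (intro mult_right_mono) auto
        also have "\<dots> \<le> 2 * pi * \<epsilon> + 3/2 * ?c * L / T"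
          using eps c0 L T by (simp add: field_simps)
        finally show ?thesis .
      next
        case True
        have "\<exists>a. z * (3/4 * ?c) - \<eta> * (?c / 4) \<le> \<bar>LINT u|lborel. fejer u * ?D (a - u / T)\<bar>"
        proof (cases "0 \<le> ?D y")
          \<comment> \<open>A positive discrepancy persists to the right, where \<open>cdf N\<close>
            can only grow, so the kernel is centered at \<open>y + L / T\<close>. The other sign is
            the mirror image.\<close>
          case Dy: True
          have "z \<le> 1 * ?D (y + L / T - u / T)" if "\<bar>u\<bar> \<le> L" for u
          proof -
            have "\<bar>u / T\<bar> \<le> L / T" using that T by (simp add: abs_divide divide_right_mono)
            then have 1: "y \<le> y + L / T - u / T" "y + L / T - u / T - y \<le> 2 * L / T" by linarith+
            have "cdf N y \<le> cdf N (y + L / T - u / T)" using 1 by (intro N.cdf_nondecreasing)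
            moreover have "cdf ?G (y + L / T - u / T) \<le> cdf ?G y + (y + L / T - u / T - y)"
              using 1 by (intro cdf_std_normal_Lipschitz)
            ultimately show ?thesis using 1 Dy by (simp add: z_def)
          qed
          then show ?thesis by (intro exI lower[OF True, of 1]) auto
        next
          case Dy: False
          have "z \<le> (-1) * ?D (y - L / T - u / T)" if "\<bar>u\<bar> \<le> L" for u
          proof -
            have "\<bar>u / T\<bar> \<le> L / T" using that T by (simp add: abs_divide divide_right_mono)
            then have 1: "y - L / T - u / T \<le> y" "y - (y - L / T - u / T) \<le> 2 * L / T" by linarith+
            have "cdf N (y - L / T - u / T) \<le> cdf N y" using 1 by (intro N.cdf_nondecreasing)
            moreover have "cdf ?G y \<le> cdf ?G (y - L / T - u / T) + (y - (y - L / T - u / T))"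
              using 1 by (intro cdf_std_normal_Lipschitz)
            ultimately show ?thesis using 1 Dy by (simp add: z_def)
          qed
          then show ?thesis by (intro exI lower[OF True, of "-1"]) auto
        qed
        then obtain a where "z * (3/4 * ?c) - \<eta> * (?c / 4) \<le> \<bar>LINT u|lborel. fejer u * ?D (a - u / T)\<bar>"
          by blast
        also have "\<dots> \<le> 2 * pi * \<epsilon>" by (rule smoothed_cdf_diff_le[OF N T eps ch])
        finally have *: "z * (3/4 * ?c) - \<eta> * (?c / 4) \<le> 2 * pi * \<epsilon>" .
        have "(2/3 * \<eta> - 2 * L / T) * (3/4 * ?c) \<le> z * (3/4 * ?c)"
          using y c0 by (intro mult_right_mono) (auto simp: z_def)
        moreover have "(2/3 * \<eta> - 2 * L / T) * (3/4 * ?c) - \<eta> * (?c / 4) = \<eta> * (?c / 4) - 3/2 * ?c * L / T"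
          using T by (simp add: field_simps)
        moreover have "Y \<le> E + W" if "X \<le> Z" "X - Y = Y - W" "Z - Y \<le> E" for X Y Z W E :: real
          using that by linarith
        ultimately show ?thesis using * by blast
      qed
    qed
    have "\<bar>?D x\<bar> \<le> \<eta>" by (rule le_eta)
    also have "\<eta> = \<eta> * (?c / 4) * (4 / ?c)" using c0 by simp
    also have "\<dots> \<le> (2 * pi * \<epsilon> + 3/2 * ?c * L / T) * (4 / ?c)"
      using key c0 by (intro mult_right_mono) auto
    also have "\<dots> = 8 * pi / ?c * \<epsilon> + 6 * L * (1 / T)"
      using c0 T by (simp add: field_simps)
    also have "\<dots> \<le> ?C * (\<epsilon> + 1 / T)"
      unfolding distrib_left using c0 T L eps by (intro add_mono mult_right_mono) auto
    finally show "\<bar>?D x\<bar> \<le> ?C * (\<epsilon> + 1 / T)" .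
  qed
qed

section \<open>Iterated function systems contracting in mean\<close>

text \<open>Interpolation between the cubic remainder bound for small arguments and the quadratic
  one for large arguments: a power between 2 and 3 dominates both, so a moment of order
  \<open>p\<close> controls the remainder.\<close>

lemma norm_taylor2:
  fixes y p :: real
  assumes p: "2 \<le> p" "p \<le> 3"
  shows "norm (iexp y - 1 - \<i> * y + y\<^sup>2 / 2) \<le> \<bar>y\<bar> powr p"
proof (cases "\<bar>y\<bar> \<le> 1")
  case True
  have "norm (iexp y - 1 - \<i> * y + y\<^sup>2 / 2) \<le> \<bar>y\<bar> ^ 3 / 6"
    using iexp_approx1[of y 2] by (simp add: numeral_eq_Suc power_mult_distrib algebra_simps)
  also have "\<dots> \<le> \<bar>y\<bar> powr 3" by (cases "y = 0") (auto simp: powr_numeral)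
  also have "\<dots> \<le> \<bar>y\<bar> powr p" using p True by (intro powr_mono') auto
  finally show ?thesis .
next
  case False
  have "norm (iexp y - 1 - \<i> * y + y\<^sup>2 / 2) \<le> \<bar>y\<bar> ^ 2"
    using iexp_approx2[of y 2] by (simp add: numeral_eq_Suc power_mult_distrib algebra_simps)
  also have "\<dots> = \<bar>y\<bar> powr 2" using False by (subst powr_numeral) auto
  also have "\<dots> \<le> \<bar>y\<bar> powr p" using p False by (intro powr_mono) auto
  finally show ?thesis .
qed

lemma norm_taylor1:
  fixes y q :: real
  assumes q: "1 \<le> q" "q \<le> 2"
  shows "norm (iexp y - 1 - \<i> * y) \<le> 2 * \<bar>y\<bar> powr q"
proof (cases "\<bar>y\<bar> \<le> 1")
  case True
  have "norm (iexp y - 1 - \<i> * y) \<le> \<bar>y\<bar> ^ 2 / 2"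
    using iexp_approx1[of y 1] by (simp add: numeral_eq_Suc algebra_simps)
  also have "\<dots> \<le> \<bar>y\<bar> powr 2" by (cases "y = 0") (auto simp: powr_numeral)
  also have "\<dots> \<le> \<bar>y\<bar> powr q" using q True by (intro powr_mono') auto
  also have "\<dots> \<le> 2 * \<bar>y\<bar> powr q" by simp
  finally show ?thesis .
next
  case False
  have "norm (iexp y - 1 - \<i> * y) \<le> 2 * \<bar>y\<bar>"
    using iexp_approx2[of y 1] by (simp add: numeral_eq_Suc algebra_simps)
  also have "\<dots> = 2 * \<bar>y\<bar> powr 1" using False by simp
  also have "\<dots> \<le> 2 * \<bar>y\<bar> powr q" using q False by (intro mult_left_mono powr_mono) auto
  finally show ?thesis .
qed

lemma norm_iexp_diff_le: "norm (iexp y - iexp z) \<le> \<bar>y - z\<bar>"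
proof -
  have "iexp y - iexp z = iexp z * (iexp (y - z) - 1)"
    by (simp add: algebra_simps flip: exp_add)
  then have "norm (iexp y - iexp z) = norm (iexp (y - z) - 1)" by (simp add: norm_mult)
  also have "\<dots> \<le> \<bar>y - z\<bar>" using iexp_approx1[of "y - z" 0] by simp
  finally show ?thesis .
qed

text \<open>Mean value inequality: the derivative of \<open>R\<close> is \<open>\<i>\<close> times
  the first-order remainder, to which \<open>norm_taylor1\<close> applies with exponent
  \<open>p - 1\<close>. This supplies the Lipschitz half of the bound on the Taylor remainder of the
  twisted operator.\<close>

lemma norm_taylor2_diff_le:
  fixes y z p m :: real
  assumes p: "2 \<le> p" "p \<le> 3" and m: "\<bar>y\<bar> \<le> m" "\<bar>z\<bar> \<le> m"
  defines "R \<equiv> \<lambda>y. iexp y - 1 - \<i> * y + y\<^sup>2 / 2"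
  shows "norm (R y - R z) \<le> 2 * m powr (p - 1) * \<bar>y - z\<bar>"
proof -
  have "norm (R y - R z) \<le> 2 * m powr (p - 1) * norm (y - z)"
  proof (rule differentiable_bound[where S="{-m..m}" and f'="\<lambda>y h. h *\<^sub>R (\<i> * (iexp y - 1 - \<i> * y))"])
    fix u assume u: "u \<in> {-m..m}"
    show "(R has_derivative (\<lambda>h. h *\<^sub>R (\<i> * (iexp u - 1 - \<i> * u)))) (at u within {-m..m})"
      unfolding R_def has_vector_derivative_def[symmetric]
      by (auto intro!: derivative_eq_intros has_vector_derivative_real_field simp: algebra_simps
          power2_eq_square of_real_def[symmetric] scaleR_conv_of_real
           simp flip: mult.assoc)
    show "onorm (\<lambda>h. h *\<^sub>R (\<i> * (iexp u - 1 - \<i> * u))) \<le> 2 * m powr (p - 1)"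
    proof (rule onorm_bound)
      fix h :: real
      have "norm (iexp u - 1 - \<i> * u) \<le> 2 * \<bar>u\<bar> powr (p - 1)" using p by (intro norm_taylor1) auto
      also have "\<dots> \<le> 2 * m powr (p - 1)" using u p by (intro mult_left_mono powr_mono2) auto
      finally show "norm (h *\<^sub>R (\<i> * (iexp u - 1 - \<i> * u))) \<le> 2 * m powr (p - 1) * norm h"
        by (simp add: norm_mult mult.commute mult_left_mono)
    qed simp
  qed (use m in auto)
  then show ?thesis by simp
qed

lemma power_diff_bound:
  fixes a b r :: real
  assumes "0 \<le> a" "a \<le> r" "0 \<le> b" "b \<le> r"
  shows "\<bar>a ^ Suc n - b ^ Suc n\<bar> \<le> real (Suc n) * r ^ n * \<bar>a - b\<bar>"
proof (induction n)
  case (Suc n)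
  have "a ^ Suc (Suc n) - b ^ Suc (Suc n) = a * (a ^ Suc n - b ^ Suc n) + b ^ Suc n * (a - b)"
    by (simp add: algebra_simps)
  then have "\<bar>a ^ Suc (Suc n) - b ^ Suc (Suc n)\<bar> \<le> a * \<bar>a ^ Suc n - b ^ Suc n\<bar> + b ^ Suc n * \<bar>a - b\<bar>"
    using assms by (metis abs_triangle_ineq abs_mult abs_of_nonneg zero_le_power)
  also have "\<dots> \<le> r * (real (Suc n) * r ^ n * \<bar>a - b\<bar>) + r ^ Suc n * \<bar>a - b\<bar>"
    using assms Suc.IH by (intro add_mono mult_mono mult_right_mono power_mono) auto
  also have "\<dots> = real (Suc (Suc n)) * r ^ Suc n * \<bar>a - b\<bar>" by (simp add: algebra_simps)
  finally show ?case .
qed simp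

lemma exp_minus_bounds:
  fixes u :: real
  assumes "0 \<le> u"
  shows "1 - u \<le> exp (- u)" "exp (- u) \<le> 1 - u + u\<^sup>2"
proof -
  show "1 - u \<le> exp (- u)" using exp_ge_add_one_self[of "- u"] by simp
  have "1 \<le> (1 + u) * (1 - u + u\<^sup>2)" using assms by (simp add: algebra_simps power2_eq_square)
  also have "\<dots> \<le> exp u * (1 - u + u\<^sup>2)"
  proof (rule mult_right_mono)
    show "1 + u \<le> exp u" by (rule exp_ge_add_one_self)
    have "1 - u + u\<^sup>2 = (u - 1/2)\<^sup>2 + 3/4" by (simp add: power2_eq_square algebra_simps)
    then show "0 \<le> 1 - u + u\<^sup>2" by simp
  qed
  finally show "exp (- u) \<le> 1 - u + u\<^sup>2" by (simp add: exp_minus field_simps)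
qed

section \<open>The abstract setting and its Lipschitz calculus\<close>

text \<open>The setting is abstract because it is instantiated twice: with the cocycle itself and
  with its centered modification. One function \<open>l\<close> bounds both the size and the
  Lipschitz constant of \<open>\<sigma>\<close>, and \<open>1 \<le> l g\<close> turns its moment of
  order \<open>p\<close> into the lower ones. Contraction by \<open>\<theta>\<close> holds in mean;
  the deterministic bound \<open>K\<close> serves where a variation is multiplied by an unbounded
  factor before averaging.\<close>

locale contracting_ifs =
  fixes \<mu> :: "'g measure" and X :: "'x measure" and act :: "'g \<Rightarrow> 'x \<Rightarrow> 'x"
    and D :: "'x \<Rightarrow> 'x \<Rightarrow> real" and \<theta> K :: real
    and \<sigma> :: "'g \<Rightarrow> 'x \<Rightarrow> real" and l :: "'g \<Rightarrow> real" and p :: real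
  assumes prob: "prob_space \<mu>"
    and act_pair: "(\<lambda>(g, x). act g x) \<in> measurable (\<mu> \<Otimes>\<^sub>M X) X"
    and X_nonempty: "space X \<noteq> {}"
    and D_nonneg: "\<And>x y. x \<in> space X \<Longrightarrow> y \<in> space X \<Longrightarrow> 0 \<le> D x y"
    and D_le_1: "\<And>x y. x \<in> space X \<Longrightarrow> y \<in> space X \<Longrightarrow> D x y \<le> 1"
    and D_meas: "\<And>x y. x \<in> space X \<Longrightarrow> y \<in> space X \<Longrightarrow> (\<lambda>g. D (act g x) (act g y)) \<in> borel_measurable \<mu>"
    and D_contr: "\<And>x y. x \<in> space X \<Longrightarrow> y \<in> space X \<Longrightarrow> (\<integral>g. D (act g x) (act g y) \<partial>\<mu>) \<le> \<theta> * D x y"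
    and D_lip: "\<And>g x y. g \<in> space \<mu> \<Longrightarrow> x \<in> space X \<Longrightarrow> y \<in> space X \<Longrightarrow> D (act g x) (act g y) \<le> K * D x y"
    and theta: "0 \<le> \<theta>" "\<theta> < 1" and K: "0 \<le> K"
    and \<sigma>_pair: "(\<lambda>(g, x). \<sigma> g x) \<in> borel_measurable (\<mu> \<Otimes>\<^sub>M X)"
    and l_meas [measurable]: "l \<in> borel_measurable \<mu>"
    and l_ge_1: "\<And>g. g \<in> space \<mu> \<Longrightarrow> 1 \<le> l g"
    and l_int: "integrable \<mu> (\<lambda>g. l g powr p)"
    and p: "2 < p" "p \<le> 3"
    and \<sigma>_bound: "\<And>g x. g \<in> space \<mu> \<Longrightarrow> x \<in> space X \<Longrightarrow> \<bar>\<sigma> g x\<bar> \<le> l g"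
    and \<sigma>_lip: "\<And>g x y. g \<in> space \<mu> \<Longrightarrow> x \<in> space X \<Longrightarrow> y \<in> space X \<Longrightarrow> \<bar>\<sigma> g x - \<sigma> g y\<bar> \<le> l g * D x y"
begin

sublocale prob_space \<mu> by (rule prob)

lemma act_measurable [measurable (raw)]:
  "f \<in> measurable N \<mu> \<Longrightarrow> h \<in> measurable N X \<Longrightarrow> (\<lambda>w. act (f w) (h w)) \<in> measurable N X"
  using measurable_compose[OF measurable_Pair act_pair] by (simp add: split_beta)

lemma \<sigma>_measurable [measurable (raw)]:
  "f \<in> measurable N \<mu> \<Longrightarrow> h \<in> measurable N X \<Longrightarrow> (\<lambda>w. \<sigma> (f w) (h w)) \<in> borel_measurable N"
  using measurable_compose[OF measurable_Pair \<sigma>_pair] by (simp add: split_beta)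

lemma act_in_space [simp]: "g \<in> space \<mu> \<Longrightarrow> x \<in> space X \<Longrightarrow> act g x \<in> space X"
  using measurable_space[OF act_pair, of "(g, x)"] by (simp add: space_pair_measure)

lemma l_powr_mono: "g \<in> space \<mu> \<Longrightarrow> q \<le> p \<Longrightarrow> l g powr q \<le> l g powr p"
  using l_ge_1 by (intro powr_mono) auto

lemma l_integrable: "integrable \<mu> l"
proof (rule Bochner_Integration.integrable_bound[OF l_int])
  show "AE g in \<mu>. norm (l g) \<le> norm (l g powr p)"
  proof (rule AE_I2)
    fix g assume g: "g \<in> space \<mu>"
    show "norm (l g) \<le> norm (l g powr p)" using l_powr_mono[OF g, of 1] l_ge_1[OF g] p by simp
  qed
qed simp

lemma l_sq_integrable: "integrable \<mu> (\<lambda>g. (l g)\<^sup>2)"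
proof (rule Bochner_Integration.integrable_bound[OF l_int])
  show "AE g in \<mu>. norm ((l g)\<^sup>2) \<le> norm (l g powr p)"
  proof (rule AE_I2)
    fix g assume g: "g \<in> space \<mu>"
    show "norm ((l g)\<^sup>2) \<le> norm (l g powr p)" using l_powr_mono[OF g, of 2] l_ge_1[OF g] p
      by (simp add: powr_numeral)
  qed
qed simp

text \<open>Seminorm bound and supremum bound are kept apart because the twisted operators treat
  them differently: they preserve \<open>B\<close>, and shrink \<open>L\<close> up to a term
  proportional to \<open>B\<close>.\<close>

definition Lip :: "real \<Rightarrow> real \<Rightarrow> ('x \<Rightarrow> 'b::{banach, second_countable_topology}) \<Rightarrow> bool" where
  "Lip L B f \<longleftrightarrow> f \<in> borel_measurable X \<and> 0 \<le> L \<and> (\<forall>x\<in>space X. norm (f x) \<le> B)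
     \<and> (\<forall>x\<in>space X. \<forall>y\<in>space X. norm (f x - f y) \<le> L * D x y)"

lemma LipD:
  assumes "Lip L B f"
  shows "f \<in> borel_measurable X" "0 \<le> L" "x \<in> space X \<Longrightarrow> norm (f x) \<le> B"
    "x \<in> space X \<Longrightarrow> y \<in> space X \<Longrightarrow> norm (f x - f y) \<le> L * D x y"
  using assms by (auto simp: Lip_def)

lemma Lip_B_nonneg: "Lip L B f \<Longrightarrow> 0 \<le> B"
  using X_nonempty by (auto simp: Lip_def) (meson norm_ge_zero order_trans)

lemma Lip_osc: "Lip L B f \<Longrightarrow> x \<in> space X \<Longrightarrow> y \<in> space X \<Longrightarrow> norm (f x - f y) \<le> L"
  using D_le_1[of x y] LipD(2)[of L B f] LipD(4)[of L B f x y] by (meson mult_left_le order_trans)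

lemma Lip_mono: "Lip L B f \<Longrightarrow> L \<le> L' \<Longrightarrow> B \<le> B' \<Longrightarrow> Lip L' B' f"
  unfolding Lip_def using D_nonneg
    by (auto intro: order_trans mult_right_mono) (meson mult_right_mono order_trans)

lemma Lip_cong: "(\<And>x. x \<in> space X \<Longrightarrow> f x = g x) \<Longrightarrow> Lip L B f \<longleftrightarrow> Lip L B g"
  unfolding Lip_def by (simp cong: measurable_cong)

lemma Lip_const: "norm c \<le> B \<Longrightarrow> Lip 0 B (\<lambda>_. c)"
  by (simp add: Lip_def)

lemma Lip_add: assumes "Lip L B f" "Lip L' B' g" shows "Lip (L + L') (B + B') (\<lambda>x. f x + g x)"
  unfolding Lip_def
proof (intro conjI ballI)
  show "(\<lambda>x. f x + g x) \<in> borel_measurable X" using assms by (auto simp: Lip_def)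
  show "0 \<le> L + L'" using assms by (auto simp: Lip_def)
  fix x assume x: "x \<in> space X"
  show "norm (f x + g x) \<le> B + B'" using assms x by (auto simp: Lip_def intro: norm_triangle_mono)
  fix y assume y: "y \<in> space X"
  have "norm (f x + g x - (f y + g y)) \<le> norm (f x - f y) + norm (g x - g y)"
    by (metis add_diff_add norm_triangle_ineq)
  also have "\<dots> \<le> (L + L') * D x y" using LipD(4)[OF assms(1) x y] LipD(4)[OF assms(2) x y]
    by (simp add: algebra_simps)
  finally show "norm (f x + g x - (f y + g y)) \<le> (L + L') * D x y" .
qed

lemma Lip_mult: fixes c :: "'b::{real_normed_field, banach, second_countable_topology}"
  assumes "Lip L B f" shows "Lip (norm c * L) (norm c * B) (\<lambda>x. c * f x)"
  unfolding Lip_def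
proof (intro conjI ballI)
  show "(\<lambda>x. c * f x) \<in> borel_measurable X" using assms by (auto simp: Lip_def)
  show "0 \<le> norm c * L" using assms by (auto simp: Lip_def)
  fix x assume x: "x \<in> space X"
  show "norm (c * f x) \<le> norm c * B" using assms x by (auto simp: Lip_def norm_mult intro: mult_left_mono)
  fix y assume y: "y \<in> space X"
  have "norm (c * f x - c * f y) = norm c * norm (f x - f y)"
    by (simp add: norm_mult flip: right_diff_distrib)
  also have "\<dots> \<le> norm c * (L * D x y)" using LipD(4)[OF assms(1) x y] by (intro mult_left_mono) auto
  finally show "norm (c * f x - c * f y) \<le> norm c * L * D x y" by (simp add: mult.assoc)
qed

lemma Lip_of_real: "Lip L B f \<Longrightarrow> Lip L B (\<lambda>x. complex_of_real (f x))"
  by (auto simp: Lip_def simp flip: of_real_diff)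

text \<open>Common source of the Lipschitz estimates for all operators. Variation of the coefficient
  is paid for by the mean of \<open>J\<close>; variation through the image points is paid for by
  \<open>b * \<theta>\<close>, since \<open>D\<close> contracts in mean.\<close>

lemma Lip_average:
  fixes F :: "'g \<Rightarrow> 'x \<Rightarrow> 'b::{banach, second_countable_topology}"
  assumes F: "(\<lambda>(x, g). F g x) \<in> borel_measurable (X \<Otimes>\<^sub>M \<mu>)"
    and H: "integrable \<mu> H" and J: "integrable \<mu> J" and Jn: "\<And>g. g \<in> space \<mu> \<Longrightarrow> 0 \<le> J g" and b: "0 \<le> b"
    and FH: "\<And>g x. g \<in> space \<mu> \<Longrightarrow> x \<in> space X \<Longrightarrow> norm (F g x) \<le> H g"
    and FJ: "\<And>g x y. g \<in> space \<mu> \<Longrightarrow> x \<in> space X \<Longrightarrow> y \<in> space X \<Longrightarrow>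
       norm (F g x - F g y) \<le> J g * D x y + b * D (act g x) (act g y)"
  shows "x \<in> space X \<Longrightarrow> integrable \<mu> (\<lambda>g. F g x)"
    and "Lip ((\<integral>g. J g \<partial>\<mu>) + b * \<theta>) (\<integral>g. H g \<partial>\<mu>) (\<lambda>x. \<integral>g. F g x \<partial>\<mu>)"
proof -
  have Fm: "(\<lambda>g. F g x) \<in> borel_measurable \<mu>" if "x \<in> space X" for x
    using measurable_compose[OF measurable_Pair1'[OF that] F] by simp
  show int: "integrable \<mu> (\<lambda>g. F g x)" if "x \<in> space X" for x
  proof (rule Bochner_Integration.integrable_bound[OF H Fm[OF that]])
    show "AE g in \<mu>. norm (F g x) \<le> norm (H g)"
      by (intro AE_I2 order_trans[OF FH]) (use that in auto)
  qed
  have Dint: "integrable \<mu> (\<lambda>g. D (act g x) (act g y))" if "x \<in> space X" "y \<in> space X" for x y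
    by (rule integrable_const_bound[where B=1]) (use that in \<open>auto intro!: AE_I2 D_meas D_le_1 simp: D_nonneg\<close>)
  show "Lip ((\<integral>g. J g \<partial>\<mu>) + b * \<theta>) (\<integral>g. H g \<partial>\<mu>) (\<lambda>x. \<integral>g. F g x \<partial>\<mu>)"
    unfolding Lip_def
  proof (intro conjI ballI)
    show "(\<lambda>x. \<integral>g. F g x \<partial>\<mu>) \<in> borel_measurable X"
      by (rule borel_measurable_lebesgue_integral[OF F])
    show "0 \<le> (\<integral>g. J g \<partial>\<mu>) + b * \<theta>" using Jn b theta by (intro add_nonneg_nonneg integral_nonneg_AE) auto
    fix x assume x: "x \<in> space X"
    show "norm (\<integral>g. F g x \<partial>\<mu>) \<le> (\<integral>g. H g \<partial>\<mu>)"
      by (rule norm_integral_le[OF int[OF x] H]) (rule FH[OF _ x])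
    fix y assume y: "y \<in> space X"
    have "norm ((\<integral>g. F g x \<partial>\<mu>) - (\<integral>g. F g y \<partial>\<mu>)) = norm (\<integral>g. F g x - F g y \<partial>\<mu>)"
      by (simp add: int x y)
    also have "\<dots> \<le> (\<integral>g. J g * D x y + b * D (act g x) (act g y) \<partial>\<mu>)"
      by (rule norm_integral_le)
         (use x y in \<open>auto intro!: int J FJ Dint Bochner_Integration.integrable_add integrable_mult_left integrable_mult_right Bochner_Integration.integrable_diff\<close>)
    also have "\<dots> = (\<integral>g. J g \<partial>\<mu>) * D x y + b * (\<integral>g. D (act g x) (act g y) \<partial>\<mu>)"
      using J Dint[OF x y] by (subst Bochner_Integration.integral_add) auto
    also have "\<dots> \<le> (\<integral>g. J g \<partial>\<mu>) * D x y + b * (\<theta> * D x y)"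
      using D_contr[OF x y] b by (intro add_left_mono mult_left_mono) auto
    finally show "norm ((\<integral>g. F g x \<partial>\<mu>) - (\<integral>g. F g y \<partial>\<mu>)) \<le> ((\<integral>g. J g \<partial>\<mu>) + b * \<theta>) * D x y"
      by (simp add: algebra_simps)
  qed
qed

lemma Lip_comp_act [measurable]:
  assumes "Lip L B f"
  shows "(\<lambda>(x, g). f (act g x)) \<in> borel_measurable (X \<Otimes>\<^sub>M \<mu>)"
  using LipD(1)[OF assms] by measurable

section \<open>The Markov operator and its Poisson equation\<close>

definition markov :: "('x \<Rightarrow> real) \<Rightarrow> 'x \<Rightarrow> real" where
  "markov f x = (\<integral>g. f (act g x) \<partial>\<mu>)"

lemma markov_Lip:
  assumes f: "Lip L B f"
  shows "x \<in> space X \<Longrightarrow> integrable \<mu> (\<lambda>g. f (act g x))" and "Lip (\<theta> * L) B (markov f)"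
proof -
  note A = Lip_average[where F="\<lambda>g x. f (act g x)" and J="\<lambda>_. 0" and H="\<lambda>_. B" and b=L]
  show "x \<in> space X \<Longrightarrow> integrable \<mu> (\<lambda>g. f (act g x))"
    by (rule A(1)) (use f LipD[OF f] in \<open>auto intro: Lip_comp_act\<close>)
  have "Lip ((\<integral>g. 0 \<partial>\<mu>) + L * \<theta>) (\<integral>g. B \<partial>\<mu>) (\<lambda>x. \<integral>g. f (act g x) \<partial>\<mu>)"
    by (rule A(2)) (use f LipD[OF f] in \<open>auto intro: Lip_comp_act\<close>)
  then show "Lip (\<theta> * L) B (markov f)" by (simp add: markov_def[abs_def] mult.commute prob_space)
qed

lemma markov_pow_Lip: "Lip L B f \<Longrightarrow> Lip (\<theta> ^ n * L) B ((markov ^^ n) f)"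
  by (induction n) (auto dest: markov_Lip simp: mult.assoc)

text \<open>Oscillations decay like \<open>\<theta> ^ n\<close>. The next iterate at
  \<open>x0\<close> is an average of the current one over the images of \<open>x0\<close>, so
  consecutive values differ by at most one oscillation and form a Cauchy sequence; the same decay
  makes the limit independent of the point. The limit plays the role of the integral against the
  invariant measure.\<close>

lemma markov_limit:
  assumes f: "Lip L B f" and x0: "x0 \<in> space X"
  obtains c where "\<And>x. x \<in> space X \<Longrightarrow> (\<lambda>n. (markov ^^ n) f x) \<longlonglongrightarrow> c"
proof -
  let ?f = "\<lambda>n. (markov ^^ n) f"
  note fL = markov_pow_Lip[OF f]
  have geo: "summable (\<lambda>n. \<theta> ^ n * L)" using theta by (intro summable_mult2 summable_geometric) auto
  have step: "norm (?f (Suc n) x0 - ?f n x0) \<le> \<theta> ^ n * L" for n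
  proof -
    have "?f (Suc n) x0 - ?f n x0 = (\<integral>g. ?f n (act g x0) - ?f n x0 \<partial>\<mu>)"
      using markov_Lip(1)[OF fL x0, of n] by (simp add: markov_def prob_space)
    moreover have "norm (\<integral>g. ?f n (act g x0) - ?f n x0 \<partial>\<mu>) \<le> (\<integral>g. \<theta> ^ n * L \<partial>\<mu>)"
      by (rule norm_integral_le)
         (use markov_Lip(1)[OF fL x0, of n] x0 in \<open>auto intro!: Lip_osc[OF fL, unfolded real_norm_def]\<close>)
    ultimately show ?thesis by (simp add: prob_space)
  qed
  have "summable (\<lambda>n. ?f (Suc n) x0 - ?f n x0)"
    by (rule summable_comparison_test'[OF geo, of 0]) (use step in auto)
  from tendsto_add[OF tendsto_const[of "?f 0 x0"] summable_LIMSEQ[OF this]]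
  have "convergent (\<lambda>n. ?f n x0)"
    by (subst (asm) sum_lessThan_telescope) (auto simp: convergent_def)
  then obtain c where c: "(\<lambda>n. ?f n x0) \<longlonglongrightarrow> c" by (auto simp: convergent_def)
  have "(\<lambda>n. ?f n x) \<longlonglongrightarrow> c" if x: "x \<in> space X" for x
  proof -
    have "(\<lambda>n. ?f n x - ?f n x0) \<longlonglongrightarrow> 0"
      by (rule Lim_null_comparison[OF _ summable_LIMSEQ_zero[OF geo]])
         (auto intro!: always_eventually Lip_osc[OF fL, unfolded real_norm_def] x x0)
    from tendsto_add[OF this c] show ?thesis by simp
  qed
  then show thesis by (rule that)
qed

text \<open>The solution is the potential series of \<open>f\<close>. Subtracting in each term the
  value at \<open>x0\<close> makes the terms decay through their oscillation alone. One constant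
  \<open>C\<close> serves as Lipschitz and as supremum bound because \<open>D\<close> is at most
  1.\<close>

lemma poisson_equation:
  assumes f: "Lip L B (f :: 'x \<Rightarrow> real)"
  obtains \<psi> c C where "Lip C C \<psi>" "\<And>x. x \<in> space X \<Longrightarrow> \<psi> x - markov \<psi> x = f x - c"
proof -
  obtain x0 where x0: "x0 \<in> space X" using X_nonempty by blast
  obtain c where c: "\<And>x. x \<in> space X \<Longrightarrow> (\<lambda>n. (markov ^^ n) f x) \<longlonglongrightarrow> c"
    by (rule markov_limit[OF f x0]) blast
  let ?f = "\<lambda>n. (markov ^^ n) f"
  note fL = markov_pow_Lip[OF f]
  have geo: "summable (\<lambda>n. \<theta> ^ n * L)" using theta by (intro summable_mult2 summable_geometric) auto
  define C where "C = (\<Sum>n. \<theta> ^ n * L)"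
  define \<psi> where "\<psi> x = (\<Sum>n. ?f n x - ?f n x0)" for x
  have le: "norm (?f n x - ?f n y) \<le> \<theta> ^ n * L" if "x \<in> space X" "y \<in> space X" for n x y
    by (rule Lip_osc[OF fL that])
  have sm: "summable (\<lambda>n. norm (?f n x - ?f n x0))" if "x \<in> space X" for x
    by (rule summable_comparison_test'[OF geo, of 0]) (use le[OF that x0] in auto)
  have [measurable]: "?f n \<in> borel_measurable X" for n using fL LipD(1) by blast
  have L0: "0 \<le> L" using LipD(2)[OF f] .
  have "Lip C C \<psi>"
    unfolding Lip_def
  proof (intro conjI ballI)
    show "\<psi> \<in> borel_measurable X" unfolding \<psi>_def by measurable
    show "0 \<le> C" unfolding C_def using L0 theta by (intro suminf_nonneg geo) auto
    fix x assume x: "x \<in> space X"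
    show "norm (\<psi> x) \<le> C" unfolding \<psi>_def C_def
      by (rule order_trans[OF summable_norm[OF sm[OF x]] suminf_le[OF _ sm[OF x] geo]]) (rule le[OF x x0])
    fix y assume y: "y \<in> space X"
    have dle: "norm (?f n x - ?f n y) \<le> \<theta> ^ n * L * D x y" for n by (rule LipD(4)[OF fL x y])
    have sm2: "summable (\<lambda>n. norm (?f n x - ?f n y))"
      by (rule summable_comparison_test'[OF geo, of 0]) (use le[OF x y] in auto)
    have "\<psi> x - \<psi> y = (\<Sum>n. (?f n x - ?f n x0) - (?f n y - ?f n x0))" unfolding \<psi>_def
      by (rule suminf_diff[OF summable_norm_cancel[OF sm[OF x]] summable_norm_cancel[OF sm[OF y]]])
    also have "\<dots> = (\<Sum>n. ?f n x - ?f n y)" by simp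
    finally have eq: "\<psi> x - \<psi> y = (\<Sum>n. ?f n x - ?f n y)" .
    have "norm (\<psi> x - \<psi> y) \<le> (\<Sum>n. \<theta> ^ n * L * D x y)"
      unfolding eq
      by (rule order_trans[OF summable_norm[OF sm2] suminf_le[OF dle sm2]]) (rule summable_mult2[OF geo])
    also have "\<dots> = C * D x y" unfolding C_def by (rule suminf_mult2[OF geo, symmetric])
    finally show "norm (\<psi> x - \<psi> y) \<le> C * D x y" .
  qed
  moreover have "\<psi> x - markov \<psi> x = f x - c" if x: "x \<in> space X" for x
  proof -
    have iF: "integrable \<mu> (\<lambda>g. ?f n (act g x) - ?f n x0)" for n using markov_Lip(1)[OF fL x] by simp
    have "markov \<psi> x = (\<Sum>n. \<integral>g. ?f n (act g x) - ?f n x0 \<partial>\<mu>)"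
      unfolding markov_def[of \<psi> x] unfolding \<psi>_def
    proof (rule integral_suminf[OF iF])
      show "AE g in \<mu>. summable (\<lambda>n. norm (?f n (act g x) - ?f n x0))"
        by (intro AE_I2 sm) (use x in auto)
      show "summable (\<lambda>n. \<integral>g. norm (?f n (act g x) - ?f n x0) \<partial>\<mu>)"
      proof (rule summable_comparison_test'[OF geo, of 0])
        fix n
        have "norm (\<integral>g. norm (?f n (act g x) - ?f n x0) \<partial>\<mu>) \<le> (\<integral>g. \<theta> ^ n * L \<partial>\<mu>)"
          by (rule norm_integral_le) (use iF x x0 le in auto)
        then show "norm (\<integral>g. norm (?f n (act g x) - ?f n x0) \<partial>\<mu>) \<le> \<theta> ^ n * L" by (simp add: prob_space)
      qed
    qed
    also have "\<dots> = (\<Sum>n. ?f (Suc n) x - ?f n x0)"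
      using markov_Lip(1)[OF fL x] by (simp add: markov_def prob_space)
    finally have P: "markov \<psi> x = (\<Sum>n. ?f (Suc n) x - ?f n x0)" .
    \<comment> \<open>The values at the base point cancel, and the difference telescopes from
      \<open>f x\<close> to the limit \<open>c\<close>.\<close>
    have tel: "(\<lambda>n. ?f n x - ?f (Suc n) x) sums (?f 0 x - c)"
      by (rule telescope_sums'[OF c[OF x]])
    have s1: "summable (\<lambda>n. ?f n x - ?f n x0)" by (rule summable_norm_cancel[OF sm[OF x]])
    have s2: "summable (\<lambda>n. ?f (Suc n) x - ?f n x0)"
      using summable_diff[OF s1 sums_summable[OF tel]] by simp
    have "\<psi> x - markov \<psi> x = (\<Sum>n. (?f n x - ?f n x0) - (?f (Suc n) x - ?f n x0))"
      unfolding P \<psi>_def by (rule suminf_diff[OF s1 s2])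
    also have "\<dots> = f x - c" using sums_unique[OF tel] by simp
    finally show ?thesis .
  qed
  ultimately show thesis by (rule that)
qed

lemma mean_Lip: "Lip (\<integral>g. l g \<partial>\<mu>) (\<integral>g. l g \<partial>\<mu>) (\<lambda>x. \<integral>g. \<sigma> g x \<partial>\<mu>)"
proof -
  have "Lip ((\<integral>g. l g \<partial>\<mu>) + 0 * \<theta>) (\<integral>g. l g \<partial>\<mu>) (\<lambda>x. \<integral>g. \<sigma> g x \<partial>\<mu>)"
    by (rule Lip_average(2)) (use l_ge_1 in \<open>auto intro!: l_integrable \<sigma>_bound \<sigma>_lip intro: order_trans[OF zero_le_one]\<close>)
  then show ?thesis by simp
qed

lemma \<sigma>_integrable: "x \<in> space X \<Longrightarrow> integrable \<mu> (\<lambda>g. \<sigma> g x)"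
  by (rule Bochner_Integration.integrable_bound[OF l_integrable])
     (auto intro!: AE_I2 order_trans[OF \<sigma>_bound])

text \<open>Factoring the difference of squares makes the Lipschitz constant quadratic in
  \<open>l\<close>. For a centered cocycle this average is the conditional variance, and its Poisson
  equation provides \<open>U\<close>.\<close>

lemma square_Lip:
  "Lip (\<integral>g. 2 * (l g)\<^sup>2 \<partial>\<mu>) (\<integral>g. (l g)\<^sup>2 \<partial>\<mu>) (\<lambda>x. \<integral>g. (\<sigma> g x)\<^sup>2 \<partial>\<mu>)"
  and \<sigma>_sq_integrable: "x \<in> space X \<Longrightarrow> integrable \<mu> (\<lambda>g. (\<sigma> g x)\<^sup>2)"
proof -
  have b: "norm ((\<sigma> g x)\<^sup>2) \<le> (l g)\<^sup>2" if "g \<in> space \<mu>" "x \<in> space X" for g x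
    using \<sigma>_bound[OF that] by (simp add: abs_le_square_iff[symmetric])
  have d: "norm ((\<sigma> g x)\<^sup>2 - (\<sigma> g y)\<^sup>2) \<le> 2 * (l g)\<^sup>2 * D x y + 0 * D (act g x) (act g y)"
    if "g \<in> space \<mu>" "x \<in> space X" "y \<in> space X" for g x y
  proof -
    have "norm ((\<sigma> g x)\<^sup>2 - (\<sigma> g y)\<^sup>2) = \<bar>\<sigma> g x + \<sigma> g y\<bar> * \<bar>\<sigma> g x - \<sigma> g y\<bar>"
      by (simp add: power2_eq_square square_diff_square_factored abs_mult)
    also have "\<dots> \<le> (2 * l g) * (l g * D x y)"
      using that \<sigma>_bound[of g x] \<sigma>_bound[of g y] l_ge_1[of g] by (intro mult_mono \<sigma>_lip) auto
    finally show ?thesis by (simp add: power2_eq_square)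
  qed
  show "x \<in> space X \<Longrightarrow> integrable \<mu> (\<lambda>g. (\<sigma> g x)\<^sup>2)"
    by (rule Lip_average(1)[OF _ l_sq_integrable integrable_mult_right[OF l_sq_integrable, of 2] _ _ b d])
      auto
  have "Lip ((\<integral>g. 2 * (l g)\<^sup>2 \<partial>\<mu>) + 0 * \<theta>) (\<integral>g. (l g)\<^sup>2 \<partial>\<mu>) (\<lambda>x. \<integral>g. (\<sigma> g x)\<^sup>2 \<partial>\<mu>)"
    by (rule Lip_average(2)[OF _ l_sq_integrable integrable_mult_right[OF l_sq_integrable, of 2] _ _ b d])
        auto
  then show "Lip (\<integral>g. 2 * (l g)\<^sup>2 \<partial>\<mu>) (\<integral>g. (l g)\<^sup>2 \<partial>\<mu>) (\<lambda>x. \<integral>g. (\<sigma> g x)\<^sup>2 \<partial>\<mu>)" by simp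
qed

end

section \<open>Twisted transfer operators\<close>

context contracting_ifs
begin

definition twisted :: "real \<Rightarrow> ('x \<Rightarrow> complex) \<Rightarrow> 'x \<Rightarrow> complex" where
  "twisted t f x = (\<integral>g. iexp (t * \<sigma> g x) * f (act g x) \<partial>\<mu>)"

definition l_mean :: real where "l_mean = (\<integral>g. l g \<partial>\<mu>)"

lemma l_mean_nonneg: "0 \<le> l_mean"
  unfolding l_mean_def using l_ge_1
    by (intro integral_nonneg_AE) (auto intro!: AE_I2 intro: order_trans[OF zero_le_one])

lemma twisted_integrand_bounds:
  assumes f: "Lip L B f"
  shows "(\<lambda>(x, g). iexp (t * \<sigma> g x) * f (act g x)) \<in> borel_measurable (X \<Otimes>\<^sub>M \<mu>)"
    and "g \<in> space \<mu> \<Longrightarrow> x \<in> space X \<Longrightarrow> norm (iexp (t * \<sigma> g x) * f (act g x)) \<le> B"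
    and "g \<in> space \<mu> \<Longrightarrow> x \<in> space X \<Longrightarrow> y \<in> space X \<Longrightarrow>
      norm (iexp (t * \<sigma> g x) * f (act g x) - iexp (t * \<sigma> g y) * f (act g y))
        \<le> \<bar>t\<bar> * B * l g * D x y + L * D (act g x) (act g y)"
proof -
  note [measurable] = Lip_comp_act[OF f]
  show "(\<lambda>(x, g). iexp (t * \<sigma> g x) * f (act g x)) \<in> borel_measurable (X \<Otimes>\<^sub>M \<mu>)"
    using LipD(1)[OF f] by measurable
  show "g \<in> space \<mu> \<Longrightarrow> x \<in> space X \<Longrightarrow> norm (iexp (t * \<sigma> g x) * f (act g x)) \<le> B"
    using LipD(3)[OF f, of "act g x"] by (simp add: norm_mult)
  assume g: "g \<in> space \<mu>" and x: "x \<in> space X" and y: "y \<in> space X"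
  have "norm (iexp (t * \<sigma> g x) - iexp (t * \<sigma> g y)) \<le> \<bar>t\<bar> * (l g * D x y)"
    using norm_iexp_diff_le[of "t * \<sigma> g x" "t * \<sigma> g y"] mult_left_mono[OF \<sigma>_lip[OF g x y], of "\<bar>t\<bar>"]
    by (simp add: abs_mult flip: right_diff_distrib)
  then have 1: "norm ((iexp (t * \<sigma> g x) - iexp (t * \<sigma> g y)) * f (act g x)) \<le> \<bar>t\<bar> * (l g * D x y) * B"
    unfolding norm_mult using LipD(3)[OF f, of "act g x"] g x y D_nonneg[OF x y] l_ge_1[OF g]
    by (intro mult_mono) auto
  have 2: "norm (iexp (t * \<sigma> g y) * (f (act g x) - f (act g y))) \<le> L * D (act g x) (act g y)"
    using LipD(4)[OF f, of "act g x" "act g y"] g x y by (simp add: norm_mult)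
  have "iexp (t * \<sigma> g x) * f (act g x) - iexp (t * \<sigma> g y) * f (act g y)
    = (iexp (t * \<sigma> g x) - iexp (t * \<sigma> g y)) * f (act g x) + iexp (t * \<sigma> g y) * (f (act g x) - f (act g y))"
    by (simp add: algebra_simps)
  from norm_triangle_mono[OF 1 2, folded this]
  show "norm (iexp (t * \<sigma> g x) * f (act g x) - iexp (t * \<sigma> g y) * f (act g y))
        \<le> \<bar>t\<bar> * B * l g * D x y + L * D (act g x) (act g y)"
    by (simp only: mult_ac)
qed

lemma twisted_integrable:
  assumes f: "Lip L B f" and x: "x \<in> space X"
  shows "integrable \<mu> (\<lambda>g. iexp (t * \<sigma> g x) * f (act g x))"
proof (rule Lip_average(1)[where J="\<lambda>g. \<bar>t\<bar> * B
    * l g" and H="\<lambda>_. B" and b=L, OF twisted_integrand_bounds(1)[OF f]])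
  show "integrable \<mu> (\<lambda>g. \<bar>t\<bar> * B * l g)" using l_integrable by simp
  show "0 \<le> \<bar>t\<bar> * B * l g" if "g \<in> space \<mu>" for g using l_ge_1[OF that] Lip_B_nonneg[OF f] by simp
qed (use twisted_integrand_bounds[OF f] LipD(2)[OF f] x in auto)

text \<open>A Doeblin-Fortet inequality: the seminorm contracts by \<open>\<theta>\<close>, and the
  variation of the phase adds a term linear in \<open>|t|\<close> that sees only the supremum
  bound.\<close>

lemma twisted_Lip:
  assumes f: "Lip L B f"
  shows "Lip (\<theta> * L + \<bar>t\<bar> * B * l_mean) B (twisted t f)"
proof -
  have "Lip ((\<integral>g. \<bar>t\<bar> * B * l g \<partial>\<mu>) + L * \<theta>) (\<integral>g. B \<partial>\<mu>) (\<lambda>x. \<integral>g. iexp (t * \<sigma> g x) * f (act g x) \<partial>\<mu>)"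
  proof (rule Lip_average(2)[OF twisted_integrand_bounds(1)[OF f]])
    show "integrable \<mu> (\<lambda>g. \<bar>t\<bar> * B * l g)" using l_integrable by simp
    show "0 \<le> \<bar>t\<bar> * B * l g" if "g \<in> space \<mu>" for g using l_ge_1[OF that] Lip_B_nonneg[OF f] by simp
  qed (use twisted_integrand_bounds[OF f] LipD(2)[OF f] in auto)
  then show ?thesis by (simp add: twisted_def[abs_def] prob_space l_mean_def algebra_simps)
qed

text \<open>Fixed point of \<open>z = \<theta> * z + l_mean\<close>, which bounds what iterating the
  preceding inequality accumulates.\<close>

definition l_pot :: real where "l_pot = l_mean / (1 - \<theta>)"

lemma l_pot_nonneg: "0 \<le> l_pot"
  unfolding l_pot_def using l_mean_nonneg theta by simp

lemma twisted_pow_Lip: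
  assumes f: "Lip L B f"
  shows "Lip (\<theta> ^ n * L + l_pot * \<bar>t\<bar> * B) B ((twisted t ^^ n) f)"
proof (induction n)
  case 0
  show ?case using l_pot_nonneg Lip_B_nonneg[OF f] by (auto intro!: Lip_mono[OF f])
next
  case (Suc n)
  have pot: "\<theta> * l_pot + l_mean = l_pot" using theta by (simp add: l_pot_def field_simps)
  have "\<theta> * (\<theta> ^ n * L + l_pot * \<bar>t\<bar> * B) + \<bar>t\<bar> * B * l_mean
      = \<theta> ^ Suc n * L + (\<theta> * l_pot + l_mean) * (\<bar>t\<bar> * B)"
    by (simp add: algebra_simps)
  then have "\<theta> * (\<theta> ^ n * L + l_pot * \<bar>t\<bar> * B) + \<bar>t\<bar> * B * l_mean = \<theta> ^ Suc n * L + l_pot * \<bar>t\<bar> * B"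
    unfolding pot by (simp only: mult.assoc)
  with twisted_Lip[OF Suc.IH, of t] show ?case by simp
qed

lemma twisted_pow_norm_le: "Lip L B f \<Longrightarrow> x \<in> space X \<Longrightarrow> norm ((twisted t ^^ n) f x) \<le> B"
  using LipD(3)[OF twisted_pow_Lip] by blast

lemma twisted_cong:
  "(\<And>x. x \<in> space X \<Longrightarrow> f x = h x) \<Longrightarrow> x \<in> space X \<Longrightarrow> twisted t f x = twisted t h x"
  unfolding twisted_def by (intro Bochner_Integration.integral_cong) auto

lemma twisted_pow_cong:
  "(\<And>x. x \<in> space X \<Longrightarrow> f x = h x) \<Longrightarrow> x \<in> space X \<Longrightarrow> (twisted t ^^ n) f x = (twisted t ^^ n) h x"
  by (induction n arbitrary: x) (auto intro: twisted_cong)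

lemma twisted_add:
  assumes "Lip L B f" "Lip L' B' h" "x \<in> space X"
  shows "twisted t (\<lambda>x. c * f x + h x) x = c * twisted t f x + twisted t h x"
proof -
  have "twisted t (\<lambda>x. c * f x + h x) x
      = (\<integral>g. c * (iexp (t * \<sigma> g x) * f (act g x)) + iexp (t * \<sigma> g x) * h (act g x) \<partial>\<mu>)"
    unfolding twisted_def
      by (intro Bochner_Integration.integral_cong) (simp_all only: distrib_left mult.left_commute)
  also have "\<dots> = c * twisted t f x + twisted t h x"
    unfolding twisted_def
      using twisted_integrable[OF assms(1,3), of t] twisted_integrable[OF assms(2,3), of t]
    by (subst Bochner_Integration.integral_add) auto
  finally show ?thesis .
qed

lemma twisted_pow_add:
  assumes "Lip L B f" "Lip L' B' h" "x \<in> space X"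
  shows "(twisted t ^^ n) (\<lambda>x. c * f x + h x) x = c * (twisted t ^^ n) f x + (twisted t ^^ n) h x"
  using assms(3)
proof (induction n arbitrary: x)
  case (Suc n)
  have "(twisted t ^^ Suc n) (\<lambda>x. c * f x + h x) x
      = twisted t (\<lambda>x. c * (twisted t ^^ n) f x + (twisted t ^^ n) h x) x"
    using Suc by (auto intro: twisted_cong)
  also have "\<dots> = c * (twisted t ^^ Suc n) f x + (twisted t ^^ Suc n) h x"
    using twisted_add[OF twisted_pow_Lip[OF assms(1), of n t] twisted_pow_Lip[OF assms(2), of n t]
        Suc.prems] by simp
  finally show ?case .
qed simp

end

section \<open>The approximate eigenfunction and its defect\<close>

text \<open>Positivity of \<open>v\<close> is kept for the next locale: the second moment estimate
  proved in this one is what later shows that \<open>v\<close> cannot be negative.\<close>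

locale centered_ifs = contracting_ifs +
  fixes U :: "'b \<Rightarrow> real" and C\<^sub>U v :: real
  assumes centered: "\<And>x. x \<in> space X \<Longrightarrow> (\<integral>g. \<sigma> g x \<partial>\<mu>) = 0"
    and U_Lip: "Lip C\<^sub>U C\<^sub>U U"
    and U_poisson: "\<And>x. x \<in> space X \<Longrightarrow> U x - markov U x = (\<integral>g. (\<sigma> g x)\<^sup>2 \<partial>\<mu>) - v"

locale nondegenerate_ifs = centered_ifs +
  assumes v_pos: "0 < v"
begin

definition eigenfun :: "real \<Rightarrow> 'b \<Rightarrow> complex" where
  "eigenfun t x = 1 - t\<^sup>2 / 2 * U x"

definition eigenval :: "real \<Rightarrow> real" where
  "eigenval t = 1 - v * t\<^sup>2 / 2"

definition defect :: "real \<Rightarrow> 'b \<Rightarrow> complex" where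
  "defect t x = twisted t (eigenfun t) x - eigenval t * eigenfun t x"

lemma C\<^sub>U_nonneg: "0 \<le> C\<^sub>U" using LipD(2)[OF U_Lip] .

lemma eigenfun_Lip: "Lip (t\<^sup>2 / 2 * C\<^sub>U) (1 + t\<^sup>2 / 2 * C\<^sub>U) (eigenfun t)"
proof -
  have "Lip (0 + norm (complex_of_real (- (t\<^sup>2 / 2))) * C\<^sub>U) (1 + norm (complex_of_real (- (t\<^sup>2 / 2)))
      * C\<^sub>U)
    (\<lambda>x. 1 + complex_of_real (- (t\<^sup>2 / 2)) * complex_of_real (U x))"
    by (intro Lip_add Lip_mult Lip_of_real U_Lip Lip_const) simp
  then show ?thesis
    by (simp add: eigenfun_def[abs_def] norm_divide norm_power)
qed

text \<open>The difference estimate for the remainder has exponent \<open>p - 1\<close> in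
  \<open>l\<close>, and the Lipschitz bound of \<open>\<sigma>\<close> supplies the missing power,
  so both bounds use the moment of order \<open>p\<close> and no higher one.\<close>

lemma remainder_Lip:
  "Lip (2 * \<bar>t\<bar> powr p * (\<integral>g. l g powr p \<partial>\<mu>)) (\<bar>t\<bar> powr p * (\<integral>g. l g powr p \<partial>\<mu>))
     (\<lambda>x. \<integral>g. iexp (t * \<sigma> g x) - 1 - \<i> * (t * \<sigma> g x) + (t * \<sigma> g x)\<^sup>2 / 2 \<partial>\<mu>)"
  and remainder_integrable: "x \<in> space X \<Longrightarrow>
     integrable \<mu> (\<lambda>g. iexp (t * \<sigma> g x) - 1 - \<i> * (t * \<sigma> g x) + (t * \<sigma> g x)\<^sup>2 / 2)"
proof -
  let ?F = "\<lambda>g x. iexp (t * \<sigma> g x) - 1 - \<i> * complex_of_real (t * \<sigma> g x) + complex_of_real ((t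
      * \<sigma> g x)\<^sup>2 / 2)"
  have m: "(\<lambda>(x, g). ?F g x) \<in> borel_measurable (X \<Otimes>\<^sub>M \<mu>)" by measurable
  have b: "norm (?F g x) \<le> \<bar>t\<bar> powr p * l g powr p" if "g \<in> space \<mu>" "x \<in> space X" for g x
  proof -
    have "norm (?F g x) \<le> \<bar>t * \<sigma> g x\<bar> powr p"
      using norm_taylor2[of p "t * \<sigma> g x"] p by simp
    also have "\<dots> \<le> (\<bar>t\<bar> * l g) powr p"
      using \<sigma>_bound[OF that] p by (intro powr_mono2) (auto simp: abs_mult mult_left_mono)
    finally show ?thesis using l_ge_1[OF that(1)] by (simp add: powr_mult)
  qed
  have d: "norm (?F g x - ?F g y) \<le> 2 * \<bar>t\<bar> powr p * l g powr p * D x y + 0 * D (act g x) (act g y)"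
    if g: "g \<in> space \<mu>" and x: "x \<in> space X" and y: "y \<in> space X" for g x y
  proof -
    have l0: "0 \<le> l g" using l_ge_1[OF g] by simp
    have "norm (?F g x - ?F g y) \<le> 2 * (\<bar>t\<bar> * l g) powr (p - 1) * \<bar>t * \<sigma> g x - t * \<sigma> g y\<bar>"
      using norm_taylor2_diff_le[of p "t * \<sigma> g x" "\<bar>t\<bar> * l g" "t * \<sigma> g y"] p \<sigma>_bound[OF g x] \<sigma>_bound[OF g y]
      by (simp add: abs_mult mult_left_mono)
    also have "\<bar>t * \<sigma> g x - t * \<sigma> g y\<bar> = \<bar>t\<bar> * \<bar>\<sigma> g x - \<sigma> g y\<bar>"
      by (simp add: abs_mult flip: right_diff_distrib)
    also have "2 * (\<bar>t\<bar> * l g) powr (p - 1) * (\<bar>t\<bar> * \<bar>\<sigma> g x - \<sigma> g y\<bar>)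
       \<le> 2 * (\<bar>t\<bar> * l g) powr (p - 1) * (\<bar>t\<bar> * (l g * D x y))"
      by (intro mult_left_mono \<sigma>_lip g x y) auto
    also have "\<dots> = 2 * ((\<bar>t\<bar> * l g) powr (p - 1) * (\<bar>t\<bar> * l g) powr 1) * D x y"
      using l0 by simp
    also have "(\<bar>t\<bar> * l g) powr (p - 1) * (\<bar>t\<bar> * l g) powr 1 = (\<bar>t\<bar> * l g) powr p"
      by (subst powr_add[symmetric]) simp
    also have "\<dots> = \<bar>t\<bar> powr p * l g powr p" using l0 by (simp add: powr_mult)
    finally show ?thesis by simp
  qed
  have "Lip ((\<integral>g. 2 * \<bar>t\<bar> powr p * l g powr p \<partial>\<mu>) + 0 * \<theta>) (\<integral>g. \<bar>t\<bar> powr p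
      * l g powr p \<partial>\<mu>) (\<lambda>x. \<integral>g. ?F g x \<partial>\<mu>)"
    by (rule Lip_average(2)[OF m _ _ _ _ b d]) (use l_int in auto)
  then show "Lip (2 * \<bar>t\<bar> powr p * (\<integral>g. l g powr p \<partial>\<mu>)) (\<bar>t\<bar> powr p * (\<integral>g. l g powr p \<partial>\<mu>))
     (\<lambda>x. \<integral>g. iexp (t * \<sigma> g x) - 1 - \<i> * (t * \<sigma> g x) + (t * \<sigma> g x)\<^sup>2 / 2 \<partial>\<mu>)"
    by simp
  have "x \<in> space X \<Longrightarrow> integrable \<mu> (\<lambda>g. ?F g x)"
    by (rule Lip_average(1)[where H="\<lambda>g. \<bar>t\<bar> powr p * l g powr p" and J="\<lambda>g. 2 * \<bar>t\<bar> powr p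
        * l g powr p" and b=0, OF m _ _ _ _ b d])
      (use l_int in auto)
  then show "x \<in> space X \<Longrightarrow>
     integrable \<mu> (\<lambda>g. iexp (t * \<sigma> g x) - 1 - \<i> * (t * \<sigma> g x) + (t * \<sigma> g x)\<^sup>2 / 2)" by simp
qed

text \<open>Contraction in mean is not applicable here: the variation of \<open>U (act g x)\<close>
  is multiplied by the unbounded \<open>l g\<close> inside the same integral, so the pointwise bound
  \<open>K\<close> takes its place. The first factor supplies one power of \<open>|t|\<close>, which
  with the prefactor \<open>t^2 / 2\<close> makes the term cubic.\<close>

lemma cross_term_Lip:
  "Lip (\<bar>t\<bar> * ((1 + K) * C\<^sub>U * l_mean)) (\<bar>t\<bar> * (C\<^sub>U * l_mean)) (\<lambda>x. \<integral>g. (iexp (t * \<sigma> g x) - 1)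
      * U (act g x) \<partial>\<mu>)"
  and cross_term_integrable: "x \<in> space X \<Longrightarrow> integrable \<mu> (\<lambda>g. (iexp (t * \<sigma> g x) - 1) * U (act g x))"
proof -
  let ?F = "\<lambda>g x. (iexp (t * \<sigma> g x) - 1) * complex_of_real (U (act g x))"
  have [measurable]: "U \<in> borel_measurable X" using LipD(1)[OF U_Lip] .
  have m: "(\<lambda>(x, g). ?F g x) \<in> borel_measurable (X \<Otimes>\<^sub>M \<mu>)" by measurable
  have e1: "norm (iexp (t * \<sigma> g x) - 1) \<le> \<bar>t\<bar> * l g" if "g \<in> space \<mu>" "x \<in> space X" for g x
    using norm_iexp_diff_le[of "t * \<sigma> g x" 0] mult_left_mono[OF \<sigma>_bound[OF that], of "\<bar>t\<bar>"]
      by (simp add: abs_mult)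
  have b: "norm (?F g x) \<le> \<bar>t\<bar> * C\<^sub>U * l g" if "g \<in> space \<mu>" "x \<in> space X" for g x
  proof -
    have "norm (?F g x) \<le> (\<bar>t\<bar> * l g) * C\<^sub>U"
      unfolding norm_mult using e1[OF that] LipD(3)[OF U_Lip, of "act g x"] that l_ge_1[of g]
        by (intro mult_mono) auto
    then show ?thesis by (simp add: mult_ac)
  qed
  have d: "norm (?F g x - ?F g y) \<le> \<bar>t\<bar> * ((1 + K) * C\<^sub>U) * l g * D x y + 0 * D (act g x) (act g y)"
    if g: "g \<in> space \<mu>" and x: "x \<in> space X" and y: "y \<in> space X" for g x y
  proof -
    have l0: "0 \<le> l g" using l_ge_1[OF g] by simp
    have "norm (iexp (t * \<sigma> g x) - iexp (t * \<sigma> g y)) \<le> \<bar>t\<bar> * (l g * D x y)"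
      using norm_iexp_diff_le[of "t * \<sigma> g x" "t * \<sigma> g y"] mult_left_mono[OF \<sigma>_lip[OF g x y], of "\<bar>t\<bar>"]
      by (simp add: abs_mult flip: right_diff_distrib)
    then have 1: "norm ((iexp (t * \<sigma> g x) - iexp (t * \<sigma> g y)) * complex_of_real (U (act g x)))
        \<le> \<bar>t\<bar> * (l g * D x y) * C\<^sub>U"
      unfolding norm_mult using LipD(3)[OF U_Lip, of "act g x"] g x y D_nonneg[OF x y] l0
      by (intro mult_mono) auto
    have "\<bar>U (act g x) - U (act g y)\<bar> \<le> C\<^sub>U * D (act g x) (act g y)"
      using LipD(4)[OF U_Lip, of "act g x" "act g y"] g x y by simp
    also have "\<dots> \<le> C\<^sub>U * (K * D x y)" by (intro mult_left_mono D_lip g x y C\<^sub>U_nonneg)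
    finally have 2: "norm ((iexp (t * \<sigma> g y) - 1) * complex_of_real (U (act g x) - U (act g y)))
        \<le> \<bar>t\<bar> * l g * (C\<^sub>U * (K * D x y))"
      unfolding norm_mult norm_of_real using e1[OF g y] l0 by (intro mult_mono) auto
    have "?F g x - ?F g y = (iexp (t * \<sigma> g x) - iexp (t * \<sigma> g y)) * complex_of_real (U (act g x))
       + (iexp (t * \<sigma> g y) - 1) * complex_of_real (U (act g x) - U (act g y))"
      by (simp add: algebra_simps)
    from norm_triangle_mono[OF 1 2, folded this] show ?thesis by (simp add: algebra_simps)
  qed
  have nn: "g \<in> space \<mu> \<Longrightarrow> 0 \<le> \<bar>t\<bar> * ((1 + K) * C\<^sub>U) * l g" for g
    using l_ge_1[of g] K C\<^sub>U_nonneg by simp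
  have "Lip ((\<integral>g. \<bar>t\<bar> * ((1 + K) * C\<^sub>U) * l g \<partial>\<mu>) + 0 * \<theta>) (\<integral>g. \<bar>t\<bar> * C\<^sub>U * l g \<partial>\<mu>) (\<lambda>x. \<integral>g. ?F g x \<partial>\<mu>)"
    by (rule Lip_average(2)[OF m _ _ nn _ b d]) (use l_integrable in auto)
  then show "Lip (\<bar>t\<bar> * ((1 + K) * C\<^sub>U * l_mean)) (\<bar>t\<bar> * (C\<^sub>U * l_mean)) (\<lambda>x. \<integral>g. (iexp (t * \<sigma> g x) - 1)
      * U (act g x) \<partial>\<mu>)"
    by (simp add: l_mean_def mult.assoc)
  show "x \<in> space X \<Longrightarrow> integrable \<mu> (\<lambda>g. ?F g x)"
    by (rule Lip_average(1)[where H="\<lambda>g. \<bar>t\<bar> * C\<^sub>U * l g" and J="\<lambda>g. \<bar>t\<bar> * ((1 + K) * C\<^sub>U)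
        * l g" and b=0, OF m _ _ nn _ b d])
      (use l_integrable in auto)
qed

text \<open>The first-order term vanishes by centering. At second order the mean square plus
  \<open>markov U\<close> equals \<open>U + v\<close> by the Poisson equation, and up to the factor
  \<open>- 1 / 2\<close> this is the \<open>t^2\<close> part of
  \<open>eigenval t * eigenfun t\<close>. What survives is the Taylor remainder, the cross term, and
  the product of the two \<open>t^2\<close> corrections.\<close>

lemma defect_eq:
  assumes x: "x \<in> space X"
  shows "defect t x = (\<integral>g. iexp (t * \<sigma> g x) - 1 - \<i> * (t * \<sigma> g x) + (t * \<sigma> g x)\<^sup>2 / 2 \<partial>\<mu>)
     + (- (t\<^sup>2 / 2) * (\<integral>g. (iexp (t * \<sigma> g x) - 1) * U (act g x) \<partial>\<mu>) + (- (v * t ^ 4 / 4)) * U x)"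
proof -
  let ?R = "\<lambda>g. iexp (t * \<sigma> g x) - 1 - \<i> * (t * \<sigma> g x) + (t * \<sigma> g x)\<^sup>2 / 2"
  let ?W = "\<lambda>g. (iexp (t * \<sigma> g x) - 1) * complex_of_real (U (act g x))"
  have iU: "integrable \<mu> (\<lambda>g. U (act g x))" by (rule markov_Lip(1)[OF U_Lip x])
  have alg: "T - complex_of_real (1 - v * t\<^sup>2 / 2) * complex_of_real (1 - t\<^sup>2 / 2 * u)
      = I + (- ((complex_of_real t)\<^sup>2 / 2) * W + complex_of_real (- (v * t ^ 4 / 4) * u))"
    if "T = I + 1 + \<i> * complex_of_real t * complex_of_real 0 - complex_of_real (t\<^sup>2 / 2)
        * complex_of_real q
      - complex_of_real (t\<^sup>2 / 2) * W - complex_of_real (t\<^sup>2 / 2) * complex_of_real (u - q + v)"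
    for T I W :: complex and u q :: real
    unfolding that by (simp add: field_simps power2_eq_square power4_eq_xxxx)
  have lin: "(\<integral>g. ((((f1 g + 1) + a * f2 g) - b * f3 g) - b * f4 g) - b * f5 g \<partial>\<mu>)
     = ((((\<integral>g. f1 g \<partial>\<mu>) + 1) + a * (\<integral>g. f2 g \<partial>\<mu>)) - b * (\<integral>g. f3 g \<partial>\<mu>) - b * (\<integral>g. f4 g \<partial>\<mu>)) - b * (\<integral>g. f5 g
         \<partial>\<mu>)"
    if "integrable \<mu> f1" "integrable \<mu> f2" "integrable \<mu> f3" "integrable \<mu> f4" "integrable \<mu> f5"
    for f1 f2 f3 f4 f5 :: "'a \<Rightarrow> complex" and a b
    using that by (simp add: prob_space)
  have "twisted t (eigenfun t) x = (\<integral>g. ((((?R g + 1) + (\<i> * t) * \<sigma> g x) - t\<^sup>2 / 2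
      * complex_of_real ((\<sigma> g x)\<^sup>2)) - t\<^sup>2 / 2 * ?W g) - t\<^sup>2 / 2 * complex_of_real (U (act g x)) \<partial>\<mu>)"
    unfolding twisted_def eigenfun_def
    by (intro Bochner_Integration.integral_cong) (auto simp: algebra_simps power_mult_distrib)
  also have "\<dots> = ((((\<integral>g. ?R g \<partial>\<mu>) + 1) + (\<i> * t) * complex_of_real (\<integral>g. \<sigma> g x \<partial>\<mu>)) - t\<^sup>2 / 2
      * complex_of_real (\<integral>g. (\<sigma> g x)\<^sup>2 \<partial>\<mu>)
      - t\<^sup>2 / 2 * (\<integral>g. ?W g \<partial>\<mu>)) - t\<^sup>2 / 2 * complex_of_real (markov U x)"
    unfolding markov_def integral_complex_of_real[symmetric]
    by (rule lin) (use remainder_integrable[OF x, of t] cross_term_integrable[OF x, of t] iU \<sigma>_integrable[OF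
        x] \<sigma>_sq_integrable[OF x] in
      \<open>auto simp del: of_real_power\<close>)
  also have "markov U x = U x - (\<integral>g. (\<sigma> g x)\<^sup>2 \<partial>\<mu>) + v" using U_poisson[OF x] by simp
  finally show ?thesis
    unfolding defect_def eigenval_def eigenfun_def[of t x] centered[OF x] by (rule alg)
qed

text \<open>The three terms are of orders \<open>p\<close>, 3 and 4 in \<open>|t|\<close>; for
  \<open>|t| \<le> 1\<close> and \<open>p \<le> 3\<close> the power \<open>p\<close>
  dominates.\<close>

lemma defect_Lip:
  obtains C where "0 \<le> C" "\<And>t. \<bar>t\<bar> \<le> 1 \<Longrightarrow> Lip (C * \<bar>t\<bar> powr p) (C * \<bar>t\<bar> powr p) (defect t)"
proof -
  define I where "I = (\<integral>g. l g powr p \<partial>\<mu>)"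
  have I: "0 \<le> I" unfolding I_def by (intro integral_nonneg_AE) auto
  define W where "W = (1 + K) * C\<^sub>U * l_mean"
  have W: "0 \<le> W" "C\<^sub>U * l_mean \<le> W" unfolding W_def using K C\<^sub>U_nonneg l_mean_nonneg
    by (auto simp: algebra_simps)
  let ?C = "2 * I + W + v * C\<^sub>U"
  show thesis
  proof (rule that[of ?C])
    show "0 \<le> ?C" using I W v_pos C\<^sub>U_nonneg by simp
    fix t :: real assume t: "\<bar>t\<bar> \<le> 1"
    let ?q = "\<bar>t\<bar> powr p"
    have pw: "\<bar>t\<bar> ^ k \<le> ?q" if "3 \<le> k" for k
    proof -
      have "\<bar>t\<bar> ^ k \<le> \<bar>t\<bar> ^ 3" using t that by (intro power_decreasing) auto
      also have "\<dots> \<le> \<bar>t\<bar> powr 3" by (cases "t = 0") (auto simp: powr_numeral)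
      also have "\<dots> \<le> ?q" using t p by (intro powr_mono') auto
      finally show ?thesis .
    qed
    have t3: "t\<^sup>2 / 2 * \<bar>t\<bar> \<le> ?q" using pw[of 3]
      by (simp add: power2_eq_square power3_eq_cube abs_mult) (smt (verit) mult_nonneg_nonneg abs_ge_zero
        abs_mult_self_eq)
    have t4: "t ^ 4 / 4 \<le> ?q" using pw[of 4] powr_ge_zero[of "\<bar>t\<bar>" p]
      by (simp add: power_even_abs, linarith)
    have A: "Lip (2 * ?q * I + (norm (complex_of_real (- (t\<^sup>2 / 2))) * (\<bar>t\<bar> * W)
        + norm (complex_of_real (- (v * t ^ 4 / 4))) * C\<^sub>U))
      (?q * I + (norm (complex_of_real (- (t\<^sup>2 / 2))) * (\<bar>t\<bar> * (C\<^sub>U * l_mean)) + norm (complex_of_real (- (v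
          * t ^ 4 / 4))) * C\<^sub>U))
      (\<lambda>x. (\<integral>g. iexp (t * \<sigma> g x) - 1 - \<i> * (t * \<sigma> g x) + (t * \<sigma> g x)\<^sup>2 / 2 \<partial>\<mu>)
     + (complex_of_real (- (t\<^sup>2 / 2)) * (\<integral>g. (iexp (t * \<sigma> g x) - 1) * U (act g x) \<partial>\<mu>) + complex_of_real (-
         (v * t ^ 4 / 4)) * complex_of_real (U x)))"
      unfolding I_def W_def
      by (intro Lip_add Lip_mult Lip_of_real U_Lip remainder_Lip cross_term_Lip)
    have n1: "norm (complex_of_real (- (t\<^sup>2 / 2))) * (\<bar>t\<bar> * z) \<le> ?q * z" if "0 \<le> z" for z
      using mult_right_mono[OF t3 that] unfolding norm_of_real by (simp add: mult_ac)
    have n2: "norm (complex_of_real (- (v * t ^ 4 / 4))) * C\<^sub>U \<le> ?q * (v * C\<^sub>U)"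
      using mult_right_mono[OF t4, of "v * C\<^sub>U"] v_pos C\<^sub>U_nonneg unfolding norm_of_real
        by (simp add: abs_mult mult_ac)
    have "Lip (?C * ?q) (?C * ?q)
      (\<lambda>x. (\<integral>g. iexp (t * \<sigma> g x) - 1 - \<i> * (t * \<sigma> g x) + (t * \<sigma> g x)\<^sup>2 / 2 \<partial>\<mu>)
     + (complex_of_real (- (t\<^sup>2 / 2)) * (\<integral>g. (iexp (t * \<sigma> g x) - 1) * U (act g x) \<partial>\<mu>) + complex_of_real (-
         (v * t ^ 4 / 4)) * complex_of_real (U x)))"
    proof (rule Lip_mono[OF A])
      show "2 * ?q * I + (norm (complex_of_real (- (t\<^sup>2 / 2))) * (\<bar>t\<bar> * W) + norm (complex_of_real (- (v
          * t ^ 4 / 4))) * C\<^sub>U) \<le> ?C * ?q"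
        using n1[OF W(1)] n2 by (simp add: distrib_left distrib_right mult_ac)
      have "?q * (C\<^sub>U * l_mean) \<le> ?q * W" "?q * I \<le> ?q * (2 * I)" using W I by (auto intro!: mult_left_mono)
      then show "?q * I + (norm (complex_of_real (- (t\<^sup>2 / 2))) * (\<bar>t\<bar> * (C\<^sub>U * l_mean))
          + norm (complex_of_real (- (v * t ^ 4 / 4))) * C\<^sub>U) \<le> ?C * ?q"
        using n1[of "C\<^sub>U * l_mean"] n2 C\<^sub>U_nonneg l_mean_nonneg
          by (simp add: distrib_left distrib_right mult_ac)
    qed
    then show "Lip (?C * ?q) (?C * ?q) (defect t)"
      by (subst Lip_cong[OF defect_eq]) auto
  qed
qed

text \<open>Discrete Duhamel formula: in each step the eigenfunction reproduces itself up to the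
  defect, which the remaining steps transport.\<close>

lemma twisted_pow_eigenfun:
  assumes x: "x \<in> space X" and t: "\<bar>t\<bar> \<le> 1"
  shows "(twisted t ^^ n) (eigenfun t) x = eigenval t ^ n * eigenfun t x
     + (\<Sum>k<n. eigenval t ^ k * (twisted t ^^ (n - 1 - k)) (defect t) x)"
proof (induction n)
  case (Suc n)
  obtain C where dL: "Lip (C * \<bar>t\<bar> powr p) (C * \<bar>t\<bar> powr p) (defect t)"
    using defect_Lip t by metis
  have "(twisted t ^^ Suc n) (eigenfun t) x = (twisted t ^^ n) (twisted t (eigenfun t)) x"
    by (simp only: funpow_Suc_right o_apply)
  also have "\<dots> = (twisted t ^^ n) (\<lambda>x. eigenval t * eigenfun t x + defect t x) x"
    by (rule twisted_pow_cong[OF _ x]) (simp add: defect_def)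
  also have "\<dots> = eigenval t * (twisted t ^^ n) (eigenfun t) x + (twisted t ^^ n) (defect t) x"
    by (rule twisted_pow_add[OF eigenfun_Lip dL x])
  also have "\<dots> = eigenval t ^ Suc n * eigenfun t x
     + (\<Sum>k<Suc n. eigenval t ^ k * (twisted t ^^ (Suc n - 1 - k)) (defect t) x)"
    unfolding Suc.IH sum.lessThan_Suc_shift
    by (simp add: algebra_simps sum_distrib_left)
  finally show ?case .
qed simp

end

section \<open>Decay of the twisted powers\<close>

context nondegenerate_ifs
begin

lemma eigenval_pow_le:
  assumes "v * t\<^sup>2 / 2 \<le> 1"
  shows "0 \<le> eigenval t" "eigenval t \<le> exp (- (v * t\<^sup>2 / 2))" "eigenval t ^ n
      \<le> exp (- (real n * (v * t\<^sup>2 / 2)))"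
proof -
  show 0: "0 \<le> eigenval t" using assms by (simp add: eigenval_def)
  show 1: "eigenval t \<le> exp (- (v * t\<^sup>2 / 2))"
    using exp_minus_bounds(1)[of "v * t\<^sup>2 / 2"] v_pos by (simp add: eigenval_def)
  have "eigenval t ^ n \<le> exp (- (v * t\<^sup>2 / 2)) ^ n" by (intro power_mono 0 1)
  then show "eigenval t ^ n \<le> exp (- (real n * (v * t\<^sup>2 / 2)))" by (simp add: exp_of_nat_mult[symmetric])
qed

lemma small_U_Lip: "Lip (t\<^sup>2 / 2 * C\<^sub>U) (t\<^sup>2 / 2 * C\<^sub>U) (\<lambda>x. complex_of_real (t\<^sup>2 / 2)
    * complex_of_real (U x))"
  using Lip_mult[OF Lip_of_real[OF U_Lip], of "complex_of_real (t\<^sup>2 / 2)"] unfolding norm_of_real by simp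

lemma twisted_pow_one:
  assumes "x \<in> space X"
  shows "(twisted t ^^ n) (\<lambda>_. 1) x = (twisted t ^^ n) (eigenfun t) x
     + (twisted t ^^ n) (\<lambda>x. complex_of_real (t\<^sup>2 / 2) * complex_of_real (U x)) x"
  using twisted_pow_add[OF eigenfun_Lip small_U_Lip assms, where c=1 and n=n, of t t t]
  by (simp add: eigenfun_def[abs_def])

text \<open>A bound that presupposes no decay of the operators: the transported defects keep their
  size \<open>C * |t| powr p\<close> and are summed against the geometric series of
  \<open>eigenval t\<close>, at most \<open>2 / (v * t^2)\<close>. Their total does not depend on
  \<open>n\<close> and is small for small \<open>t\<close> because \<open>p > 2\<close>.\<close>

lemma norm_twisted_pow_one_le:
  assumes x: "x \<in> space X" and t: "\<bar>t\<bar> \<le> 1" "t \<noteq> 0" "v * t\<^sup>2 / 2 \<le> 1" "t\<^sup>2 / 2 * C\<^sub>U \<le> 1"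
    and C: "Lip (C * \<bar>t\<bar> powr p) (C * \<bar>t\<bar> powr p) (defect t)"
  shows "norm ((twisted t ^^ n) (\<lambda>_. 1) x)
     \<le> 2 * exp (- (real n * (v * t\<^sup>2 / 2))) + 2 * C / v * \<bar>t\<bar> powr (p - 2) + t\<^sup>2 / 2 * C\<^sub>U"
proof -
  let ?q = "C * \<bar>t\<bar> powr p"
  have q0: "0 \<le> ?q" using LipD(2)[OF C] .
  note e0 = eigenval_pow_le(1)[OF t(3)]
  have 1: "norm (eigenval t ^ n * eigenfun t x) \<le> exp (- (real n * (v * t\<^sup>2 / 2))) * 2"
    unfolding norm_mult using LipD(3)[OF eigenfun_Lip x, of t] t(4) e0 eigenval_pow_le(3)[OF t(3), of n]
    by (intro mult_mono) (auto simp: norm_power)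
  have geo: "(\<Sum>k<n. eigenval t ^ k) \<le> 2 / (v * t\<^sup>2)"
  proof -
    have "(1 - eigenval t) * (\<Sum>k<n. eigenval t ^ k) = 1 - eigenval t ^ n"
      by (rule one_diff_power_eq[symmetric])
    also have "\<dots> \<le> 1" using e0 by simp
    finally have "v * t\<^sup>2 / 2 * (\<Sum>k<n. eigenval t ^ k) \<le> 1" by (simp add: eigenval_def)
    then show ?thesis using v_pos t(2) by (simp add: field_simps)
  qed
  have "norm (\<Sum>k<n. eigenval t ^ k * (twisted t ^^ (n - 1 - k)) (defect t) x)
      \<le> (\<Sum>k<n. eigenval t ^ k * ?q)"
    using e0 by (intro sum_norm_le) (auto simp: norm_mult norm_power intro!: mult_left_mono
        twisted_pow_norm_le[OF C x])
  also have "\<dots> = (\<Sum>k<n. eigenval t ^ k) * ?q" by (simp add: sum_distrib_right)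
  also have "\<dots> \<le> 2 / (v * t\<^sup>2) * ?q" by (rule mult_right_mono[OF geo q0])
  also have "\<dots> = 2 * C / v * \<bar>t\<bar> powr (p - 2)"
    using t(2) v_pos by (simp add: powr_diff powr_numeral field_simps)
  finally have 2: "norm (\<Sum>k<n. eigenval t ^ k * (twisted t ^^ (n - 1 - k)) (defect t) x)
      \<le> 2 * C / v * \<bar>t\<bar> powr (p - 2)" .
  have 3: "norm ((twisted t ^^ n) (\<lambda>x. complex_of_real (t\<^sup>2 / 2) * complex_of_real (U x)) x)
      \<le> t\<^sup>2 / 2 * C\<^sub>U"
    by (rule twisted_pow_norm_le[OF small_U_Lip x])
  show ?thesis
    unfolding twisted_pow_one[OF x] twisted_pow_eigenfun[OF x t(1)]
    using norm_triangle_mono[OF norm_triangle_mono[OF 1 2] 3] by simp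
qed

text \<open>After \<open>n\<close> steps \<open>f\<close> is constant up to a small error, and \<open>n\<close> further steps damp the constant.\<close>

lemma twisted_block_contraction:
  assumes f: "Lip L B f" and t: "l_pot * \<bar>t\<bar> \<le> 1 / 8" and n: "\<theta> ^ n \<le> 1 / 8"
    and one: "\<And>x. x \<in> space X \<Longrightarrow> norm ((twisted t ^^ n) (\<lambda>_. 1) x) \<le> 1 / 4"
  obtains L' B' where "Lip L' B' ((twisted t ^^ (2 * n)) f)" "L' + B' \<le> (L + B) / 2"
proof -
  have B0: "0 \<le> B" and L0: "0 \<le> L" using Lip_B_nonneg[OF f] LipD(2)[OF f] by auto
  let ?f = "(twisted t ^^ n) f"
  have fL: "Lip (\<theta> ^ n * L + l_pot * \<bar>t\<bar> * B) B ?f" by (rule twisted_pow_Lip[OF f])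
  have small: "\<theta> ^ n * L + l_pot * \<bar>t\<bar> * B \<le> L / 8 + B / 8"
    using mult_right_mono[OF n L0] mult_right_mono[OF t B0] by simp
  obtain x0 where x0: "x0 \<in> space X" using X_nonempty by blast
  have "\<theta> ^ (2 * n) \<le> 1 / 8 * 1"
    unfolding mult_2 power_add using n theta by (intro mult_mono power_le_one) auto
  then have small2: "\<theta> ^ (2 * n) * L + l_pot * \<bar>t\<bar> * B \<le> L / 8 + B / 8"
    using mult_right_mono[of "\<theta> ^ (2 * n)" "1 / 8" L] L0 mult_right_mono[OF t B0] by simp
  note Lf = twisted_pow_Lip[OF f, of "2 * n" t]
  have b: "norm ((twisted t ^^ (2 * n)) f x) \<le> B / 4 + (L / 8 + B / 8)" if x: "x \<in> space X" for x
  proof -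
    \<comment> \<open>The deviation of \<open>?f\<close> from a constant: its supremum is at most an
      oscillation, hence at most the Lipschitz constant that \<open>n\<close> steps have made
      small.\<close>
    define h where "h y = ?f y - ?f x0" for y
    have h: "Lip (\<theta> ^ n * L + l_pot * \<bar>t\<bar> * B) (L / 8 + B / 8) h"
      unfolding Lip_def
    proof (intro conjI ballI)
      show "h \<in> borel_measurable X" unfolding h_def using LipD(1)[OF fL] by measurable
      show "0 \<le> \<theta> ^ n * L + l_pot * \<bar>t\<bar> * B" using LipD(2)[OF fL] .
      fix y assume y: "y \<in> space X"
      show "norm (h y) \<le> L / 8 + B / 8" unfolding h_def by (rule order_trans[OF Lip_osc[OF fL y x0] small])
      fix z assume z: "z \<in> space X"
      show "norm (h y - h z) \<le> (\<theta> ^ n * L + l_pot * \<bar>t\<bar> * B) * D y z"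
        using LipD(4)[OF fL y z] by (simp add: h_def)
    qed
    have "(twisted t ^^ (2 * n)) f x = (twisted t ^^ n) (\<lambda>y. ?f x0 * 1 + h y) x"
      by (simp add: mult_2 funpow_add h_def[abs_def])
    also have "\<dots> = ?f x0 * (twisted t ^^ n) (\<lambda>_. 1) x + (twisted t ^^ n) h x"
      by (rule twisted_pow_add[OF Lip_const[of 1 1] h x]) simp
    finally have eq: "(twisted t ^^ (2 * n)) f x
        = ?f x0 * (twisted t ^^ n) (\<lambda>_. 1) x + (twisted t ^^ n) h x" .
    have "norm (?f x0 * (twisted t ^^ n) (\<lambda>_. 1) x) \<le> B * (1 / 4)"
      unfolding norm_mult using LipD(3)[OF fL x0] one[OF x] B0 by (intro mult_mono) auto
    from norm_triangle_mono[OF this twisted_pow_norm_le[OF h x, of n t]] show ?thesis unfolding eq by simp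
  qed
  show thesis
  proof (rule that)
    show "Lip (L / 8 + B / 8) (B / 4 + (L / 8 + B / 8)) ((twisted t ^^ (2 * n)) f)"
      unfolding Lip_def
    proof (intro conjI ballI)
      fix y z assume yz: "y \<in> space X" "z \<in> space X"
      show "norm ((twisted t ^^ (2 * n)) f y - (twisted t ^^ (2 * n)) f z) \<le> (L / 8 + B / 8) * D y z"
        by (rule order_trans[OF LipD(4)[OF Lf yz] mult_right_mono[OF small2 D_nonneg[OF yz]]])
    qed (use LipD(1)[OF Lf] L0 B0 b in auto)
    \<comment> \<open>The two new bounds add up to \<open>L / 4 + B / 2\<close>.\<close>
    show "L / 8 + B / 8 + (B / 4 + (L / 8 + B / 8)) \<le> (L + B) / 2" using L0 by simp
  qed
qed

text \<open>A block of \<open>2 * N\<close> steps, with \<open>N\<close> of order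
  \<open>1 / t^2\<close>, halves \<open>L + B\<close>. The number of complete blocks in
  \<open>n\<close> steps is of order \<open>n * t^2\<close>, which gives the exponential.\<close>

lemma twisted_pow_decay:
  obtains \<delta> c where "0 < \<delta>" "0 < c"
    "\<And>t n L B f x. \<bar>t\<bar> \<le> \<delta> \<Longrightarrow> Lip L B f \<Longrightarrow> x \<in> space X \<Longrightarrow>
       norm ((twisted t ^^ n) f x) \<le> 2 * exp (- (c * real n * t\<^sup>2)) * (L + B)"
proof -
  obtain C where C: "0 \<le> C" "\<And>t. \<bar>t\<bar> \<le> 1 \<Longrightarrow> Lip (C * \<bar>t\<bar> powr p) (C * \<bar>t\<bar> powr p) (defect t)"
    by (rule defect_Lip) blast
  \<comment> \<open>For \<open>N \<ge> K0 / t^2\<close> the exponential is at most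
    \<open>exp (- ln 16) = 1 / 16\<close>. Taken twice and joined by two further sixteenths it gives
    the \<open>1 / 4\<close> that a block demands.\<close>
  define K0 where "K0 = 2 * ln 16 / v"
  have K0: "0 < K0" using v_pos by (simp add: K0_def)
  have "(\<lambda>n. \<theta> ^ n) \<longlonglongrightarrow> 0" using theta by (intro LIMSEQ_power_zero) simp
  then have "eventually (\<lambda>n. \<theta> ^ n < 1 / 8) sequentially" by (rule order_tendstoD) simp
  then obtain n0 where n0: "\<And>n. n0 \<le> n \<Longrightarrow> \<theta> ^ n < 1 / 8" by (auto simp: eventually_sequentially)
  \<comment> \<open>The last two conditions make \<open>N\<close> large enough for
    \<open>\<theta> ^ N \<le> 1 / 8\<close>, and ensure that rounding \<open>K0 / t^2\<close> up to
    an integer at most doubles it.\<close>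
  let ?P = "\<lambda>t. \<bar>t\<bar> < 1 \<and> v * t\<^sup>2 / 2 < 1 \<and> t\<^sup>2 / 2 * C\<^sub>U < 1 / 16 \<and> 2 * C / v * \<bar>t\<bar> powr (p - 2) < 1 / 16
     \<and> l_pot * \<bar>t\<bar> < 1 / 8 \<and> real n0 * t\<^sup>2 < K0 \<and> t\<^sup>2 < K0"
  have "eventually ?P (at 0)"
  proof (intro eventually_conj)
    have pw: "((\<lambda>t. \<bar>t\<bar> powr (p - 2)) \<longlongrightarrow> 0) (at (0::real))"
    proof (rule tendsto_eq_rhs[OF tendsto_powr'[of abs 0 "at 0" "\<lambda>_. p - 2" "p - 2"]])
      show "(abs \<longlongrightarrow> (0::real)) (at 0)" by (rule tendsto_rabs_zero) (rule tendsto_ident_at)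
    qed (use p in auto)
    show "\<forall>\<^sub>F t in at 0. 2 * C / v * \<bar>t\<bar> powr (p - 2) < 1 / 16"
      by (rule order_tendstoD(2)[OF tendsto_mult_right_zero[OF pw]]) simp
    show "\<forall>\<^sub>F t in at (0::real). \<bar>t\<bar> < 1"
      by (rule order_tendstoD(2)[of _ 0]) (auto intro!: tendsto_eq_intros)
    show "\<forall>\<^sub>F t in at (0::real). v * t\<^sup>2 / 2 < 1"
      by (rule order_tendstoD(2)[of _ 0]) (auto intro!: tendsto_eq_intros)
    show "\<forall>\<^sub>F t in at (0::real). t\<^sup>2 / 2 * C\<^sub>U < 1 / 16"
      by (rule order_tendstoD(2)[of _ 0]) (auto intro!: tendsto_eq_intros)
    show "\<forall>\<^sub>F t in at (0::real). l_pot * \<bar>t\<bar> < 1 / 8"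
      by (rule order_tendstoD(2)[of _ 0]) (auto intro!: tendsto_eq_intros)
    show "\<forall>\<^sub>F t in at (0::real). real n0 * t\<^sup>2 < K0"
      by (rule order_tendstoD(2)[of _ 0]) (auto intro!: tendsto_eq_intros K0)
    show "\<forall>\<^sub>F t in at (0::real). t\<^sup>2 < K0"
      by (rule order_tendstoD(2)[of _ 0]) (auto intro!: tendsto_eq_intros K0)
  qed
  then obtain d where d: "0 < d" "\<And>t. t \<noteq> 0 \<Longrightarrow> \<bar>t\<bar> < d \<Longrightarrow> ?P t"
    unfolding eventually_at dist_real_def by auto
  \<comment> \<open>One factor 2 per block, and a block is at most \<open>4 * K0 / t^2\<close> steps
    long.\<close>
  define c where "c = ln 2 / (4 * K0)"
  have c: "0 < c" using K0 by (simp add: c_def)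
  show thesis
  proof (rule that[of "d / 2" c])
    show "0 < d / 2" "0 < c" using d(1) c by auto
    fix t n L B x and f :: "'b \<Rightarrow> complex"
    assume t: "\<bar>t\<bar> \<le> d / 2" and f: "Lip L B f" and x: "x \<in> space X"
    have L0: "0 \<le> L" and B0: "0 \<le> B" using LipD(2)[OF f] Lip_B_nonneg[OF f] by auto
    show "norm ((twisted t ^^ n) f x) \<le> 2 * exp (- (c * real n * t\<^sup>2)) * (L + B)"
    proof (cases "t = 0")
      case True
      then show ?thesis using twisted_pow_norm_le[OF f x, of n t] L0 B0 by simp
    next
      case False
      then have P: "?P t" using t d by simp
      have t2: "0 < t\<^sup>2" using False by simp
      define N where "N = nat \<lceil>K0 / t\<^sup>2\<rceil>"
      have N1: "K0 / t\<^sup>2 \<le> real N" unfolding N_def by (simp add: of_nat_ceiling)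
      have N2: "real N \<le> 2 * K0 / t\<^sup>2"
      proof -
        have "real N \<le> K0 / t\<^sup>2 + 1" unfolding N_def using K0 t2 by simp
        also have "1 \<le> K0 / t\<^sup>2" using P t2 by (simp add: field_simps)
        finally show ?thesis by simp
      qed
      have N0: "0 < N" unfolding N_def using K0 t2 by simp
      have "real n0 < K0 / t\<^sup>2" using P t2 by (simp add: field_simps)
      then have "n0 \<le> N" using N1 by linarith
      then have th: "\<theta> ^ N \<le> 1 / 8" using n0 by (simp add: less_imp_le)
      have one: "norm ((twisted t ^^ N) (\<lambda>_. 1) y) \<le> 1 / 4" if y: "y \<in> space X" for y
      proof -
        have "norm ((twisted t ^^ N) (\<lambda>_. 1) y)
           \<le> 2 * exp (- (real N * (v * t\<^sup>2 / 2))) + 2 * C / v * \<bar>t\<bar> powr (p - 2) + t\<^sup>2 / 2 * C\<^sub>U"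
          using P False by (intro norm_twisted_pow_one_le[OF y] C(2)) linarith+
        moreover have "ln 16 \<le> real N * (v * t\<^sup>2 / 2)"
        proof -
          have "K0 / t\<^sup>2 * (v * t\<^sup>2 / 2) \<le> real N * (v * t\<^sup>2 / 2)" using v_pos
            by (intro mult_right_mono N1) auto
          moreover have "K0 / t\<^sup>2 * (v * t\<^sup>2 / 2) = ln 16" using v_pos t2 by (simp add: K0_def field_simps)
          ultimately show ?thesis by simp
        qed
        then have "exp (- (real N * (v * t\<^sup>2 / 2))) \<le> exp (- ln 16)" by simp
        then have "exp (- (real N * (v * t\<^sup>2 / 2))) \<le> 1 / 16" by (simp add: exp_minus)
        ultimately show ?thesis using P by linarith
      qed
      have iter: "\<exists>L' B'. Lip L' B' ((twisted t ^^ (2 * N * j)) f) \<and> L' + B' \<le> (L + B) / 2 ^ j" for j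
      proof (induction j)
        case 0
        show ?case using f by auto
      next
        case (Suc j)
        then obtain L' B' where 1: "Lip L' B' ((twisted t ^^ (2 * N * j)) f)" "L' + B' \<le> (L + B) / 2 ^ j"
          by blast
        obtain L'' B'' where 2: "Lip L'' B'' ((twisted t ^^ (2 * N)) ((twisted t ^^ (2 * N * j)) f))" "L''
            + B'' \<le> (L' + B') / 2"
          by (rule twisted_block_contraction[OF 1(1) _ th one]) (use P in auto)
        have "(twisted t ^^ (2 * N)) ((twisted t ^^ (2 * N * j)) f) = (twisted t ^^ (2 * N * Suc j)) f"
          by (simp add: funpow_add)
        moreover have "L'' + B'' \<le> (L + B) / 2 ^ Suc j" using 1(2) 2(2) by simp
        ultimately show ?case using 2(1) by metis
      qed
      define j where "j = n div (2 * N)"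
      obtain L' B' where LB: "Lip L' B' ((twisted t ^^ (2 * N * j)) f)" "L' + B' \<le> (L + B) / 2 ^ j"
        using iter by blast
      have n: "n = n mod (2 * N) + 2 * N * j" by (simp add: j_def)
      have "norm ((twisted t ^^ n) f x) = norm ((twisted t ^^ (n mod (2 * N))) ((twisted t ^^ (2 * N
          * j)) f) x)"
        by (subst n) (simp add: funpow_add)
      also have "\<dots> \<le> B'" by (rule twisted_pow_norm_le[OF LB(1) x])
      also have "\<dots> \<le> (L + B) / 2 ^ j" using LB LipD(2)[OF LB(1)] by simp
      \<comment> \<open>The leading factor 2 pays for the unfinished last block.\<close>
      also have "\<dots> \<le> 2 * exp (- (c * real n * t\<^sup>2)) * (L + B)"
      proof -
        have "n < 2 * N * (j + 1)" using dividend_less_div_times[of "2 * N" n] N0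
          by (simp add: j_def algebra_simps)
        then have "real n \<le> 2 * real N * (real j + 1)"
          by (metis (mono_tags, opaque_lifting) less_imp_le of_nat_1 of_nat_add of_nat_le_iff of_nat_mult
              of_nat_numeral)
        also have "\<dots> \<le> 2 * (2 * K0 / t\<^sup>2) * (real j + 1)" using N2 by (intro mult_right_mono) auto
        finally have "c * real n * t\<^sup>2 \<le> c * (2 * (2 * K0 / t\<^sup>2) * (real j + 1)) * t\<^sup>2"
          using c by (intro mult_right_mono mult_left_mono) auto
        also have "\<dots> = ln 2 * (real j + 1)" using K0 t2 False by (simp add: c_def field_simps)
        finally have "exp (- (ln 2 * (real j + 1))) \<le> exp (- (c * real n * t\<^sup>2))" by simp
        moreover have "exp (- (ln 2 * (real j + 1))) = 1 / (2 * 2 ^ j)"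
        proof -
          have "exp (ln 2 * (real j + 1)) = 2 powr (real (Suc j))" by (simp add: powr_def mult.commute)
          also have "\<dots> = 2 ^ Suc j" by (rule powr_realpow) simp
          finally show ?thesis by (simp add: exp_minus inverse_eq_divide)
        qed
        ultimately have "1 / 2 ^ j \<le> 2 * exp (- (c * real n * t\<^sup>2))" by simp
        from mult_right_mono[OF this, of "L + B"] show ?thesis using L0 B0 by simp
      qed
      finally show ?thesis .
    qed
  qed
qed

text \<open>Four errors are damped separately: \<open>A1\<close> replaces the constant 1 by the
  eigenfunction, \<open>A2\<close> goes back after the steps, \<open>A3\<close> collects the
  transported defects, \<open>A4\<close> replaces powers of the eigenvalue by the exponential. The
  first two are of order \<open>t^2\<close>, the factor with which \<open>U\<close> enters; the
  others are of order \<open>n |t|^p\<close>.\<close>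

lemma twisted_pow_one_estimate:
  obtains \<delta> c C where "0 < \<delta>" "0 < c" "0 \<le> C"
    "\<And>t n x. \<bar>t\<bar> \<le> \<delta> \<Longrightarrow> x \<in> space X \<Longrightarrow>
       norm ((twisted t ^^ n) (\<lambda>_. 1) x - exp (- (real n * (v * t\<^sup>2 / 2))))
         \<le> C * (t\<^sup>2 + real n * \<bar>t\<bar> powr p) * exp (- (c * real n * t\<^sup>2))"
proof -
  obtain C where C: "0 \<le> C" "\<And>t. \<bar>t\<bar> \<le> 1 \<Longrightarrow> Lip (C * \<bar>t\<bar> powr p) (C * \<bar>t\<bar> powr p) (defect t)"
    by (rule defect_Lip) blast
  obtain \<delta>0 c0 where dc: "0 < \<delta>0" "0 < c0" and decay:
    "\<And>t n L B f x. \<bar>t\<bar> \<le> \<delta>0 \<Longrightarrow> Lip L B f \<Longrightarrow> x \<in> space X \<Longrightarrow>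
       norm ((twisted t ^^ n) f x) \<le> 2 * exp (- (c0 * real n * t\<^sup>2)) * (L + B)"
    by (rule twisted_pow_decay) blast
  \<comment> \<open>The rate has to serve both the operators (\<open>c0\<close>) and the powers of
    the eigenvalue (\<open>v / 2\<close>).\<close>
  define c where "c = min c0 (v / 2)"
  have c: "0 < c" "c \<le> c0" "c \<le> v / 2" using dc v_pos by (auto simp: c_def)
  \<comment> \<open>The last bound forces \<open>v * t^2 / 2 \<le> 1\<close>, which keeps the
    eigenvalue nonnegative.\<close>
  define \<delta> where "\<delta> = min \<delta>0 (min 1 (1 / (1 + v)))"
  have dl: "0 < \<delta>" "\<delta> \<le> \<delta>0" "\<delta> \<le> 1" "\<delta> \<le> 1 / (1 + v)" using dc v_pos by (auto simp: \<delta>_def min_le_iff_disj)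
  define C1 where "C1 = 3 * C\<^sub>U + 4 * C * exp c + v\<^sup>2 * exp c"
  have C1: "0 \<le> C1" using C(1) C\<^sub>U_nonneg by (simp add: C1_def)
  show thesis
  proof (rule that[of \<delta> c C1])
    show "0 < \<delta>" "0 < c" "0 \<le> C1" using dl c C1 by auto
    fix t n x assume t: "\<bar>t\<bar> \<le> \<delta>" and x: "x \<in> space X"
    have t1: "\<bar>t\<bar> \<le> 1" using t dl by simp
    have t2: "t\<^sup>2 \<le> 1" using t1 by (simp add: abs_square_le_1)
    have tt: "t\<^sup>2 \<le> \<bar>t\<bar>" using mult_left_mono[OF t1, of "\<bar>t\<bar>"] by (simp add: power2_eq_square)
    have vt: "v * t\<^sup>2 / 2 \<le> 1"
    proof -
      have "v * t\<^sup>2 \<le> v * (1 / (1 + v))" using tt t dl v_pos by (intro mult_left_mono) auto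
      also have "\<dots> \<le> 1" using v_pos by simp
      finally show ?thesis by simp
    qed
    define e where "e n = exp (- (c * real n * t\<^sup>2))" for n :: nat
    define q where "q = \<bar>t\<bar> powr p"
    have e0: "0 \<le> e n" for n by (simp add: e_def)
    have q0: "0 \<le> q" by (simp add: q_def)
    have e_add: "e m * e k = e (m + k)" for m k by (simp add: e_def exp_add[symmetric] algebra_simps)
    \<comment> \<open>The Duhamel sum carries only \<open>n - 1\<close> damping factors; the missing
      one costs the constant \<open>exp c\<close>. At \<open>n = 0\<close> truncated subtraction
      leaves \<open>e 0\<close>, and the bound still holds.\<close>
    have e_pred: "e (n - 1) \<le> exp c * e n"
    proof -
      have "c * real n * t\<^sup>2 \<le> c * (real (n - 1) + 1) * t\<^sup>2" using c
        by (intro mult_right_mono mult_left_mono) auto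
      also have "\<dots> \<le> c * real (n - 1) * t\<^sup>2 + c" using mult_left_mono[OF t2, of c] c
        by (simp add: algebra_simps)
      finally show ?thesis by (simp add: e_def exp_add[symmetric])
    qed
    have c0e: "exp (- (c0 * real m * t\<^sup>2)) \<le> e m" for m using c by (simp add: e_def mult_right_mono)
    have vbase: "exp (- (v * t\<^sup>2 / 2)) \<le> e 1" using mult_right_mono[OF c(3), of "t\<^sup>2"] by (simp add: e_def)
    have e1pow: "e 1 ^ m = e m" for m by (simp add: e_def exp_of_nat_mult[symmetric] mult_ac)
    have ev: "eigenval t ^ m \<le> e m" for m
      using power_mono[OF order_trans[OF eigenval_pow_le(2)[OF vt] vbase] eigenval_pow_le(1)[OF vt], of m]
        by (simp only: e1pow)
    have ev0: "0 \<le> eigenval t" by (rule eigenval_pow_le(1)[OF vt])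
    let ?T = "\<lambda>n f. (twisted t ^^ n) f x"
    have A1: "norm (?T n (\<lambda>x. complex_of_real (t\<^sup>2 / 2) * complex_of_real (U x))) \<le> 2 * C\<^sub>U * t\<^sup>2 * e n"
    proof -
      have "norm (?T n (\<lambda>x. complex_of_real (t\<^sup>2 / 2) * complex_of_real (U x)))
          \<le> 2 * exp (- (c0 * real n * t\<^sup>2)) * (t\<^sup>2 / 2 * C\<^sub>U + t\<^sup>2 / 2 * C\<^sub>U)"
        using t dl by (intro decay[OF _ small_U_Lip x]) auto
      also have "\<dots> \<le> 2 * e n * (t\<^sup>2 / 2 * C\<^sub>U + t\<^sup>2 / 2 * C\<^sub>U)"
        using c0e[of n] C\<^sub>U_nonneg by (intro mult_right_mono mult_left_mono) auto
      finally show ?thesis by (simp add: algebra_simps)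
    qed
    have A2: "norm (eigenval t ^ n * (eigenfun t x - 1)) \<le> C\<^sub>U * t\<^sup>2 * e n"
    proof -
      have "norm (eigenfun t x - 1) \<le> t\<^sup>2 / 2 * C\<^sub>U"
        using LipD(3)[OF small_U_Lip x, of t] by (simp add: eigenfun_def norm_minus_commute)
      then have "norm (eigenval t ^ n * (eigenfun t x - 1)) \<le> e n * (t\<^sup>2 / 2 * C\<^sub>U)"
        unfolding norm_mult using ev[of n] ev0 e0 by (intro mult_mono) (auto simp: norm_power)
      also have "\<dots> \<le> e n * (t\<^sup>2 * C\<^sub>U)" using e0 C\<^sub>U_nonneg by (intro mult_left_mono) auto
      finally show ?thesis by (simp add: mult_ac)
    qed
    have A3: "norm (\<Sum>k<n. eigenval t ^ k * ?T (n - 1 - k) (defect t)) \<le> 4 * C * exp c * (real n * q) * e n"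
    proof -
      have "norm (\<Sum>k<n. eigenval t ^ k * ?T (n - 1 - k) (defect t)) \<le> (\<Sum>k<n. 4 * C * q * e (n - 1))"
      proof (rule sum_norm_le)
        fix k assume k: "k \<in> {..<n}"
        have "norm (?T (n - 1 - k) (defect t))
            \<le> 2 * exp (- (c0 * real (n - 1 - k) * t\<^sup>2)) * (C * q + C * q)"
          unfolding q_def using t dl by (intro decay[OF _ C(2)[OF t1] x]) auto
        also have "\<dots> \<le> 2 * e (n - 1 - k) * (C * q + C * q)"
          using c0e[of "n - 1 - k"] C(1) q0 by (intro mult_right_mono mult_left_mono) auto
        finally have 1: "norm (?T (n - 1 - k) (defect t)) \<le> 2 * e (n - 1 - k) * (C * q + C * q)" .
        have "norm (eigenval t ^ k * ?T (n - 1 - k) (defect t))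
            \<le> e k * (2 * e (n - 1 - k) * (C * q + C * q))"
          unfolding norm_mult using 1 ev[of k] ev0 e0 by (intro mult_mono) (auto simp: norm_power)
        also have "\<dots> = 4 * C * q * (e k * e (n - 1 - k))" by (simp add: algebra_simps)
        \<comment> \<open>The eigenvalue damps \<open>k\<close> steps and the operator the other
          \<open>n - 1 - k\<close>, so every summand carries the full exponential.\<close>
        also have "e k * e (n - 1 - k) = e (n - 1)" using k by (simp add: e_add)
        finally show "norm (eigenval t ^ k * ?T (n - 1 - k) (defect t)) \<le> 4 * C * q * e (n - 1)" .
      qed
      also have "\<dots> = real n * (4 * C * q) * e (n - 1)" by simp
      also have "\<dots> \<le> real n * (4 * C * q) * (exp c * e n)"
        using C(1) q0 by (intro mult_left_mono e_pred) auto
      finally show ?thesis by (simp add: mult_ac)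
    qed
    have A4: "\<bar>eigenval t ^ n - exp (- (real n * (v * t\<^sup>2 / 2)))\<bar> \<le> v\<^sup>2 * exp c * (real n * q) * e n"
    proof (cases n)
      case 0
      then show ?thesis by simp
    next
      case (Suc m)
      let ?u = "v * t\<^sup>2 / 2"
      have "\<bar>eigenval t ^ Suc m - exp (- ?u) ^ Suc m\<bar> \<le> real (Suc m) * e 1 ^ m * \<bar>eigenval t - exp (- ?u)\<bar>"
        using order_trans[OF eigenval_pow_le(2)[OF vt] vbase] by (intro power_diff_bound ev0 vbase) auto
      also have "\<bar>eigenval t - exp (- ?u)\<bar> \<le> ?u\<^sup>2"
        using exp_minus_bounds[of ?u] v_pos by (simp add: eigenval_def)
      also have "?u\<^sup>2 \<le> v\<^sup>2 * q"
      proof -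
        have "\<bar>t\<bar> ^ 4 \<le> \<bar>t\<bar> powr 4" by (cases "t = 0") (auto simp: powr_numeral)
        also have "\<dots> \<le> q" unfolding q_def using t1 p by (intro powr_mono') auto
        finally have "v\<^sup>2 * t ^ 4 \<le> v\<^sup>2 * q" by (intro mult_left_mono) (auto simp: power_even_abs)
        moreover have "?u\<^sup>2 = v\<^sup>2 * t ^ 4 / 4" by (simp add: power2_eq_square power4_eq_xxxx)
        moreover have "0 \<le> v\<^sup>2 * t ^ 4" by simp
        ultimately show ?thesis by linarith
      qed
      finally have "\<bar>eigenval t ^ Suc m - exp (- ?u) ^ Suc m\<bar> \<le> real (Suc m) * e m * (v\<^sup>2 * q)"
        unfolding e1pow using e0[of m] by (simp add: mult_left_mono)
      also have "\<dots> \<le> real (Suc m) * (exp c * e n) * (v\<^sup>2 * q)"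
        using e_pred q0 unfolding Suc by (intro mult_right_mono mult_left_mono) auto
      also have "exp (- ?u) ^ Suc m = exp (- (real n * ?u))" unfolding Suc
        by (simp add: exp_of_nat_mult[symmetric] del: power_Suc)
      finally show ?thesis unfolding Suc by (simp add: mult_ac)
    qed
    have dec: "?T n (\<lambda>_. 1) - exp (- (real n * (v * t\<^sup>2 / 2)))
       = (?T n (\<lambda>x. complex_of_real (t\<^sup>2 / 2) * complex_of_real (U x)) + eigenval t ^ n * (eigenfun t x -
           1))
        + ((\<Sum>k<n. eigenval t ^ k * ?T (n - 1 - k) (defect t)) + complex_of_real (eigenval t ^ n - exp (-
            (real n * (v * t\<^sup>2 / 2)))))"
      unfolding twisted_pow_one[OF x] twisted_pow_eigenfun[OF x t1] by (simp add: algebra_simps)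
    have "norm (?T n (\<lambda>_. 1) - exp (- (real n * (v * t\<^sup>2 / 2))))
       \<le> (2 * C\<^sub>U * t\<^sup>2 * e n + C\<^sub>U * t\<^sup>2 * e n) + (4 * C * exp c * (real n * q) * e n + v\<^sup>2 * exp c * (real
           n * q) * e n)"
      unfolding dec using A4 by (intro norm_triangle_mono A1 A2 A3) (simp only: norm_of_real)
    also have "\<dots> = (3 * C\<^sub>U * t\<^sup>2 + (4 * C * exp c + v\<^sup>2 * exp c) * (real n * q)) * e n"
      by (simp add: algebra_simps)
    also have "\<dots> \<le> (C1 * t\<^sup>2 + C1 * (real n * q)) * e n"
      using C(1) C\<^sub>U_nonneg q0 e0 by (intro mult_right_mono add_mono) (auto simp: C1_def)
    finally show "norm (?T n (\<lambda>_. 1) - exp (- (real n * (v * t\<^sup>2 / 2))))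
         \<le> C1 * (t\<^sup>2 + real n * \<bar>t\<bar> powr p) * exp (- (c * real n * t\<^sup>2))"
      by (simp add: e_def q_def distrib_left)
  qed
qed

end

section \<open>Random walks and the Berry-Esseen bound\<close>

text \<open>The driving sequence is a plain argument, so the same function can be evaluated at
  \<open>\<lambda>i. Y i w\<close> and at points of a product space. Entries are read from index 1
  on, as in \<open>walk\<close>.\<close>

primrec trajectory :: "('g \<Rightarrow> 'x \<Rightarrow> 'x) \<Rightarrow> (nat \<Rightarrow> 'g) \<Rightarrow> 'x \<Rightarrow> nat \<Rightarrow> 'x" where
  "trajectory a y x 0 = x"
| "trajectory a y x (Suc n) = a (y (Suc n)) (trajectory a y x n)"

definition birkhoff :: "('g \<Rightarrow> 'x \<Rightarrow> real) \<Rightarrow> ('g \<Rightarrow> 'x \<Rightarrow> 'x) \<Rightarrow> (nat \<Rightarrow> 'g) \<Rightarrow> 'x \<Rightarrow> nat \<Rightarrow> real" where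
  "birkhoff s a y x n = (\<Sum>k<n. s (y (Suc k)) (trajectory a y x k))"

lemma trajectory_cong: "(\<And>i. 1 \<le> i \<Longrightarrow> i \<le> n \<Longrightarrow> y i = z i) \<Longrightarrow> trajectory a y x n = trajectory a z x n"
  by (induction n) auto

lemma birkhoff_cong: "(\<And>i. 1 \<le> i \<Longrightarrow> i \<le> n \<Longrightarrow> y i = z i) \<Longrightarrow> birkhoff s a y x n = birkhoff s a z x n"
  unfolding birkhoff_def by (intro sum.cong refl arg_cong2[where f=s] trajectory_cong) auto

definition iid_seq :: "'w measure \<Rightarrow> 'g measure \<Rightarrow> (nat \<Rightarrow> 'w \<Rightarrow> 'g) \<Rightarrow> bool" where
  "iid_seq M \<mu> Y \<longleftrightarrow> prob_space M \<and> prob_space.indep_vars M (\<lambda>_. \<mu>) Y {1..} \<and> (\<forall>n\<ge>1. distr M \<mu> (Y n) = \<mu>)"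

lemma iid_seq_measurable: "iid_seq M \<mu> Y \<Longrightarrow> 1 \<le> n \<Longrightarrow> Y n \<in> measurable M \<mu>"
  unfolding iid_seq_def by (auto simp: prob_space.indep_vars_def2)

text \<open>Independence enters as the product rule for preimages, a common form to which both
  independence of blocks of letters and independence of generated sigma-algebras reduce.\<close>

lemma (in prob_space) joint_distr_eqI:
  assumes X [measurable]: "X \<in> measurable M S" and Y [measurable]: "Y \<in> measurable M T"
    and indep: "\<And>A B. A \<in> sets S \<Longrightarrow> B \<in> sets T \<Longrightarrow>
      prob ((X -` A \<inter> space M) \<inter> (Y -` B \<inter> space M)) = prob (X -` A \<inter> space M) * prob (Y -` B \<inter> space M)"
  shows "distr M (S \<Otimes>\<^sub>M T) (\<lambda>w. (X w, Y w)) = distr M S X \<Otimes>\<^sub>M distr M T Y"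
proof (rule pair_measure_eqI[symmetric])
  interpret X: prob_space "distr M S X" by (rule prob_space_distr[OF X])
  interpret Y: prob_space "distr M T Y" by (rule prob_space_distr[OF Y])
  show "sigma_finite_measure (distr M S X)" "sigma_finite_measure (distr M T Y)" ..
  show "sets (distr M S X \<Otimes>\<^sub>M distr M T Y) = sets (distr M (S \<Otimes>\<^sub>M T) (\<lambda>w. (X w, Y w)))" by simp
  fix A B assume AB: "A \<in> sets (distr M S X)" "B \<in> sets (distr M T Y)"
  then have [measurable]: "A \<in> sets S" "B \<in> sets T" by auto
  have "(\<lambda>w. (X w, Y w)) -` (A \<times> B) \<inter> space M = (X -` A \<inter> space M) \<inter> (Y -` B \<inter> space M)" by auto
  then show "emeasure (distr M S X) A * emeasure (distr M T Y) B
      = emeasure (distr M (S \<Otimes>\<^sub>M T) (\<lambda>w. (X w, Y w))) (A \<times> B)"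
    using AB by (simp add: emeasure_distr emeasure_eq_measure indep ennreal_mult[symmetric] pair_measureI)
qed

lemma (in prob_space) indep_expectation:
  fixes F :: "'b \<times> 'c \<Rightarrow> 'd::{banach, second_countable_topology}"
  assumes X: "X \<in> measurable M S" and Y: "Y \<in> measurable M T"
    and indep: "\<And>A B. A \<in> sets S \<Longrightarrow> B \<in> sets T \<Longrightarrow>
      prob ((X -` A \<inter> space M) \<inter> (Y -` B \<inter> space M)) = prob (X -` A \<inter> space M) * prob (Y -` B \<inter> space M)"
    and F: "F \<in> borel_measurable (S \<Otimes>\<^sub>M T)" and int: "integrable M (\<lambda>w. F (X w, Y w))"
  shows "(\<integral>w. F (X w, Y w) \<partial>M) = (\<integral>w. \<integral>w'. F (X w, Y w') \<partial>M \<partial>M)"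
proof -
  interpret X: prob_space "distr M S X" by (rule prob_space_distr[OF X])
  interpret Y: prob_space "distr M T Y" by (rule prob_space_distr[OF Y])
  interpret P: pair_sigma_finite "distr M S X" "distr M T Y" ..
  note joint = joint_distr_eqI[OF X Y indep]
  have XY: "(\<lambda>w. (X w, Y w)) \<in> measurable M (S \<Otimes>\<^sub>M T)" using X Y by measurable
  have "integrable (distr M (S \<Otimes>\<^sub>M T) (\<lambda>w. (X w, Y w))) F"
    by (rule iffD2[OF integrable_distr_eq[OF XY F] int])
  then have i2: "integrable (distr M S X \<Otimes>\<^sub>M distr M T Y) (\<lambda>(x, y). F (x, y))"
    by (simp only: joint case_prod_eta)
  have F': "(\<lambda>(x, y). F (x, y)) \<in> borel_measurable (S \<Otimes>\<^sub>M distr M T Y)" using F by simp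
  have "(\<integral>w. F (X w, Y w) \<partial>M) = (\<integral>q. F q \<partial>distr M (S \<Otimes>\<^sub>M T) (\<lambda>w. (X w, Y w)))"
    by (rule integral_distr[OF XY F, symmetric])
  also have "\<dots> = (\<integral>(x, y). F (x, y) \<partial>(distr M S X \<Otimes>\<^sub>M distr M T Y))"
    by (simp only: joint case_prod_eta)
  also have "\<dots> = (\<integral>x. \<integral>y. F (x, y) \<partial>distr M T Y \<partial>distr M S X)"
    by (rule P.integral_fst[OF i2, symmetric])
  also have "\<dots> = (\<integral>w. \<integral>y. F (X w, y) \<partial>distr M T Y \<partial>M)"
    by (rule integral_distr[OF X Y.borel_measurable_lebesgue_integral[OF F']])
  also have "\<dots> = (\<integral>w. \<integral>w'. F (X w, Y w') \<partial>M \<partial>M)"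
  proof (rule Bochner_Integration.integral_cong[OF refl])
    fix w assume w: "w \<in> space M"
    have "(\<lambda>y. F (X w, y)) \<in> borel_measurable T"
      by (rule measurable_compose[OF measurable_Pair1'[OF measurable_space[OF X w]] F])
    then show "(\<integral>y. F (X w, y) \<partial>distr M T Y) = (\<integral>w'. F (X w, Y w') \<partial>M)"
      by (rule integral_distr[OF Y])
  qed
  finally show ?thesis .
qed

context contracting_ifs
begin

lemma trajectory_in_space: "x \<in> space X \<Longrightarrow> (\<And>i. 1 \<le> i \<Longrightarrow> y i \<in> space \<mu>) \<Longrightarrow> trajectory act y x n \<in> space X"
  by (induction n) auto

lemma trajectory_measurable:
  assumes "h \<in> measurable N X" "\<And>i. 1 \<le> i \<Longrightarrow> i \<le> n \<Longrightarrow> (\<lambda>w. y w i) \<in> measurable N \<mu>"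
  shows "(\<lambda>w. trajectory act (y w) (h w) n) \<in> measurable N X"
  using assms by (induction n) auto

lemma birkhoff_measurable:
  assumes "h \<in> measurable N X" "\<And>i. 1 \<le> i \<Longrightarrow> i \<le> n \<Longrightarrow> (\<lambda>w. y w i) \<in> measurable N \<mu>"
  shows "(\<lambda>w. birkhoff \<sigma> act (y w) (h w) n) \<in> borel_measurable N"
  unfolding birkhoff_def
proof (intro borel_measurable_sum)
  fix k assume "k \<in> {..<n}"
  then have "(\<lambda>w. y w (Suc k)) \<in> measurable N \<mu>" "(\<lambda>w. trajectory act (y w) (h w) k) \<in> measurable N X"
    using assms by (auto intro!: trajectory_measurable)
  then show "(\<lambda>w. \<sigma> (y w (Suc k)) (trajectory act (y w) (h w) k)) \<in> borel_measurable N"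
    by (rule \<sigma>_measurable)
qed

text \<open>Markov property: position and sum after \<open>n\<close> steps are functions of the
  first \<open>n\<close> letters, hence independent of the next letter, which can be integrated out
  under \<open>\<mu>\<close>.\<close>

lemma expectation_step:
  fixes F :: "'g \<times> 'x \<times> real \<Rightarrow> 'c::{banach, second_countable_topology}"
  assumes iid: "iid_seq M \<mu> Y" and x: "x \<in> space X"
    and F: "F \<in> borel_measurable (\<mu> \<Otimes>\<^sub>M (X \<Otimes>\<^sub>M borel))"
    and int: "integrable M (\<lambda>w. F (Y (Suc n) w, trajectory act (\<lambda>i. Y i w) x n, birkhoff \<sigma> act (\<lambda>i. Y i w) x
        n))"
  shows "(\<integral>w. F (Y (Suc n) w, trajectory act (\<lambda>i. Y i w) x n, birkhoff \<sigma> act (\<lambda>i. Y i w) x n) \<partial>M)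
     = (\<integral>w. \<integral>g. F (g, trajectory act (\<lambda>i. Y i w) x n, birkhoff \<sigma> act (\<lambda>i. Y i w) x n) \<partial>\<mu> \<partial>M)"
proof -
  interpret M: prob_space M using iid by (simp add: iid_seq_def)
  note Ym = iid_seq_measurable[OF iid]
  define Z where "Z w = (trajectory act (\<lambda>i. Y i w) x n, birkhoff \<sigma> act (\<lambda>i. Y i w) x n)" for w
  let ?Q = "X \<Otimes>\<^sub>M (borel :: real measure)"
  have Zm [measurable]: "Z \<in> measurable M ?Q"
    unfolding Z_def by (intro measurable_Pair trajectory_measurable birkhoff_measurable measurable_const[OF
        x] Ym)
  have Y1 [measurable]: "Y (Suc n) \<in> measurable M \<mu>" by (rule Ym) simp
  \<comment> \<open>The restrictions of the sequence to the disjoint index blocks are independent;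
    \<open>?pA\<close> and \<open>?pB\<close> recover the new letter and the current state from
    them.\<close>
  let ?A = "PiM {Suc n} (\<lambda>_. \<mu>)" and ?B = "PiM {1..n} (\<lambda>_. \<mu>)"
  let ?rA = "\<lambda>w. restrict (\<lambda>i. Y i w) {Suc n}" and ?rB = "\<lambda>w. restrict (\<lambda>i. Y i w) {1..n}"
  let ?pA = "\<lambda>f. f (Suc n)" and ?pB = "\<lambda>f. (trajectory act f x n, birkhoff \<sigma> act f x n)"
  have ind: "M.indep_var ?A ?rA ?B ?rB"
    by (rule M.indep_var_restrict[where I="{1..}"]) (use iid in \<open>auto simp: iid_seq_def\<close>)
  have pA [measurable]: "?pA \<in> measurable ?A \<mu>" by (rule measurable_component_singleton) simp
  have pB [measurable]: "?pB \<in> measurable ?B ?Q"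
    by (intro measurable_Pair trajectory_measurable birkhoff_measurable measurable_const[OF x]
        measurable_component_singleton) auto
  have ZB: "Z w = ?pB (?rB w)" for w
    by (auto simp: Z_def intro!: trajectory_cong birkhoff_cong)
  have sp: "w \<in> space M \<Longrightarrow> ?rA w \<in> space ?A" "w \<in> space M \<Longrightarrow> ?rB w \<in> space ?B" for w
    using measurable_space[OF M.indep_var_rv1[OF ind]] measurable_space[OF M.indep_var_rv2[OF ind]] by auto
  have indep: "M.prob ((Z -` B \<inter> space M) \<inter> (Y (Suc n) -` A \<inter> space M))
      = M.prob (Z -` B \<inter> space M) * M.prob (Y (Suc n) -` A \<inter> space M)"
    if AB: "B \<in> sets ?Q" "A \<in> sets \<mu>" for A B
  proof -
    let ?A' = "?pA -` A \<inter> space ?A" and ?B' = "?pB -` B \<inter> space ?B"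
    have e1: "?rA -` ?A' \<inter> space M = Y (Suc n) -` A \<inter> space M" using sp(1) by auto
    have e2: "?rB -` ?B' \<inter> space M = Z -` B \<inter> space M" using sp(2) unfolding ZB by auto
    have "M.prob ((\<lambda>w. (?rA w, ?rB w)) -` (?A' \<times> ?B') \<inter> space M)
        = M.prob (?rA -` ?A' \<inter> space M) * M.prob (?rB -` ?B' \<inter> space M)"
      by (rule M.indep_varD[OF ind]) (use AB pA pB in \<open>auto intro: measurable_sets\<close>)
    moreover have "(\<lambda>w. (?rA w, ?rB w)) -` (?A' \<times> ?B') \<inter> space M
        = (?rB -` ?B' \<inter> space M) \<inter> (?rA -` ?A' \<inter> space M)" by auto
    ultimately show ?thesis by (simp only: e1 e2 mult.commute)
  qed
  have F': "(\<lambda>(z, g). F (g, z)) \<in> borel_measurable (?Q \<Otimes>\<^sub>M \<mu>)" using F by measurable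
  have "(\<integral>w. (\<lambda>(z, g). F (g, z)) (Z w, Y (Suc n) w) \<partial>M)
      = (\<integral>w. \<integral>w'. (\<lambda>(z, g). F (g, z)) (Z w, Y (Suc n) w') \<partial>M \<partial>M)"
  proof (rule M.indep_expectation[OF Zm Y1 _ F'])
    show "integrable M (\<lambda>w. (\<lambda>(z, g). F (g, z)) (Z w, Y (Suc n) w))" using int
      by (simp only: Z_def prod.case)
  qed (rule indep)
  then have "(\<integral>w. F (Y (Suc n) w, Z w) \<partial>M) = (\<integral>w. \<integral>w'. F (Y (Suc n) w', Z w) \<partial>M \<partial>M)"
    by (simp only: prod.case)
  also have "\<dots> = (\<integral>w. \<integral>g. F (g, Z w) \<partial>\<mu> \<partial>M)"
  proof (rule Bochner_Integration.integral_cong[OF refl])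
    fix w assume w: "w \<in> space M"
    have "(\<lambda>g. F (g, Z w)) \<in> borel_measurable \<mu>"
      by (rule measurable_compose[OF measurable_Pair2'[OF measurable_space[OF Zm w]] F])
    then have "(\<integral>g. F (g, Z w) \<partial>distr M \<mu> (Y (Suc n))) = (\<integral>w'. F (Y (Suc n) w', Z w) \<partial>M)"
      by (rule integral_distr[OF Y1])
    then show "(\<integral>w'. F (Y (Suc n) w', Z w) \<partial>M) = (\<integral>g. F (g, Z w) \<partial>\<mu>)"
      using iid by (simp add: iid_seq_def)
  qed
  finally show ?thesis by (simp add: Z_def)
qed

text \<open>Integrating out the newest letter turns \<open>f\<close> into
  \<open>twisted t f\<close>; the induction therefore runs with \<open>f\<close> arbitrary.\<close>

lemma twisted_pow_expectation:
  assumes iid: "iid_seq M \<mu> Y" and x: "x \<in> space X" and f: "Lip L B f"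
  shows "(\<integral>w. iexp (t * birkhoff \<sigma> act (\<lambda>i. Y i w) x n) * f (trajectory act (\<lambda>i. Y i w) x n) \<partial>M)
      = (twisted t ^^ n) f x"
  using f
proof (induction n arbitrary: f L B)
  case 0
  interpret M: prob_space M using iid by (simp add: iid_seq_def)
  show ?case by (simp add: birkhoff_def M.prob_space)
next
  case (Suc n)
  interpret M: prob_space M using iid by (simp add: iid_seq_def)
  note Ym = iid_seq_measurable[OF iid]
  note [measurable] = LipD(1)[OF Suc.prems]
  let ?p = "\<lambda>w. trajectory act (\<lambda>i. Y i w) x n" and ?s = "\<lambda>w. birkhoff \<sigma> act (\<lambda>i. Y i w) x n"
  have [measurable]: "?p \<in> measurable M X" "?s \<in> borel_measurable M" "Y (Suc n) \<in> measurable M \<mu>"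
    by (auto intro!: trajectory_measurable birkhoff_measurable measurable_const[OF x] Ym)
  let ?F = "\<lambda>(g, z, s). iexp (t * s) * (iexp (t * \<sigma> g z) * f (act g z))"
  have "(\<integral>w. iexp (t * birkhoff \<sigma> act (\<lambda>i. Y i w) x (Suc n)) * f (trajectory act (\<lambda>i. Y i w) x (Suc n)) \<partial>M)
      = (\<integral>w. ?F (Y (Suc n) w, ?p w, ?s w) \<partial>M)"
    by (simp add: birkhoff_def distrib_left exp_add mult_ac)
  also have "\<dots> = (\<integral>w. \<integral>g. ?F (g, ?p w, ?s w) \<partial>\<mu> \<partial>M)"
  proof (rule expectation_step[OF iid x])
    show "?F \<in> borel_measurable (\<mu> \<Otimes>\<^sub>M (X \<Otimes>\<^sub>M borel))" by measurable
    show "integrable M (\<lambda>w. ?F (Y (Suc n) w, ?p w, ?s w))"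
    proof (rule M.integrable_const_bound[where B=B])
      show "AE w in M. norm (?F (Y (Suc n) w, ?p w, ?s w)) \<le> B"
      proof (rule AE_I2)
        fix w assume w: "w \<in> space M"
        have "act (Y (Suc n) w) (?p w) \<in> space X"
          by (intro act_in_space trajectory_in_space[OF x] measurable_space[OF Ym w]) auto
        then show "norm (?F (Y (Suc n) w, ?p w, ?s w)) \<le> B"
          using LipD(3)[OF Suc.prems] by (simp add: norm_mult)
      qed
    qed measurable
  qed
  also have "\<dots> = (\<integral>w. iexp (t * ?s w) * twisted t f (?p w) \<partial>M)"
    unfolding twisted_def by simp
  also have "\<dots> = (twisted t ^^ n) (twisted t f) x"
    by (rule Suc.IH[OF twisted_Lip[OF Suc.prems]])
  finally show ?case by (simp only: funpow_Suc_right o_apply)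
qed

text \<open>The starting point \<open>h\<close> may be random, so that the lemma also covers
  \<open>W0\<close>. Each step adds at most the square integrable \<open>l\<close> of the new
  letter.\<close>

lemma birkhoff_square_integrable:
  assumes iid: "iid_seq M \<mu> Y" and h: "h \<in> measurable M X"
  shows "integrable M (\<lambda>w. (birkhoff \<sigma> act (\<lambda>i. Y i w) (h w) n)\<^sup>2)"
proof (induction n)
  case 0
  show ?case by (simp add: birkhoff_def)
next
  case (Suc n)
  note Ym = iid_seq_measurable[OF iid]
  let ?p = "\<lambda>w. trajectory act (\<lambda>i. Y i w) (h w) n" and ?s = "\<lambda>w. birkhoff \<sigma> act (\<lambda>i. Y i w) (h w) n"
  have Y1 [measurable]: "Y (Suc n) \<in> measurable M \<mu>" by (rule Ym) simp
  have "integrable (distr M \<mu> (Y (Suc n))) (\<lambda>g. (l g)\<^sup>2)"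
    using iid l_sq_integrable by (simp add: iid_seq_def)
  then have l2: "integrable M (\<lambda>w. (l (Y (Suc n) w))\<^sup>2)"
    by (subst (asm) integrable_distr_eq) auto
  show ?case
  proof (rule Bochner_Integration.integrable_bound[OF Bochner_Integration.integrable_add[OF
      integrable_mult_right[OF Suc.IH, of 2] integrable_mult_right[OF l2, of 2]]])
    show "(\<lambda>w. (birkhoff \<sigma> act (\<lambda>i. Y i w) (h w) (Suc n))\<^sup>2) \<in> borel_measurable M"
      by (intro borel_measurable_power birkhoff_measurable h Ym)
    show "AE w in M. norm ((birkhoff \<sigma> act (\<lambda>i. Y i w) (h w) (Suc n))\<^sup>2)
        \<le> norm (2 * (?s w)\<^sup>2 + 2 * (l (Y (Suc n) w))\<^sup>2)"
    proof (rule AE_I2)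
      fix w assume w: "w \<in> space M"
      have "?p w \<in> space X"
        by (rule trajectory_in_space[OF measurable_space[OF h w] measurable_space[OF Ym w]])
      then have "\<bar>\<sigma> (Y (Suc n) w) (?p w)\<bar> \<le> \<bar>l (Y (Suc n) w)\<bar>"
        by (intro order_trans[OF \<sigma>_bound[OF measurable_space[OF Y1 w]] abs_ge_self])
      then have "(\<sigma> (Y (Suc n) w) (?p w))\<^sup>2 \<le> (l (Y (Suc n) w))\<^sup>2" by (simp add: abs_le_square_iff)
      moreover have "(?s w + \<sigma> (Y (Suc n) w) (?p w))\<^sup>2 \<le> 2 * (?s w)\<^sup>2 + 2 * (\<sigma> (Y (Suc n) w) (?p w))\<^sup>2"
        using zero_le_power2[of "?s w - \<sigma> (Y (Suc n) w) (?p w)"]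
          by (simp add: power2_eq_square algebra_simps)
      ultimately show "norm ((birkhoff \<sigma> act (\<lambda>i. Y i w) (h w) (Suc n))\<^sup>2)
          \<le> norm (2 * (?s w)\<^sup>2 + 2 * (l (Y (Suc n) w))\<^sup>2)"
        by (simp add: birkhoff_def)
    qed
  qed
qed

end

text \<open>The second moment plus the mean of \<open>U\<close> at the current position grows by
  exactly \<open>v\<close> per step: the cross term vanishes by centering, and the Poisson equation
  trades the conditional variance for \<open>v\<close> and an increment of \<open>U\<close>.
  Boundedness of \<open>U\<close> is the error.\<close>

lemma (in centered_ifs) birkhoff_second_moment:
  assumes iid: "iid_seq M \<mu> Y" and x: "x \<in> space X"
  shows "\<bar>(\<integral>w. (birkhoff \<sigma> act (\<lambda>i. Y i w) x n)\<^sup>2 \<partial>M) - real n * v\<bar> \<le> 2 * C\<^sub>U"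
proof -
  interpret M: prob_space M using iid by (simp add: iid_seq_def)
  note Ym = iid_seq_measurable[OF iid]
  let ?p = "\<lambda>n w. trajectory act (\<lambda>i. Y i w) x n" and ?s = "\<lambda>n w. birkhoff \<sigma> act (\<lambda>i. Y i w) x n"
  have [measurable]: "?p n \<in> measurable M X" "?s n \<in> borel_measurable M" "Y (Suc n) \<in> measurable M \<mu>" for n
    by (auto intro!: trajectory_measurable birkhoff_measurable measurable_const[OF x] Ym)
  have pX: "w \<in> space M \<Longrightarrow> ?p n w \<in> space X" for n w
    by (rule trajectory_in_space[OF x measurable_space[OF Ym]])
  have Um [measurable]: "U \<in> borel_measurable X" using LipD(1)[OF U_Lip] .
  have mUm [measurable]: "markov U \<in> borel_measurable X" using LipD(1)[OF markov_Lip(2)[OF U_Lip]] .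
  have Vm [measurable]: "(\<lambda>x. \<integral>g. (\<sigma> g x)\<^sup>2 \<partial>\<mu>) \<in> borel_measurable X" using LipD(1)[OF square_Lip] .
  have iU: "integrable M (\<lambda>w. U (?p n w))" for n
    by (rule M.integrable_const_bound[where B=C\<^sub>U]) (auto intro!: AE_I2 LipD(3)[OF U_Lip, unfolded
        real_norm_def] pX)
  have imU: "integrable M (\<lambda>w. markov U (?p n w))" for n
    by (rule M.integrable_const_bound[where B=C\<^sub>U]) (auto intro!: AE_I2 LipD(3)[OF markov_Lip(2)[OF U_Lip],
        unfolded real_norm_def] pX)
  have step_U: "(\<integral>w. U (?p (Suc n) w) \<partial>M) = (\<integral>w. markov U (?p n w) \<partial>M)" for n
    using expectation_step[OF iid x, of "\<lambda>(g, z, s). U (act g z)" n] iU[of "Suc n"]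
      by (simp add: markov_def)
  have step_S: "(\<integral>w. (?s (Suc n) w)\<^sup>2 \<partial>M)
      = (\<integral>w. (?s n w)\<^sup>2 \<partial>M) + v + (\<integral>w. U (?p n w) \<partial>M) - (\<integral>w. markov U (?p n w) \<partial>M)" for n
  proof -
    have "(\<integral>w. (?s (Suc n) w)\<^sup>2 \<partial>M) = (\<integral>w. \<integral>g. (?s n w + \<sigma> g (?p n w))\<^sup>2 \<partial>\<mu> \<partial>M)"
      using expectation_step[OF iid x, of "\<lambda>(g, z, s). (s
          + \<sigma> g z)\<^sup>2" n] birkhoff_square_integrable[OF iid measurable_const[OF x], of "Suc n"]
      by (simp add: birkhoff_def)
    also have "\<dots> = (\<integral>w. (?s n w)\<^sup>2 + v + U (?p n w) - markov U (?p n w) \<partial>M)"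
    proof (rule Bochner_Integration.integral_cong[OF refl])
      fix w assume "w \<in> space M"
      note q = pX[OF this, of n]
      have "(\<integral>g. (?s n w + \<sigma> g (?p n w))\<^sup>2 \<partial>\<mu>)
          = (\<integral>g. (?s n w)\<^sup>2 + 2 * ?s n w * \<sigma> g (?p n w) + (\<sigma> g (?p n w))\<^sup>2 \<partial>\<mu>)"
        by (simp add: power2_sum algebra_simps)
      also have "\<dots> = (?s n w)\<^sup>2 + (\<integral>g. (\<sigma> g (?p n w))\<^sup>2 \<partial>\<mu>)"
        using \<sigma>_integrable[OF q] \<sigma>_sq_integrable[OF q] centered[OF q] by (simp add: prob_space)
      finally show "(\<integral>g. (?s n w + \<sigma> g (?p n w))\<^sup>2 \<partial>\<mu>) = (?s n w)\<^sup>2 + v + U (?p n w) - markov U (?p n w)"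
        using U_poisson[OF q] by simp
    qed
    also have "\<dots> = (\<integral>w. (?s n w)\<^sup>2 \<partial>M) + v + (\<integral>w. U (?p n w) \<partial>M) - (\<integral>w. markov U (?p n w) \<partial>M)"
      using birkhoff_square_integrable[OF iid measurable_const[OF x], of n] iU[of n] imU[of n]
        by (simp add: M.prob_space)
    finally show ?thesis .
  qed
  have "(\<integral>w. (?s n w)\<^sup>2 \<partial>M) + (\<integral>w. U (?p n w) \<partial>M) = real n * v + U x"
    by (induction n) (simp_all add: birkhoff_def[of _ _ _ _ 0] M.prob_space step_S step_U[simplified]
        algebra_simps)
  moreover have "\<bar>U x\<bar> \<le> C\<^sub>U" using LipD(3)[OF U_Lip x] by simp
  moreover have "\<bar>\<integral>w. U (?p n w) \<partial>M\<bar> \<le> C\<^sub>U"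
  proof -
    have "norm (\<integral>w. U (?p n w) \<partial>M) \<le> (\<integral>w. C\<^sub>U \<partial>M)"
      by (rule norm_integral_le[OF iU]) (auto intro!: LipD(3)[OF U_Lip, unfolded real_norm_def] pX)
    then show ?thesis by (simp add: M.prob_space)
  qed
  ultimately show ?thesis by linarith
qed

section \<open>The Berry-Esseen bound for centered cocycles\<close>

text \<open>One factor \<open>1 + u^2\<close> absorbs the polynomial growth of the error, the other
  the denominator of Esseen's hypothesis. The Gaussian wins because
  \<open>y^2 / 2 \<le> exp y\<close> for nonnegative \<open>y\<close>.\<close>

lemma exp_polynomial_bound:
  fixes a u :: real
  assumes a: "0 < a"
  shows "(1 + u\<^sup>2)\<^sup>2 * exp (- (a * u\<^sup>2)) \<le> 2 + 4 / a\<^sup>2"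
proof -
  let ?y = "a * u\<^sup>2"
  have y: "0 \<le> ?y" using a by simp
  have "(1 + u\<^sup>2)\<^sup>2 \<le> 2 + 2 * (u\<^sup>2)\<^sup>2"
    using zero_le_power2[of "1 - u\<^sup>2"] by (simp add: power2_eq_square algebra_simps)
  also have "\<dots> = 2 * 1 + 4 / a\<^sup>2 * (?y\<^sup>2 / 2)" using a by (simp add: power_mult_distrib)
  also have "\<dots> \<le> 2 * exp ?y + 4 / a\<^sup>2 * exp ?y"
    using exp_lower_Taylor_quadratic[OF y] y by (intro add_mono mult_left_mono) auto
  also have "\<dots> = (2 + 4 / a\<^sup>2) * exp ?y" by (simp add: algebra_simps)
  finally have "(1 + u\<^sup>2)\<^sup>2 * exp (- ?y) \<le> (2 + 4 / a\<^sup>2) * exp ?y * exp (- ?y)"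
    by (intro mult_right_mono) auto
  also have "\<dots> = 2 + 4 / a\<^sup>2" by (simp add: mult.assoc flip: exp_add)
  finally show ?thesis .
qed

text \<open>Esseen's inequality for the sum divided by \<open>b = sqrt (v * n)\<close>, with cutoff
  \<open>\<delta> * b\<close>, the range in which the estimate of the twisted powers holds. The rate
  \<open>r\<close> dominates both \<open>1 / n\<close>, which comes from the term
  \<open>t^2\<close>, and the cutoff term of order \<open>1 / sqrt n\<close>.\<close>

lemma (in nondegenerate_ifs) berry_esseen_centered:
  obtains C where "0 \<le> C"
    "\<And>M :: 'w measure. \<And>Y n x t. iid_seq M \<mu> Y \<Longrightarrow> 1 \<le> n \<Longrightarrow> x \<in> space X \<Longrightarrow>
       \<bar>measure M {w \<in> space M. birkhoff \<sigma> act (\<lambda>i. Y i w) x n \<le> t * sqrt (real n)}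
         - cdf std_normal_distribution (t / sqrt v)\<bar> \<le> C * (1 / real n) powr (p / 2 - 1)"
proof -
  obtain C0 where C0: "0 < C0" and ess:
    "\<And>N \<epsilon> T x. real_distribution N \<Longrightarrow> 0 < T \<Longrightarrow> 0 \<le> \<epsilon> \<Longrightarrow>
      (\<And>s. \<bar>s\<bar> \<le> T \<Longrightarrow> norm (char N s - char std_normal_distribution s) \<le> \<epsilon> * \<bar>s\<bar> / (1 + s\<^sup>2)) \<Longrightarrow>
      \<bar>cdf N x - cdf std_normal_distribution x\<bar> \<le> C0 * (\<epsilon> + 1 / T)"
    by (rule esseen_inequality) blast
  obtain \<delta> c C1 where dc: "0 < \<delta>" "0 < c" "0 \<le> C1" and est:
    "\<And>t n x. \<bar>t\<bar> \<le> \<delta> \<Longrightarrow> x \<in> space X \<Longrightarrow>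
       norm ((twisted t ^^ n) (\<lambda>_. 1) x - exp (- (real n * (v * t\<^sup>2 / 2))))
         \<le> C1 * (t\<^sup>2 + real n * \<bar>t\<bar> powr p) * exp (- (c * real n * t\<^sup>2))"
    by (rule twisted_pow_one_estimate) blast
  define a where "a = c / v"
  have a: "0 < a" using dc v_pos by (simp add: a_def)
  define E where "E = C1 * (1 / v + 1 / v powr (p / 2)) * 2 * (2 + 4 / a\<^sup>2)"
  have E: "0 \<le> E" using dc v_pos by (simp add: E_def)
  define C where "C = C0 * (E + 1 / (\<delta> * sqrt v))"
  show thesis
  proof (rule that[of C])
    show "0 \<le> C" using C0 E dc v_pos by (simp add: C_def)
    fix M :: "'w measure" and Y and n :: nat and x t
    assume iid: "iid_seq M \<mu> Y" and n: "1 \<le> n" and x: "x \<in> space X"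
    interpret M: prob_space M using iid by (simp add: iid_seq_def)
    let ?s = "\<lambda>w. birkhoff \<sigma> act (\<lambda>i. Y i w) x n"
    have sm [measurable]: "?s \<in> borel_measurable M"
      by (intro birkhoff_measurable measurable_const[OF x] iid_seq_measurable[OF iid])
    define b where "b = sqrt (v * real n)"
    have b: "0 < b" using v_pos n by (simp add: b_def)
    have b2: "b\<^sup>2 = v * real n" using v_pos by (simp add: b_def)
    define N where "N = distr M borel (\<lambda>w. ?s w / b)"
    have N: "real_distribution N" unfolding N_def by (rule M.real_distribution_distr) measurable
    define r where "r = (1 / real n) powr (p / 2 - 1)"
    have r0: "0 \<le> r" by (simp add: r_def)
    have rn: "1 / real n \<le> r"
    proof -
      have "(1 / real n) powr 1 \<le> r" unfolding r_def using n p by (intro powr_mono') auto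
      then show ?thesis using n by simp
    qed
    have rs: "1 / sqrt (real n) \<le> r"
    proof -
      have "(1 / real n) powr (1 / 2) \<le> r" unfolding r_def using n p by (intro powr_mono') auto
      then show ?thesis using n by (simp add: powr_half_sqrt real_sqrt_divide)
    qed
    have ch: "char N u = (twisted (u / b) ^^ n) (\<lambda>_. 1) x" for u
    proof -
      have "char N u = (\<integral>w. iexp (u * (?s w / b)) \<partial>M)"
        unfolding char_def N_def by (subst integral_distr) auto
      also have "\<dots> = (\<integral>w. iexp (u / b * ?s w) * 1 \<partial>M)" by simp
      also have "\<dots> = (twisted (u / b) ^^ n) (\<lambda>_. 1) x"
        by (rule twisted_pow_expectation[OF iid x Lip_const[of 1 1]]) simp
      finally show ?thesis .
    qed
    have "\<bar>cdf N (t / sqrt v) - cdf std_normal_distribution (t / sqrt v)\<bar> \<le> C0 * (E * r + 1 / (\<delta> * b))"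
    proof (rule ess[OF N])
      show "0 < \<delta> * b" using dc b by simp
      show "0 \<le> E * r" using E r0 by simp
      fix u assume u: "\<bar>u\<bar> \<le> \<delta> * b"
      have ub: "\<bar>u / b\<bar> \<le> \<delta>" using u b by (simp add: field_simps)
      have 1: "real n * (v * (u / b)\<^sup>2 / 2) = u\<^sup>2 / 2" using v_pos n by (simp add: power_divide b2)
      have 2: "c * real n * (u / b)\<^sup>2 = a * u\<^sup>2" using v_pos n by (simp add: power_divide b2 a_def)
      have 3: "(u / b)\<^sup>2 = u\<^sup>2 * (1 / v) * (1 / real n)" by (simp add: power_divide b2)
      have 4: "real n * \<bar>u / b\<bar> powr p = \<bar>u\<bar> powr p * (1 / v powr (p / 2)) * r"
      proof -
        have "b powr p = (v * real n) powr (p / 2)"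
          unfolding b_def using v_pos by (simp add: powr_half_sqrt[symmetric] powr_powr)
        also have "\<dots> = v powr (p / 2) * real n powr (p / 2)" using v_pos by (simp add: powr_mult)
        finally have bp: "b powr p = v powr (p / 2) * real n powr (p / 2)" .
        have "real n / real n powr (p / 2) = real n powr (1 - p / 2)" using n by (simp add: powr_diff)
        also have "\<dots> = r" using n by (simp add: r_def powr_divide powr_minus_divide[symmetric] )
        finally have "real n / real n powr (p / 2) = r" .
        moreover have "\<bar>u / b\<bar> powr p = \<bar>u\<bar> powr p / b powr p" using b by (simp add: powr_divide)
        moreover have "real n * (w / (V * z)) = w * (1 / V) * (real n / z)" for w V z :: real by simp
        ultimately show ?thesis by (simp only: bp)
      qed
      have "norm (char N u - char std_normal_distribution u)
         = norm ((twisted (u / b) ^^ n) (\<lambda>_. 1) x - exp (- (real n * (v * (u / b)\<^sup>2 / 2))))"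
        unfolding ch char_std_normal_distribution 1 by simp
      also have "\<dots> \<le> C1 * ((u / b)\<^sup>2 + real n * \<bar>u / b\<bar> powr p) * exp (- (c * real n * (u / b)\<^sup>2))"
        by (rule est[OF ub x])
      also have "\<dots> = C1 * (u\<^sup>2 * (1 / v) * (1 / real n) + \<bar>u\<bar> powr p * (1 / v powr (p / 2)) * r) * exp (- (a
          * u\<^sup>2))"
        unfolding 2 4 unfolding 3 ..
      \<comment> \<open>One factor \<open>|u|\<close> is split off, as Esseen's hypothesis requires
        near 0; the rest grows at most quadratically because \<open>p - 1 \<le> 2\<close>.\<close>
      also have "\<dots> \<le> C1 * ((\<bar>u\<bar> * (2 * (1 + u\<^sup>2))) * (1 / v) * r + (\<bar>u\<bar> * (2 * (1 + u\<^sup>2)))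
          * (1 / v powr (p / 2)) * r) * exp (- (a * u\<^sup>2))"
      proof -
        have "\<bar>u\<bar> \<le> 1 + u\<^sup>2" using zero_le_power2[of "\<bar>u\<bar> - 1"]
          by (simp add: power2_eq_square algebra_simps)
        then have A: "u\<^sup>2 \<le> \<bar>u\<bar> * (2 * (1 + u\<^sup>2))"
          using mult_left_mono[of "\<bar>u\<bar>" "2 * (1 + u\<^sup>2)" "\<bar>u\<bar>"] by (simp add: power2_eq_square)
        have B: "\<bar>u\<bar> powr p \<le> \<bar>u\<bar> * (2 * (1 + u\<^sup>2))"
        proof (cases "u = 0")
          case False
          have "\<bar>u\<bar> powr (p - 1) \<le> 1 + u\<^sup>2"
          proof (cases "\<bar>u\<bar> \<le> 1")
            case True
            then have "\<bar>u\<bar> powr (p - 1) \<le> \<bar>u\<bar> powr 0" using p by (intro powr_mono') auto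
            also have "\<dots> = 1" using False by simp
            also have "\<dots> \<le> 1 + u\<^sup>2" by simp
            finally show ?thesis .
          next
            case False
            then have "\<bar>u\<bar> powr (p - 1) \<le> \<bar>u\<bar> powr 2" using p by (intro powr_mono) auto
            also have "\<dots> = u\<^sup>2" using False by (subst powr_numeral) auto
            finally show ?thesis by simp
          qed
          then have "\<bar>u\<bar> powr (p - 1) \<le> 2 * (1 + u\<^sup>2)" by (rule order_trans) simp
          from mult_left_mono[OF this, of "\<bar>u\<bar>"] show ?thesis using False by (simp add: powr_mult_base)
        qed simp
        show ?thesis
          using A B rn r0 dc v_pos n by (intro mult_right_mono mult_left_mono add_mono mult_mono) auto
      qed
      also have "\<dots> = C1 * (1 / v + 1 / v powr (p / 2)) * 2 * ((1 + u\<^sup>2)\<^sup>2 * exp (- (a * u\<^sup>2))) * r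
          * \<bar>u\<bar> / (1 + u\<^sup>2)"
      proof -
        have "1 + u\<^sup>2 \<noteq> 0" by (metis add_pos_nonneg less_irrefl zero_le_power2 zero_less_one)
        moreover have "C1 * ((w * (2 * z)) * A * r + (w * (2 * z)) * B * r) * e
            = C1 * (A + B) * 2 * (z\<^sup>2 * e) * r * w / z"
          if "z \<noteq> 0" for z w A B e :: real
          using that by (simp add: power2_eq_square field_simps)
        ultimately show ?thesis by blast
      qed
      also have "\<dots> \<le> C1 * (1 / v + 1 / v powr (p / 2)) * 2 * (2 + 4 / a\<^sup>2) * r * \<bar>u\<bar> / (1 + u\<^sup>2)"
        using dc v_pos r0 by (intro divide_right_mono mult_right_mono mult_left_mono exp_polynomial_bound[OF
            a]) auto
      finally show "norm (char N u - char std_normal_distribution u) \<le> E * r * \<bar>u\<bar> / (1 + u\<^sup>2)"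
        by (simp add: E_def)
    qed
    also have "\<dots> \<le> C0 * (E * r + (1 / (\<delta> * sqrt v)) * r)"
    proof -
      have "1 / (\<delta> * b) = 1 / (\<delta> * sqrt v) * (1 / sqrt (real n))" by (simp add: b_def real_sqrt_mult)
      also have "\<dots> \<le> 1 / (\<delta> * sqrt v) * r" using rs dc v_pos by (intro mult_left_mono) auto
      finally show ?thesis using C0 by (intro mult_left_mono add_left_mono) auto
    qed
    also have "\<dots> = C * r" by (simp add: C_def algebra_simps)
    also have "cdf N (t / sqrt v) = measure M {w \<in> space M. ?s w \<le> t * sqrt (real n)}"
    proof -
      have "?s w / b \<le> t / sqrt v \<longleftrightarrow> ?s w \<le> t * sqrt (real n)" for w
        using b v_pos n by (simp add: b_def real_sqrt_mult field_simps)
      then have "(\<lambda>w. ?s w / b) -` {..t / sqrt v} \<inter> space M = {w \<in> space M. ?s w \<le> t * sqrt (real n)}"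
        by auto
      then show ?thesis unfolding cdf_def N_def by (subst measure_distr) auto
    qed
    finally show "\<bar>measure M {w \<in> space M. ?s w \<le> t * sqrt (real n)}
         - cdf std_normal_distribution (t / sqrt v)\<bar> \<le> C * (1 / real n) powr (p / 2 - 1)"
      by (simp add: r_def)
  qed
qed


section \<open>Reduction of a general cocycle to a centered one\<close>

text \<open>An error \<open>b\<close> in the variable moves the threshold parameter \<open>t\<close>
  by \<open>b / r\<close>, and this moves the normal distribution function at \<open>t / s\<close>
  by at most \<open>b / (r * s)\<close>.\<close>

lemma kolmogorov_shift:
  assumes M: "prob_space M" and Z: "Z \<in> borel_measurable M" "Z' \<in> borel_measurable M"
    and close: "\<And>w. w \<in> space M \<Longrightarrow> \<bar>Z w - Z' w\<bar> \<le> b"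
    and r: "0 < r" and s: "0 < s"
    and K: "\<And>t. \<bar>measure M {w \<in> space M. Z' w \<le> t * r} - cdf std_normal_distribution (t / s)\<bar> \<le> \<epsilon>"
  shows "\<bar>measure M {w \<in> space M. Z w \<le> t * r} - cdf std_normal_distribution (t / s)\<bar> \<le> \<epsilon> + b / (r * s)"
proof -
  interpret prob_space M by fact
  note [measurable] = Z
  obtain w0 where "w0 \<in> space M" using not_empty by blast
  then have b0: "0 \<le> b" using close[of w0] by linarith
  let ?G = "cdf std_normal_distribution"
  have "measure M {w \<in> space M. Z w \<le> t * r} \<le> measure M {w \<in> space M. Z' w \<le> (t + b / r) * r}"
  proof (rule finite_measure_mono)
    show "{w \<in> space M. Z w \<le> t * r} \<subseteq> {w \<in> space M. Z' w \<le> (t + b / r) * r}"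
    proof safe
      fix w assume "w \<in> space M" "Z w \<le> t * r"
      then have "Z' w \<le> t * r + b" using close[of w] by linarith
      then show "Z' w \<le> (t + b / r) * r" using r by (simp add: distrib_right)
    qed
  qed measurable
  also have "\<dots> \<le> ?G ((t + b / r) / s) + \<epsilon>" using K[of "t + b / r"] by linarith
  also have "?G ((t + b / r) / s) \<le> ?G (t / s) + ((t + b / r) / s - t / s)"
    using b0 r s by (intro cdf_std_normal_Lipschitz) (auto simp: divide_right_mono)
  finally have 1: "measure M {w \<in> space M. Z w \<le> t * r} \<le> ?G (t / s) + \<epsilon> + b / (r * s)"
    by (simp add: add_divide_distrib)
  have "?G (t / s) \<le> ?G ((t - b / r) / s) + (t / s - (t - b / r) / s)"
    using b0 r s by (intro cdf_std_normal_Lipschitz) (auto simp: divide_right_mono)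
  also have "?G ((t - b / r) / s) \<le> measure M {w \<in> space M. Z' w \<le> (t - b / r) * r} + \<epsilon>"
    using K[of "t - b / r"] by linarith
  also have "measure M {w \<in> space M. Z' w \<le> (t - b / r) * r} \<le> measure M {w \<in> space M. Z w \<le> t * r}"
  proof (rule finite_measure_mono)
    show "{w \<in> space M. Z' w \<le> (t - b / r) * r} \<subseteq> {w \<in> space M. Z w \<le> t * r}"
    proof safe
      fix w assume w: "w \<in> space M" and "Z' w \<le> (t - b / r) * r"
      then have "Z' w \<le> t * r - b" using r by (simp add: left_diff_distrib)
      then show "Z w \<le> t * r" using close[OF w] by linarith
    qed
  qed measurable
  finally have 2: "?G (t / s) \<le> measure M {w \<in> space M. Z w \<le> t * r} + \<epsilon> + b / (r * s)"
    by (simp add: diff_divide_distrib)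
  from 1 2 show ?thesis by linarith
qed

text \<open>Gordin's decomposition: adding the coboundary of the Poisson solution
  \<open>\<psi>\<close> makes the cocycle centered at every point, not merely on average, and
  changes the centered sums by at most \<open>2 * C\<^sub>\<psi>\<close>. A second Poisson equation,
  for the mean square of the new cocycle, supplies \<open>U\<close> and \<open>v\<close>.\<close>

lemma (in contracting_ifs) birkhoff_limit_theorems:
  obtains m v :: real and C where "0 \<le> v" "0 \<le> C"
    "\<And>M :: 'w measure. \<And>Y n x. iid_seq M \<mu> Y \<Longrightarrow> x \<in> space X \<Longrightarrow>
       \<bar>(\<integral>w. (birkhoff \<sigma> act (\<lambda>i. Y i w) x n - real n * m)\<^sup>2 \<partial>M) - real n * v\<bar> \<le> C * (1 + sqrt (real n))"
    "\<And>M :: 'w measure. \<And>Y n x t. 0 < v \<Longrightarrow> iid_seq M \<mu> Y \<Longrightarrow> 1 \<le> n \<Longrightarrow> x \<in> space X \<Longrightarrow>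
       \<bar>measure M {w \<in> space M. birkhoff \<sigma> act (\<lambda>i. Y i w) x n - real n * m \<le> t * sqrt (real n)}
         - cdf std_normal_distribution (t / sqrt v)\<bar> \<le> C * (1 / real n) powr (p / 2 - 1)"
proof -
  obtain \<psi> m C\<^sub>\<psi> where \<psi>: "Lip C\<^sub>\<psi> C\<^sub>\<psi> \<psi>" and \<psi>_eq: "\<And>x. x \<in> space X \<Longrightarrow> \<psi> x - markov \<psi> x
      = (\<integral>g. \<sigma> g x \<partial>\<mu>) - m"
    by (rule poisson_equation[OF mean_Lip]) blast
  have C\<psi>: "0 \<le> C\<^sub>\<psi>" using LipD(2)[OF \<psi>] .
  note [measurable] = LipD(1)[OF \<psi>]
  define \<tau> where "\<tau> g x = \<sigma> g x - m + \<psi> (act g x) - \<psi> x" for g x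
  \<comment> \<open>The size of \<open>\<tau>\<close> needs
    \<open>1 + |m| + 2 * C\<^sub>\<psi>\<close>, its Lipschitz constant
    \<open>1 + (1 + K) * C\<^sub>\<psi>\<close>; \<open>Q\<close> is at least both.\<close>
  define Q where "Q = 1 + \<bar>m\<bar> + (2 + K) * C\<^sub>\<psi>"
  have Q: "1 \<le> Q" using K C\<psi> by (simp add: Q_def)
  interpret T: contracting_ifs \<mu> X act D \<theta> K \<tau> "\<lambda>g. Q * l g" p
  proof (rule contracting_ifs.intro)
    show "(\<lambda>(g, x). \<tau> g x) \<in> borel_measurable (\<mu> \<Otimes>\<^sub>M X)" unfolding \<tau>_def by measurable
    fix g assume g: "g \<in> space \<mu>"
    have l1: "1 \<le> l g" by (rule l_ge_1[OF g])
    show "1 \<le> Q * l g" using mult_mono[OF Q l1] Q by simp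
    fix x assume x: "x \<in> space X"
    have b: "\<bar>\<psi> y\<bar> \<le> C\<^sub>\<psi>" if "y \<in> space X" for y using LipD(3)[OF \<psi> that] by simp
    have "\<bar>\<tau> g x\<bar> \<le> l g + \<bar>m\<bar> + C\<^sub>\<psi> + C\<^sub>\<psi>"
      unfolding \<tau>_def using \<sigma>_bound[OF g x] b[OF x] b[of "act g x"] g x by fastforce
    also have "\<dots> \<le> l g + \<bar>m\<bar> * l g + 2 * C\<^sub>\<psi> * l g"
      using mult_left_mono[OF l1, of "\<bar>m\<bar>"] mult_left_mono[OF l1, of "2 * C\<^sub>\<psi>"] C\<psi> by simp
    also have "\<dots> \<le> Q * l g"
      unfolding Q_def using C\<psi> K l1 by (simp add: algebra_simps)
    finally show "\<bar>\<tau> g x\<bar> \<le> Q * l g" .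
    fix y assume y: "y \<in> space X"
    have D0: "0 \<le> D x y" by (rule D_nonneg[OF x y])
    have "\<bar>\<psi> (act g x) - \<psi> (act g y)\<bar> \<le> C\<^sub>\<psi> * D (act g x) (act g y)"
      using LipD(4)[OF \<psi>, of "act g x" "act g y"] g x y by simp
    also have "\<dots> \<le> C\<^sub>\<psi> * (K * D x y)" by (intro mult_left_mono D_lip g x y C\<psi>)
    finally have 1: "\<bar>\<psi> (act g x) - \<psi> (act g y)\<bar> \<le> C\<^sub>\<psi> * (K * D x y)" .
    have 2: "\<bar>\<psi> x - \<psi> y\<bar> \<le> C\<^sub>\<psi> * D x y" using LipD(4)[OF \<psi> x y] by simp
    have "\<bar>\<tau> g x - \<tau> g y\<bar> \<le> l g * D x y + C\<^sub>\<psi> * (K * D x y) + C\<^sub>\<psi> * D x y"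
      unfolding \<tau>_def using \<sigma>_lip[OF g x y] 1 2 by linarith
    also have "\<dots> = (l g + (1 + K) * C\<^sub>\<psi>) * D x y" by (simp add: algebra_simps)
    also have "\<dots> \<le> (Q * l g) * D x y"
    proof (rule mult_right_mono[OF _ D0])
      have "(1 + K) * C\<^sub>\<psi> \<le> (1 + K) * C\<^sub>\<psi> * l g" using mult_left_mono[OF l1, of "(1 + K) * C\<^sub>\<psi>"] K C\<psi>
        by simp
      moreover have "Q * l g = l g + (1 + K) * C\<^sub>\<psi> * l g + (\<bar>m\<bar> + C\<^sub>\<psi>) * l g"
        by (simp add: Q_def algebra_simps)
      moreover have "0 \<le> (\<bar>m\<bar> + C\<^sub>\<psi>) * l g" using C\<psi> l1 by simp
      ultimately show "l g + (1 + K) * C\<^sub>\<psi> \<le> Q * l g" by linarith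
    qed
    finally show "\<bar>\<tau> g x - \<tau> g y\<bar> \<le> Q * l g * D x y" .
  next
    have "integrable \<mu> (\<lambda>g. Q powr p * l g powr p)" using l_int by simp
    then show "integrable \<mu> (\<lambda>g. (Q * l g) powr p)"
      by (rule Bochner_Integration.integrable_cong[THEN iffD1, rotated -1]) (use Q l_ge_1 in \<open>auto simp: powr_mult\<close>)
  qed (use prob act_pair X_nonempty D_nonneg D_le_1 D_meas D_contr D_lip theta K p in auto)
  obtain U v C\<^sub>U where U: "T.Lip C\<^sub>U C\<^sub>U U" and U_eq: "\<And>x. x \<in> space X \<Longrightarrow> U x - T.markov U x
      = (\<integral>g. (\<tau> g x)\<^sup>2 \<partial>\<mu>) - v"
    by (rule T.poisson_equation[OF T.square_Lip]) blast
  have cent: "(\<integral>g. \<tau> g x \<partial>\<mu>) = 0" if x: "x \<in> space X" for x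
  proof -
    have "(\<integral>g. \<tau> g x \<partial>\<mu>) = (\<integral>g. \<sigma> g x \<partial>\<mu>) - m + markov \<psi> x - \<psi> x"
      unfolding \<tau>_def markov_def using \<sigma>_integrable[OF x] markov_Lip(1)[OF \<psi> x] by (simp add: prob_space)
    then show ?thesis using \<psi>_eq[OF x] by simp
  qed
  interpret T: centered_ifs \<mu> X act D \<theta> K \<tau> "\<lambda>g. Q * l g" p U C\<^sub>U v
    by unfold_locales (use cent U U_eq in auto)
  have bk: "birkhoff \<tau> act y x n = birkhoff \<sigma> act y x n - real n * m + (\<psi> (trajectory act y x n) - \<psi> x)"
    for y x n
    by (induction n) (simp_all add: birkhoff_def \<tau>_def algebra_simps)
  have close: "\<bar>(birkhoff \<sigma> act (\<lambda>i. Y i w) x n - real n * m) - birkhoff \<tau> act (\<lambda>i. Y i w) x n\<bar> \<le> 2 * C\<^sub>\<psi>"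
    if "iid_seq M \<mu> Y" "x \<in> space X" "w \<in> space M" for M :: "'w measure" and Y w x n
  proof -
    have "trajectory act (\<lambda>i. Y i w) x n \<in> space X"
      by (rule trajectory_in_space[OF that(2) measurable_space[OF iid_seq_measurable[OF that(1)] that(3)]])
    then show ?thesis unfolding bk
      using LipD(3)[OF \<psi> that(2)] LipD(3)[OF \<psi>, of "trajectory act (\<lambda>i. Y i w) x n"] by simp
  qed
  have CU: "0 \<le> C\<^sub>U" using T.LipD(2)[OF U] .
  have sup_v: "0 \<le> v" if iid: "iid_seq (M :: 'w measure) \<mu> Y" for M Y
  proof (rule ccontr)
    assume neg: "\<not> 0 \<le> v"
    obtain x where x: "x \<in> space X" using X_nonempty by blast
    obtain n :: nat where n: "2 * C\<^sub>U / (- v) < real n" using reals_Archimedean2 by blast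
    then have "2 * C\<^sub>U < - (real n * v)" using neg by (simp add: field_simps)
    moreover have "0 \<le> (\<integral>w. (birkhoff \<tau> act (\<lambda>i. Y i w) x n)\<^sup>2 \<partial>M)" by (intro integral_nonneg_AE) auto
    ultimately show False using T.birkhoff_second_moment[OF iid x, of n] by linarith
  qed
  \<comment> \<open>Nonnegativity of \<open>v\<close> was derived from an actual iid sequence over
    the type \<open>'w\<close>, but is claimed unconditionally. The maximum settles the case where
    no such sequence exists and changes nothing otherwise.\<close>
  define v' where "v' = max 0 v"
  have v': "v' = v" if "iid_seq (M :: 'w measure) \<mu> Y" for M Y using sup_v[OF that] by (simp add: v'_def)
  define C1 where "C1 = 2 * C\<^sub>U + (v' + 2 * C\<^sub>U) + 8 * C\<^sub>\<psi>\<^sup>2"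
  have moment: "\<bar>(\<integral>w. (birkhoff \<sigma> act (\<lambda>i. Y i w) x n - real n * m)\<^sup>2 \<partial>M) - real n * v'\<bar>
      \<le> C1 * (1 + sqrt (real n))"
    if iid: "iid_seq M \<mu> Y" and x: "x \<in> space X" for M :: "'w measure" and Y x n
  proof (cases "n = 0")
    case True
    then show ?thesis using CU by (simp add: birkhoff_def C1_def v'_def)
  next
    case False
    interpret M: prob_space M using iid by (simp add: iid_seq_def)
    let ?s = "\<lambda>w. birkhoff \<sigma> act (\<lambda>i. Y i w) x n - real n * m" and ?z = "\<lambda>w. birkhoff \<tau> act (\<lambda>i. Y i w) x n"
    have [measurable]: "?s \<in> borel_measurable M" "?z \<in> borel_measurable M"
      by (intro birkhoff_measurable T.birkhoff_measurable borel_measurable_diff borel_measurable_const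
          measurable_const[OF x] iid_seq_measurable[OF iid]; simp)+
    define q where "q = sqrt (real n)"
    have q: "1 \<le> q" "q * q = real n" using False by (auto simp: q_def)
    have i2: "integrable M (\<lambda>w. (?z w)\<^sup>2)"
      by (rule T.birkhoff_square_integrable[OF iid measurable_const[OF x]])
    \<comment> \<open>Young's inequality with weight \<open>q = sqrt n\<close>: the cross term
      between a bounded difference and a sum of typical size \<open>sqrt n\<close> stays of order
      \<open>sqrt n\<close> after integration.\<close>
    have pw: "\<bar>(?s w)\<^sup>2 - (?z w)\<^sup>2\<bar> \<le> (?z w)\<^sup>2 / q + 8 * C\<^sub>\<psi>\<^sup>2 * q" if w: "w \<in> space M" for w
    proof -
      define d where "d = ?s w - ?z w"
      have d: "\<bar>d\<bar> \<le> 2 * C\<^sub>\<psi>" unfolding d_def by (rule close[OF iid x w])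
      have d2: "d\<^sup>2 \<le> 4 * C\<^sub>\<psi>\<^sup>2" using power_mono[OF d, of 2] by (simp add: power_mult_distrib)
      have "(?s w)\<^sup>2 - (?z w)\<^sup>2 = 2 * d * ?z w + d\<^sup>2" by (simp add: d_def power2_eq_square algebra_simps)
      then have 1: "\<bar>(?s w)\<^sup>2 - (?z w)\<^sup>2\<bar> \<le> 2 * \<bar>d\<bar> * \<bar>?z w\<bar> + d\<^sup>2"
        using abs_triangle_ineq[of "2 * d * ?z w" "d\<^sup>2"] by (simp only: abs_mult abs_numeral abs_power2)
      have 2: "2 * \<bar>d\<bar> * \<bar>?z w\<bar> \<le> (?z w)\<^sup>2 / q + d\<^sup>2 * q"
      proof -
        have "0 \<le> (\<bar>?z w\<bar> / q - \<bar>d\<bar>)\<^sup>2 * q" using q by simp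
        also have "\<dots> = (?z w)\<^sup>2 / q + d\<^sup>2 * q - 2 * \<bar>d\<bar> * \<bar>?z w\<bar>"
        proof -
          have "(A / q - B)\<^sup>2 * q = A\<^sup>2 / q + B\<^sup>2 * q - 2 * B * A" if "q \<noteq> 0" for A B q :: real
            using that by (simp add: power2_eq_square field_simps)
          from this[of q "\<bar>?z w\<bar>" "\<bar>d\<bar>"] show ?thesis using q by simp
        qed
        finally show ?thesis by simp
      qed
      have 3: "d\<^sup>2 * q + d\<^sup>2 \<le> 8 * C\<^sub>\<psi>\<^sup>2 * q"
      proof -
        have "d\<^sup>2 \<le> d\<^sup>2 * q" using mult_left_mono[OF q(1), of "d\<^sup>2"] by simp
        moreover have "d\<^sup>2 * q \<le> 4 * C\<^sub>\<psi>\<^sup>2 * q" using d2 q by (intro mult_right_mono) auto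
        ultimately show ?thesis by simp
      qed
      from 1 2 3 show ?thesis by linarith
    qed
    have bd: "integrable M (\<lambda>w. (?z w)\<^sup>2 / q + 8 * C\<^sub>\<psi>\<^sup>2 * q)" using i2 by simp
    have idiff: "integrable M (\<lambda>w. (?s w)\<^sup>2 - (?z w)\<^sup>2)"
      by (rule Bochner_Integration.integrable_bound[OF bd]) (auto intro!: AE_I2 order_trans[OF pw
          abs_ge_self])
    have is2: "integrable M (\<lambda>w. (?s w)\<^sup>2)"
      using Bochner_Integration.integrable_add[OF idiff i2] by simp
    have "\<bar>(\<integral>w. (?s w)\<^sup>2 \<partial>M) - (\<integral>w. (?z w)\<^sup>2 \<partial>M)\<bar> = norm (\<integral>w. (?s w)\<^sup>2 - (?z w)\<^sup>2 \<partial>M)"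
      using is2 i2 by simp
    also have "\<dots> \<le> (\<integral>w. (?z w)\<^sup>2 / q + 8 * C\<^sub>\<psi>\<^sup>2 * q \<partial>M)"
      by (rule norm_integral_le[OF idiff bd]) (simp add: pw)
    also have "\<dots> = (\<integral>w. (?z w)\<^sup>2 \<partial>M) / q + 8 * C\<^sub>\<psi>\<^sup>2 * q" using i2 by (simp add: M.prob_space)
    also have "(\<integral>w. (?z w)\<^sup>2 \<partial>M) / q \<le> (v' + 2 * C\<^sub>U) * q"
    proof -
      have "(\<integral>w. (?z w)\<^sup>2 \<partial>M) \<le> real n * v + 2 * C\<^sub>U" using T.birkhoff_second_moment[OF iid x, of n]
        by (simp add: abs_le_iff)
      also have "\<dots> \<le> (v' + 2 * C\<^sub>U) * real n"
        using mult_left_mono[of 1 "real n" "2 * C\<^sub>U"] False CU v'[OF iid] by (simp add: algebra_simps)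
      also have "\<dots> = (v' + 2 * C\<^sub>U) * q * q" by (simp only: mult.assoc q(2))
      finally show ?thesis using q(1) by (simp add: field_simps)
    qed
    finally have "\<bar>(\<integral>w. (?s w)\<^sup>2 \<partial>M) - (\<integral>w. (?z w)\<^sup>2 \<partial>M)\<bar> \<le> (v' + 2 * C\<^sub>U) * q + 8 * C\<^sub>\<psi>\<^sup>2 * q" by simp
    moreover have "\<bar>(\<integral>w. (?z w)\<^sup>2 \<partial>M) - real n * v'\<bar> \<le> 2 * C\<^sub>U"
      using T.birkhoff_second_moment[OF iid x, of n] v'[OF iid] by simp
    ultimately have "\<bar>(\<integral>w. (?s w)\<^sup>2 \<partial>M) - real n * v'\<bar> \<le> 2 * C\<^sub>U + ((v' + 2 * C\<^sub>U) * q + 8 * C\<^sub>\<psi>\<^sup>2 * q)"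
      by linarith
    also have "\<dots> \<le> C1 * (1 + q)"
      using q CU by (simp add: C1_def v'_def algebra_simps)
    finally show ?thesis by (simp add: q_def)
  qed
  show thesis
  proof (cases "0 < v")
    \<comment> \<open>Here \<open>v'\<close> is 0, so the claim that is conditional on positive
      variance is vacuous.\<close>
    case False
    show thesis
    proof (rule that[of v' C1 m])
      show "0 \<le> v'" "0 \<le> C1" using CU by (auto simp: v'_def C1_def)
    qed (use False moment in \<open>auto simp: v'_def\<close>)
  next
    case True
    then have vv: "v' = v" by (simp add: v'_def)
    interpret T: nondegenerate_ifs \<mu> X act D \<theta> K \<tau> "\<lambda>g. Q * l g" p U C\<^sub>U v
      by unfold_locales (rule True)
    obtain C2 where C2: "0 \<le> C2" and BE:
      "\<And>M :: 'w measure. \<And>Y n x t. iid_seq M \<mu> Y \<Longrightarrow> 1 \<le> n \<Longrightarrow> x \<in> space X \<Longrightarrow>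
       \<bar>measure M {w \<in> space M. birkhoff \<tau> act (\<lambda>i. Y i w) x n \<le> t * sqrt (real n)}
         - cdf std_normal_distribution (t / sqrt v)\<bar> \<le> C2 * (1 / real n) powr (p / 2 - 1)"
      by (rule T.berry_esseen_centered) blast
    define C3 where "C3 = C2 + 2 * C\<^sub>\<psi> / sqrt v"
    have C3: "0 \<le> C3" using C2 C\<psi> True by (simp add: C3_def)
    have BE': "\<bar>measure M {w \<in> space M. birkhoff \<sigma> act (\<lambda>i. Y i w) x n - real n * m \<le> t * sqrt (real n)}
         - cdf std_normal_distribution (t / sqrt v)\<bar> \<le> C3 * (1 / real n) powr (p / 2 - 1)"
      if iid: "iid_seq M \<mu> Y" and n: "1 \<le> n" and x: "x \<in> space X" for M :: "'w measure" and Y n x t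
    proof -
      have "\<bar>measure M {w \<in> space M. birkhoff \<sigma> act (\<lambda>i. Y i w) x n - real n * m \<le> t * sqrt (real n)}
         - cdf std_normal_distribution (t / sqrt v)\<bar> \<le> C2 * (1 / real n) powr (p / 2 - 1) + (2 * C\<^sub>\<psi>) /
             (sqrt (real n) * sqrt v)"
      proof (rule kolmogorov_shift[OF _ _ _ close[OF iid x] _ _ BE[OF iid n x]])
        show "prob_space M" using iid by (simp add: iid_seq_def)
        show "(\<lambda>w. birkhoff \<sigma> act (\<lambda>i. Y i w) x n - real n * m) \<in> borel_measurable M"
          by (intro birkhoff_measurable borel_measurable_diff borel_measurable_const measurable_const[OF x]
              iid_seq_measurable[OF iid])
        show "(\<lambda>w. birkhoff \<tau> act (\<lambda>i. Y i w) x n) \<in> borel_measurable M"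
          by (intro T.birkhoff_measurable measurable_const[OF x] iid_seq_measurable[OF iid])
      qed (use n True in auto)
      also have "(2 * C\<^sub>\<psi>) / (sqrt (real n) * sqrt v) = 2 * C\<^sub>\<psi> / sqrt v * (1 / sqrt (real n))" by simp
      also have "\<dots> \<le> 2 * C\<^sub>\<psi> / sqrt v * (1 / real n) powr (p / 2 - 1)"
      proof (rule mult_left_mono)
        have "(1 / real n) powr (1 / 2) \<le> (1 / real n) powr (p / 2 - 1)" using n p
          by (intro powr_mono') auto
        then show "1 / sqrt (real n) \<le> (1 / real n) powr (p / 2 - 1)" using n
          by (simp add: powr_half_sqrt real_sqrt_divide)
      qed (use C\<psi> True in simp)
      finally show ?thesis by (simp only: C3_def distrib_right)
    qed
    show thesis
    proof (rule that[of v' "C1 + C3" m])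
      have C1: "0 \<le> C1" using CU by (auto simp: v'_def C1_def)
      show "0 \<le> v'" "0 \<le> C1 + C3" using C1 C3 by (auto simp: v'_def)
      fix M :: "'w measure" and Y x and n :: nat and t
      assume iid: "iid_seq M \<mu> Y" and x: "x \<in> space X"
      show "\<bar>(\<integral>w. (birkhoff \<sigma> act (\<lambda>i. Y i w) x n - real n * m)\<^sup>2 \<partial>M) - real n * v'\<bar>
          \<le> (C1 + C3) * (1 + sqrt (real n))"
        using moment[OF iid x, of n] C3 by (simp add: distrib_right add_increasing2)
      assume n: "1 \<le> n"
      show "\<bar>measure M {w \<in> space M. birkhoff \<sigma> act (\<lambda>i. Y i w) x n - real n * m \<le> t * sqrt (real n)}
         - cdf std_normal_distribution (t / sqrt v')\<bar> \<le> (C1 + C3) * (1 / real n) powr (p / 2 - 1)"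
        unfolding vv by (rule order_trans[OF BE'[OF iid n x] mult_right_mono]) (use C1 in auto)
    qed
  qed
qed

section \<open>The action of nonnegative matrices\<close>

definition colsum :: "real ^ 'd ^ 'd \<Rightarrow> 'd \<Rightarrow> real" where
  "colsum g j = (\<Sum>i\<in>UNIV. g $ i $ j)"

definition colmin :: "real ^ 'd ^ 'd \<Rightarrow> real" where
  "colmin g = Min (range (colsum g))"

definition colmax :: "real ^ 'd ^ 'd \<Rightarrow> real" where
  "colmax g = Max (range (colsum g))"

lemma G_nonneg: "g \<in> G \<Longrightarrow> 0 \<le> g $ i $ j"
  by (simp add: G_def)

lemma G_row: "g \<in> G \<Longrightarrow> \<exists>j. 0 < g $ i $ j"
  unfolding G_def by blast

lemma G_column: "g \<in> G \<Longrightarrow> \<exists>i. 0 < g $ i $ j"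
  unfolding G_def by blast

lemma Splus_nonneg: "x \<in> Splus \<Longrightarrow> 0 \<le> x $ i"
  by (simp add: Splus_def)

lemma norm1_eq_sum: "(\<And>i. 0 \<le> x $ i) \<Longrightarrow> norm1 x = (\<Sum>i\<in>UNIV. x $ i)"
  by (simp add: norm1_def)

lemma Splus_sum: "x \<in> Splus \<Longrightarrow> (\<Sum>i\<in>UNIV. x $ i) = 1"
  using norm1_eq_sum[of x] by (simp add: Splus_def)

lemma mv_component: "((g :: real ^ 'd ^ 'd) *v x) $ i = (\<Sum>j\<in>UNIV. g $ i $ j * x $ j)"
  by (simp add: matrix_vector_mult_def)

lemma mv_nonneg: "g \<in> G \<Longrightarrow> x \<in> Splus \<Longrightarrow> 0 \<le> (g *v x) $ i"
  unfolding mv_component by (intro sum_nonneg mult_nonneg_nonneg G_nonneg Splus_nonneg)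

text \<open>On nonnegative vectors the norm is a linear functional, which reduces every norm
  occurring below to column sums.\<close>

lemma norm1_mv:
  assumes "g \<in> G" "x \<in> Splus"
  shows "norm1 (g *v x) = (\<Sum>j\<in>UNIV. colsum g j * x $ j)"
proof -
  have "norm1 (g *v x) = (\<Sum>i\<in>UNIV. \<Sum>j\<in>UNIV. g $ i $ j * x $ j)"
    by (subst norm1_eq_sum[OF mv_nonneg[OF assms]]) (simp add: mv_component)
  also have "\<dots> = (\<Sum>j\<in>UNIV. \<Sum>i\<in>UNIV. g $ i $ j * x $ j)" by (rule sum.swap)
  finally show ?thesis by (simp add: colsum_def sum_distrib_right)
qed

lemma colsum_pos: assumes "g \<in> G" shows "0 < colsum g j"
proof -
  obtain i where "0 < g $ i $ j" using G_column[OF assms] by blast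
  then show ?thesis unfolding colsum_def using assms by (intro sum_pos2[of _ i]) (auto intro: G_nonneg)
qed

lemma colsum_bounds: "colmin g \<le> colsum g j" "colsum g j \<le> colmax g"
  by (auto simp: colmin_def colmax_def)

lemma colmin_pos: "g \<in> G \<Longrightarrow> 0 < colmin g"
  unfolding colmin_def by (subst Min_gr_iff) (auto intro: colsum_pos)

lemma norm1_mv_bounds:
  assumes "g \<in> G" "x \<in> Splus"
  shows "colmin g \<le> norm1 (g *v x)" "norm1 (g *v x) \<le> colmax g"
proof -
  have "colmin g * (\<Sum>j\<in>UNIV. x $ j) \<le> norm1 (g *v x)"
    unfolding norm1_mv[OF assms] sum_distrib_left
    by (intro sum_mono mult_right_mono colsum_bounds Splus_nonneg[OF assms(2)])
  then show "colmin g \<le> norm1 (g *v x)" using Splus_sum[OF assms(2)] by simp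
  have "norm1 (g *v x) \<le> colmax g * (\<Sum>j\<in>UNIV. x $ j)"
    unfolding norm1_mv[OF assms] sum_distrib_left
    by (intro sum_mono mult_right_mono colsum_bounds Splus_nonneg[OF assms(2)])
  then show "norm1 (g *v x) \<le> colmax g" using Splus_sum[OF assms(2)] by simp
qed

lemma norm1_mv_pos: "g \<in> G \<Longrightarrow> x \<in> Splus \<Longrightarrow> 0 < norm1 (g *v x)"
  using norm1_mv_bounds(1) colmin_pos by (meson order_less_le_trans)

lemma norm1_scaleR: "norm1 (c *\<^sub>R x) = \<bar>c\<bar> * norm1 x"
  by (simp add: norm1_def abs_mult sum_distrib_left)

lemma act_in_Splus: "g \<in> G \<Longrightarrow> x \<in> Splus \<Longrightarrow> act g x \<in> Splus"
  using norm1_mv_pos[of g x] mv_nonneg[of g x] unfolding act_def by (simp add: Splus_def norm1_scaleR)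

lemma act_component: "act g x $ i = (g *v x) $ i / norm1 (g *v x)"
  by (simp add: act_def)

lemma axis_in_Splus: "axis j 1 \<in> Splus"
  by (simp add: Splus_def norm1_def axis_def if_distrib[of abs] cong: if_cong)

lemma norm1_mv_axis: "g \<in> G \<Longrightarrow> norm1 (g *v axis j 1) = colsum g j"
  by (simp add: norm1_mv axis_in_Splus) (simp add: axis_def if_distrib[of "(*) _"] cong: if_cong)

text \<open>The largest column is the image of a basis vector. The supremum runs over vectors of
  arbitrary sign, which are handled by passing to absolute values.\<close>

lemma opnorm1_eq: assumes g: "g \<in> G" shows "opnorm1 g = colmax g"
  unfolding opnorm1_def
proof (rule cSup_eq_maximum)
  have "colmax g \<in> range (colsum g)" unfolding colmax_def by (intro Max_in) auto
  then obtain j where "colmax g = colsum g j" by blast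
  then show "colmax g \<in> {norm1 (g *v x) |x. norm1 x = 1}"
    using norm1_mv_axis[OF g, of j] axis_in_Splus[of j]
      by (auto simp: Splus_def intro!: exI[of _ "axis j 1"])
  fix z assume "z \<in> {norm1 (g *v x) |x. norm1 x = 1}"
  then obtain x where z: "z = norm1 (g *v x)" and x: "norm1 x = 1" by blast
  have "z \<le> (\<Sum>i\<in>UNIV. \<Sum>j\<in>UNIV. g $ i $ j * \<bar>x $ j\<bar>)"
    unfolding z norm1_def mv_component
    by (intro sum_mono order_trans[OF sum_abs] sum_mono) (simp add: abs_mult G_nonneg[OF g])
  also have "\<dots> = (\<Sum>j\<in>UNIV. \<Sum>i\<in>UNIV. g $ i $ j * \<bar>x $ j\<bar>)" by (rule sum.swap)
  also have "\<dots> = (\<Sum>j\<in>UNIV. colsum g j * \<bar>x $ j\<bar>)" by (simp add: colsum_def sum_distrib_right)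
  also have "\<dots> \<le> (\<Sum>j\<in>UNIV. colmax g * \<bar>x $ j\<bar>)" by (intro sum_mono mult_right_mono colsum_bounds) auto
  also have "\<dots> = colmax g" using x by (simp add: norm1_def flip: sum_distrib_left)
  finally show "z \<le> colmax g" .
qed

lemma vinf_eq: assumes g: "g \<in> G" shows "vinf g = colmin g"
  unfolding vinf_def
proof (rule cInf_eq_minimum)
  have "colmin g \<in> range (colsum g)" unfolding colmin_def by (intro Min_in) auto
  then obtain j where "colmin g = colsum g j" by blast
  then show "colmin g \<in> (\<lambda>x. norm1 (g *v x)) ` Splus"
    using norm1_mv_axis[OF g, of j] axis_in_Splus[of j] by (auto intro!: image_eqI[of _ _ "axis j 1"])
qed (use norm1_mv_bounds(1)[OF g] in auto)

lemma Nsize_eq: "g \<in> G \<Longrightarrow> Nsize g = max (colmax g) (1 / colmin g)"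
  by (simp add: Nsize_def opnorm1_eq vinf_eq)

lemma Nsize_ge_1: assumes g: "g \<in> G" shows "1 \<le> Nsize g"
proof (cases "1 \<le> colmax g")
  case False
  then have "colmin g \<le> 1" using colsum_bounds[of g undefined] by linarith
  then show ?thesis using colmin_pos[OF g] by (simp add: Nsize_eq[OF g] le_max_iff_disj)
qed (simp add: Nsize_eq[OF g])

lemma cocycle_bound: assumes g: "g \<in> G" and x: "x \<in> Splus" shows "\<bar>cocycle g x\<bar> \<le> ln (Nsize g)"
proof -
  note pos = norm1_mv_pos[OF g x] and b = norm1_mv_bounds[OF g x]
  have "ln (norm1 (g *v x)) \<le> ln (Nsize g)"
    using b pos Nsize_ge_1[OF g] by (subst ln_le_cancel_iff) (auto simp: Nsize_eq[OF g])
  moreover have "ln (1 / norm1 (g *v x)) \<le> ln (Nsize g)"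
  proof (subst ln_le_cancel_iff)
    have "1 / norm1 (g *v x) \<le> 1 / colmin g" using b colmin_pos[OF g] by (intro divide_left_mono) auto
    then show "1 / norm1 (g *v x) \<le> Nsize g" by (simp add: Nsize_eq[OF g])
  qed (use pos Nsize_ge_1[OF g] in auto)
  ultimately show ?thesis using pos by (simp add: cocycle_def ln_div abs_le_iff)
qed

lemma act_mult: assumes g: "g \<in> G" and h: "h \<in> G" and x: "x \<in> Splus"
  shows "act (g ** h) x = act g (act h x)" and "cocycle (g ** h) x = cocycle g (act h x) + cocycle h x"
proof -
  let ?n = "norm1 (h *v x)"
  have n: "0 < ?n" by (rule norm1_mv_pos[OF h x])
  have mv: "g *v act h x = (1 / ?n) *\<^sub>R ((g ** h) *v x)"
    unfolding act_def by (simp add: matrix_vector_mult_scaleR matrix_vector_mul_assoc)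
  have nn: "norm1 (g *v act h x) = norm1 ((g ** h) *v x) / ?n" using n by (simp add: mv norm1_scaleR)
  have pos: "0 < norm1 (g *v act h x)" by (rule norm1_mv_pos[OF g act_in_Splus[OF h x]])
  have "act g (act h x) = (1 / (norm1 ((g ** h) *v x) / ?n)) *\<^sub>R ((1 / ?n) *\<^sub>R ((g ** h) *v x))"
    unfolding act_def[of g "act h x"] unfolding nn unfolding mv ..
  then show "act (g ** h) x = act g (act h x)" using n by (simp add: act_def)
  have "norm1 ((g ** h) *v x) = norm1 (g *v act h x) * ?n" using n by (simp add: nn)
  then show "cocycle (g ** h) x = cocycle g (act h x) + cocycle h x"
    using n pos by (simp add: cocycle_def ln_mult)
qed

lemma G_mult: assumes g: "g \<in> G" and h: "h \<in> G" shows "g ** h \<in> G"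
proof -
  have c: "(g ** h) $ i $ j = (\<Sum>k\<in>UNIV. g $ i $ k * h $ k $ j)" for i j
    by (simp add: matrix_matrix_mult_def)
  have pos: "0 < (g ** h) $ i $ j" if "0 < g $ i $ k" "0 < h $ k $ j" for i j k
    unfolding c using that
      by (intro sum_pos2[of _ k]) (auto intro: mult_nonneg_nonneg G_nonneg[OF g] G_nonneg[OF h])
  have "\<exists>j. 0 < (g ** h) $ i $ j" for i
    using G_row[OF g, of i] G_row[OF h] pos by blast
  moreover have "\<exists>i. 0 < (g ** h) $ i $ j" for j
    using G_column[OF g] G_column[OF h, of j] pos by blast
  moreover have "0 \<le> (g ** h) $ i $ j" for i j
    unfolding c by (intro sum_nonneg mult_nonneg_nonneg G_nonneg[OF g] G_nonneg[OF h])
  ultimately show ?thesis by (simp add: G_def)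
qed

lemma one_in_G: "mat 1 \<in> G"
  by (auto simp: G_def mat_def)

lemma act_one: "x \<in> Splus \<Longrightarrow> act (mat 1) x = x" and cocycle_one: "x \<in> Splus \<Longrightarrow> cocycle (mat 1) x = 0"
  by (auto simp: act_def cocycle_def Splus_def)

section \<open>A projective distance contracted by matrices\<close>

text \<open>In terms of Hilbert's projective metric
  \<open>h = - ln (mratio x y * mratio y x)\<close> this is \<open>1 - exp (- h / 2)\<close>,
  bounded even where \<open>h\<close> is infinite. The square root is the geometric mean of the two
  ratios, the quantity suited to the contraction estimate.\<close>

definition hdist :: "real ^ 'd \<Rightarrow> real ^ 'd \<Rightarrow> real" where
  "hdist x y = 1 - sqrt (mratio x y * mratio y x)"

lemma hdist_bounds: assumes "x \<in> Splus" "y \<in> Splus" shows "0 \<le> hdist x y" "hdist x y \<le> 1"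
  using mratio_nonneg[OF assms] mratio_nonneg[OF assms(2,1)] mratio_le_one[OF assms] mratio_le_one[OF
      assms(2,1)]
  by (auto simp: hdist_def mult_le_one)

definition entmin :: "real ^ 'd ^ 'd \<Rightarrow> real" where "entmin g = Min (range (\<lambda>(i, j). g $ i $ j))"
definition entmax :: "real ^ 'd ^ 'd \<Rightarrow> real" where "entmax g = Max (range (\<lambda>(i, j). g $ i $ j))"

lemma ent_bounds: "entmin g \<le> g $ i $ j" "g $ i $ j \<le> entmax g"
  unfolding entmin_def entmax_def by (auto intro!: Min_le Max_ge image_eqI[of _ _ "(i, j)"])

lemma entmin_nonneg: "g \<in> G \<Longrightarrow> 0 \<le> entmin g"
  unfolding entmin_def by (subst Min_ge_iff) (auto intro: G_nonneg)

lemma entmax_pos: assumes "g \<in> G" shows "0 < entmax g"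
proof -
  obtain j where "0 < g $ undefined $ j" using G_row[OF assms] by blast
  then show ?thesis using ent_bounds(2)[of g undefined j] by linarith
qed

text \<open>A crude contraction strength in the spirit of Birkhoff's coefficient: the smallest entry
  measures how much mass each coordinate of an image is guaranteed to receive.\<close>

definition ratio :: "real ^ 'd ^ 'd \<Rightarrow> real" where "ratio g = entmin g / entmax g"

lemma ratio_bounds: assumes g: "g \<in> G" shows "0 \<le> ratio g" "ratio g \<le> 1"
  using entmin_nonneg[OF g] entmax_pos[OF g] ent_bounds[of g undefined undefined] by (auto simp: ratio_def)

lemma ratio_pos: assumes g: "g \<in> Gplus" shows "0 < ratio g"
proof -
  have "0 < entmin g" using g unfolding entmin_def by (subst Min_gr_iff) (auto simp: Gplus_def)
  then show ?thesis using entmax_pos[of g] g by (simp add: ratio_def Gplus_def)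
qed

text \<open>With \<open>a = mratio x y\<close> the vector \<open>x - a y\<close> is nonnegative of
  mass \<open>1 - a\<close>, so \<open>g\<close> sends at least \<open>entmin g * (1 - a)\<close> of
  it to each coordinate, while the coordinates of \<open>g *v y\<close> are at most
  \<open>entmax g\<close>. Hence \<open>g *v x\<close> dominates a larger multiple of
  \<open>g *v y\<close>; the norms come from normalising.\<close>

lemma mratio_act_ge:
  assumes g: "g \<in> G" and x: "x \<in> Splus" and y: "y \<in> Splus"
  shows "(mratio x y + ratio g * (1 - mratio x y)) * norm1 (g *v y) / norm1 (g *v x)
      \<le> mratio (act g x) (act g y)"
proof (rule mratio_greatest[OF act_in_Splus[OF g x] act_in_Splus[OF g y]])
  fix i
  let ?a = "mratio x y" and ?k = "ratio g"
  have a1: "?a \<le> 1" by (rule mratio_le_one[OF x y])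
  have "(g *v y) $ i \<le> (\<Sum>j\<in>UNIV. entmax g * y $ j)"
    unfolding mv_component by (intro sum_mono mult_right_mono ent_bounds Splus_nonneg[OF y])
  also have "\<dots> = entmax g" by (simp add: Splus_sum[OF y] flip: sum_distrib_left)
  finally have "ratio g * (g *v y) $ i \<le> ratio g * entmax g" using ratio_bounds[OF g]
    by (intro mult_left_mono)
  then have "ratio g * (g *v y) $ i \<le> entmin g" using entmax_pos[OF g] by (simp add: ratio_def)
  then have "?k * (1 - ?a) * (g *v y) $ i \<le> entmin g * (1 - ?a)"
    using mult_right_mono[of "?k * (g *v y) $ i" "entmin g" "1 - ?a"] a1 by (simp add: mult_ac)
  also have "\<dots> = (\<Sum>j\<in>UNIV. entmin g * (x $ j - ?a * y $ j))"
    by (simp add: Splus_sum[OF x] Splus_sum[OF y] sum_subtractf flip: sum_distrib_left)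
  also have "\<dots> \<le> (\<Sum>j\<in>UNIV. g $ i $ j * (x $ j - ?a * y $ j))"
    using mratio_mult_le[OF x y] by (intro sum_mono mult_right_mono ent_bounds) auto
  also have "\<dots> = (g *v x) $ i - ?a * (g *v y) $ i"
    by (simp add: mv_component right_diff_distrib sum_subtractf sum_distrib_left mult_ac)
  finally have "(?a + ?k * (1 - ?a)) * (g *v y) $ i \<le> (g *v x) $ i" by (simp add: algebra_simps)
  then show "(?a + ?k * (1 - ?a)) * norm1 (g *v y) / norm1 (g *v x) * act g y $ i \<le> act g x $ i"
    using norm1_mv_pos[OF g x] norm1_mv_pos[OF g y] by (simp add: act_component divide_right_mono)
qed

text \<open>In the product of the two ratios the norms cancel. What remains is
  \<open>((1 - k) s + k)^2 \<le> (a + k (1 - a)) (b + k (1 - b))\<close> with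
  \<open>s = sqrt (a b)\<close>, and the sides differ by \<open>k (1 - k)\<close> times
  \<open>a + b - 2 s\<close>, which is nonnegative.\<close>

lemma hdist_act_le:
  assumes g: "g \<in> G" and x: "x \<in> Splus" and y: "y \<in> Splus"
  shows "hdist (act g x) (act g y) \<le> (1 - ratio g) * hdist x y"
proof -
  let ?a = "mratio x y" and ?b = "mratio y x" and ?k = "ratio g"
  note ab = mratio_nonneg[OF x y] mratio_nonneg[OF y x] mratio_le_one[OF x y] mratio_le_one[OF y x]
  note k = ratio_bounds[OF g] and n = norm1_mv_pos[OF g x] norm1_mv_pos[OF g y]
  define s where "s = sqrt (?a * ?b)"
  have s2: "s\<^sup>2 = ?a * ?b" using ab by (simp add: s_def)
  have s0: "0 \<le> s" using ab by (simp add: s_def)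
  have nn: "0 \<le> ?a + ?k * (1 - ?a)" "0 \<le> ?b + ?k * (1 - ?b)" using ab k by auto
  have amgm: "2 * s \<le> ?a + ?b" using arith_geo_mean_sqrt[OF ab(1,2)] by (simp add: s_def)
  have "((1 - ?k) * s + ?k)\<^sup>2 = (1 - ?k)\<^sup>2 * (?a * ?b) + ?k * (1 - ?k) * (2 * s) + ?k\<^sup>2"
    unfolding s2[symmetric] by (simp add: power2_eq_square algebra_simps)
  also have "\<dots> \<le> (1 - ?k)\<^sup>2 * (?a * ?b) + ?k * (1 - ?k) * (?a + ?b) + ?k\<^sup>2"
    using k by (intro add_mono order_refl mult_left_mono[OF amgm]) auto
  also have "\<dots> = (?a + ?k * (1 - ?a)) * (?b + ?k * (1 - ?b))"
    by (simp add: power2_eq_square algebra_simps)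
  also have "\<dots> = ((?a + ?k * (1 - ?a)) * norm1 (g *v y) / norm1 (g *v x)) * ((?b + ?k * (1 - ?b))
      * norm1 (g *v x) / norm1 (g *v y))"
    using n by simp
  also have "\<dots> \<le> mratio (act g x) (act g y) * mratio (act g y) (act g x)"
    using nn n by (intro mult_mono mratio_act_ge g x y mratio_nonneg act_in_Splus) auto
  finally have "(1 - ?k) * s + ?k \<le> sqrt (mratio (act g x) (act g y) * mratio (act g y) (act g x))"
    by (rule real_le_rsqrt)
  then show ?thesis by (simp add: hdist_def s_def[symmetric] algebra_simps)
qed

text \<open>For close points the constant is uniform in \<open>g\<close>. Since \<open>x\<close>
  dominates \<open>a y\<close>, the norm of the image of \<open>x\<close> is at least
  \<open>a\<close> times that of the image of \<open>y\<close>, so the logarithms differ by at most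
  \<open>- ln a\<close>, and \<open>a\<close> is at least the square of
  \<open>s = 1 - hdist x y\<close>. The 4 is 2 from the square times 2 from
  \<open>1 / s \<le> 2\<close>.\<close>

lemma cocycle_diff_le:
  assumes g: "g \<in> G" and x: "x \<in> Splus" and y: "y \<in> Splus" and h: "hdist x y \<le> 1 / 2"
  shows "cocycle g y - cocycle g x \<le> 4 * hdist x y"
proof -
  let ?a = "mratio x y" and ?b = "mratio y x"
  note ab = mratio_nonneg[OF x y] mratio_nonneg[OF y x] mratio_le_one[OF x y] mratio_le_one[OF y x]
  note n = norm1_mv_pos[OF g x] norm1_mv_pos[OF g y]
  define s where "s = sqrt (?a * ?b)"
  have s: "1 / 2 \<le> s" using h by (simp add: hdist_def s_def)
  have s2: "s\<^sup>2 = ?a * ?b" using ab by (simp add: s_def)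
  have "s\<^sup>2 \<le> ?a" unfolding s2 using ab by (simp add: mult_left_le)
  moreover have "0 < s\<^sup>2" using s by simp
  ultimately have a: "0 < ?a" "s\<^sup>2 \<le> ?a" by linarith+
  have "?a * norm1 (g *v y) \<le> norm1 (g *v x)"
    unfolding norm1_mv[OF g x] norm1_mv[OF g y] sum_distrib_left
  proof (intro sum_mono)
    fix j
    have "colsum g j * (?a * y $ j) \<le> colsum g j * x $ j"
      using colsum_pos[OF g, of j] by (intro mult_left_mono mratio_mult_le[OF x y]) auto
    then show "?a * (colsum g j * y $ j) \<le> colsum g j * x $ j" by (simp add: mult_ac)
  qed
  then have "ln (?a * norm1 (g *v y)) \<le> ln (norm1 (g *v x))" using a n by (subst ln_le_cancel_iff) auto
  then have "cocycle g y - cocycle g x \<le> - ln ?a" using a n by (simp add: cocycle_def ln_mult)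
  also have "\<dots> \<le> - ln (s\<^sup>2)" using a \<open>0 < s\<^sup>2\<close> by (subst neg_le_iff_le, subst ln_le_cancel_iff)
  also have "\<dots> = 2 * ln (1 / s)" using s by (simp add: ln_div ln_realpow)
  also have "\<dots> \<le> 2 * (1 / s - 1)" using ln_le_minus_one[of "1 / s"] s by simp
  also have "\<dots> \<le> 4 * (1 - s)"
  proof -
    have "1 / s - 1 = (1 - s) * (1 / s)" using s by (simp add: field_simps)
    also have "\<dots> \<le> (1 - s) * 2"
    proof (rule mult_left_mono)
      show "1 / s \<le> 2" using s by (simp add: field_simps)
      show "0 \<le> 1 - s" using hdist_bounds(1)[OF x y] by (simp add: hdist_def s_def)
    qed
    finally show ?thesis by simp
  qed
  finally show ?thesis by (simp add: hdist_def s_def)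
qed

lemma hdist_commute: "hdist x y = hdist y x"
  by (simp add: hdist_def mult.commute)

text \<open>Close points use the uniform local bound; at distance above one half the size bound is
  already a Lipschitz bound. The constant is thus linear in \<open>ln (Nsize g)\<close> and inherits
  its moments.\<close>

lemma cocycle_Lipschitz:
  assumes g: "g \<in> G" and x: "x \<in> Splus" and y: "y \<in> Splus"
  shows "\<bar>cocycle g x - cocycle g y\<bar> \<le> 4 * (1 + ln (Nsize g)) * hdist x y"
proof (cases "hdist x y \<le> 1 / 2")
  case True
  have "\<bar>cocycle g x - cocycle g y\<bar> \<le> 4 * hdist x y"
    using cocycle_diff_le[OF g x y True] cocycle_diff_le[OF g y x] True
    by (simp add: hdist_commute[of y x])
  also have "\<dots> \<le> 4 * hdist x y + 4 * ln (Nsize g) * hdist x y"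
    using hdist_bounds(1)[OF x y] Nsize_ge_1[OF g] by simp
  finally show ?thesis by (simp add: algebra_simps)
next
  case False
  have l: "0 \<le> ln (Nsize g)" using Nsize_ge_1[OF g] by simp
  have "\<bar>cocycle g x - cocycle g y\<bar> \<le> 2 * ln (Nsize g)"
    using cocycle_bound[OF g x] cocycle_bound[OF g y] by linarith
  also have "\<dots> \<le> 4 * (1 + ln (Nsize g)) * (1 / 2)" by simp
  also have "\<dots> \<le> 4 * (1 + ln (Nsize g)) * hdist x y" using False l by (intro mult_left_mono) auto
  finally show ?thesis .
qed

section \<open>Measurability\<close>

text \<open>The trace of the Euclidean sigma-algebra, in which coordinates are measurable. It is
  linked to \<open>borel_S\<close> later, through measurability of the identity.\<close>

definition borel_Splus :: "(real ^ 'd) measure" where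
  "borel_Splus = restrict_space borel Splus"

lemma space_borel_G [simp]: "space borel_G = G"
  by (simp add: borel_G_def space_restrict_space)

lemma space_borel_Splus [simp]: "space borel_Splus = Splus"
  by (simp add: borel_Splus_def space_restrict_space)

lemma borel_measurable_vecI:
  fixes f :: "'a \<Rightarrow> 'c::euclidean_space ^ 'n"
  assumes "\<And>i. (\<lambda>w. f w $ i) \<in> borel_measurable M"
  shows "f \<in> borel_measurable M"
proof (rule borel_measurable_euclidean_space[THEN iffD2], rule ballI)
  fix b :: "'c ^ 'n" assume "b \<in> Basis"
  then obtain i u where b: "b = axis i u" by (auto simp: Basis_vec_def)
  show "(\<lambda>w. f w \<bullet> b) \<in> borel_measurable M"
    unfolding b inner_axis by (intro borel_measurable_inner assms borel_measurable_const)
qed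

lemma borel_measurable_component [measurable]:
  "(\<lambda>g. g $ i $ j) \<in> borel_measurable borel_G" "(\<lambda>x. x $ i) \<in> borel_measurable borel_Splus"
  unfolding borel_G_def borel_Splus_def
  by (auto intro!: measurable_restrict_space1 borel_measurable_continuous_onI continuous_intros)

lemma borel_measurable_mv [measurable]:
  "(\<lambda>p. (fst p *v snd p) $ i) \<in> borel_measurable (borel_G \<Otimes>\<^sub>M borel_Splus)"
proof -
  have [measurable]: "(\<lambda>p. fst p $ i $ j) \<in> borel_measurable (borel_G \<Otimes>\<^sub>M borel_Splus)"
    "(\<lambda>p. snd p $ j) \<in> borel_measurable (borel_G \<Otimes>\<^sub>M borel_Splus)" for j
    by (rule measurable_compose[OF measurable_fst borel_measurable_component(1)],
        rule measurable_compose[OF measurable_snd borel_measurable_component(2)])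
  show ?thesis unfolding mv_component by measurable
qed

lemma borel_measurable_norm1_mv [measurable]:
  "(\<lambda>p. norm1 (fst p *v snd p)) \<in> borel_measurable (borel_G \<Otimes>\<^sub>M borel_Splus)"
  unfolding norm1_def by measurable

lemma measurable_act: "(\<lambda>(g, x). act g x) \<in> measurable (borel_G \<Otimes>\<^sub>M borel_Splus) borel_Splus"
  unfolding borel_Splus_def
proof (rule measurable_restrict_space2)
  show "(\<lambda>(g, x). act g x) \<in> space (borel_G \<Otimes>\<^sub>M restrict_space borel Splus) \<rightarrow> Splus"
    by (auto simp: space_pair_measure space_restrict_space intro: act_in_Splus)
  have "(\<lambda>p. act (fst p) (snd p)) \<in> borel_measurable (borel_G \<Otimes>\<^sub>M borel_Splus)"
    by (rule borel_measurable_vecI) (simp only: act_component, measurable)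
  then show "(\<lambda>(g, x). act g x) \<in> borel_measurable (borel_G \<Otimes>\<^sub>M restrict_space borel Splus)"
    by (simp only: case_prod_beta' borel_Splus_def)
qed

lemma measurable_cocycle: "(\<lambda>(g, x). cocycle g x) \<in> borel_measurable (borel_G \<Otimes>\<^sub>M borel_Splus)"
  unfolding cocycle_def split_beta by measurable

lemma measurable_matrix_mult:
  "(\<lambda>(g, h). g ** h) \<in> measurable (borel_G \<Otimes>\<^sub>M borel_G) (borel_G :: (real ^ 'd ^ 'd) measure)"
proof -
  let ?B = "borel_G :: (real ^ 'd ^ 'd) measure"
  have "(\<lambda>p. fst p ** snd p) \<in> measurable (?B \<Otimes>\<^sub>M ?B) (restrict_space borel G)"
  proof (rule measurable_restrict_space2)
    show "(\<lambda>p. fst p ** snd p) \<in> space (?B \<Otimes>\<^sub>M ?B) \<rightarrow> G"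
      by (auto simp: space_pair_measure intro: G_mult)
    have c: "(g ** h) $ i $ j = (\<Sum>k\<in>UNIV. g $ i $ k * h $ k $ j)" for g h :: "real ^ 'd ^ 'd" and i j
      by (simp add: matrix_matrix_mult_def)
    show "(\<lambda>p. fst p ** snd p) \<in> borel_measurable (?B \<Otimes>\<^sub>M ?B)"
    proof (intro borel_measurable_vecI)
      fix i j :: 'd
      have [measurable]: "(\<lambda>p. fst p $ i $ k) \<in> borel_measurable (?B \<Otimes>\<^sub>M ?B)"
        "(\<lambda>p. snd p $ k $ j) \<in> borel_measurable (?B \<Otimes>\<^sub>M ?B)" for k
        by (rule measurable_compose[OF measurable_fst borel_measurable_component(1)],
            rule measurable_compose[OF measurable_snd borel_measurable_component(1)])
      show "(\<lambda>p. (fst p ** snd p) $ i $ j) \<in> borel_measurable (?B \<Otimes>\<^sub>M ?B)"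
        unfolding c by measurable
    qed
  qed
  then show ?thesis by (simp only: case_prod_beta' borel_G_def)
qed

text \<open>The index set of the infimum depends on \<open>y\<close>. Filling the gaps with 1,
  harmless since the ratio never exceeds 1, gives a minimum over a fixed finite set and thereby
  measurability.\<close>

lemma mratio_eq_Min:
  assumes x: "x \<in> Splus" and y: "y \<in> Splus"
  shows "mratio x y = Min (range (\<lambda>i. if 0 < y $ i then x $ i / y $ i else 1))"
proof (rule antisym)
  show "mratio x y \<le> Min (range (\<lambda>i. if 0 < y $ i then x $ i / y $ i else 1))"
  proof (rule Min.boundedI)
    fix z assume "z \<in> range (\<lambda>i. if 0 < y $ i then x $ i / y $ i else 1)"
    then obtain i where "z = (if 0 < y $ i then x $ i / y $ i else 1)" by blast
    then show "mratio x y \<le> z" using mratio_mult_le[OF x y, of i] mratio_le_one[OF x y]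
      by (simp add: field_simps)
  qed auto
  show "Min (range (\<lambda>i. if 0 < y $ i then x $ i / y $ i else 1)) \<le> mratio x y"
  proof (rule mratio_greatest[OF x y])
    fix i assume i: "0 < y $ i"
    have "Min (range (\<lambda>i. if 0 < y $ i then x $ i / y $ i else 1))
        \<le> (if 0 < y $ i then x $ i / y $ i else 1)"
      by (rule Min_le) auto
    then show "Min (range (\<lambda>i. if 0 < y $ i then x $ i / y $ i else 1)) * y $ i \<le> x $ i"
      using i by (simp add: field_simps)
  qed
qed

lemma measurable_hdist: "(\<lambda>(x, y). hdist x y) \<in> borel_measurable (borel_Splus \<Otimes>\<^sub>M borel_Splus)"
proof -
  have c [measurable]: "(\<lambda>p. fst p $ i) \<in> borel_measurable (borel_Splus \<Otimes>\<^sub>M borel_Splus)"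
      "(\<lambda>p. snd p $ i) \<in> borel_measurable (borel_Splus \<Otimes>\<^sub>M borel_Splus)" for i :: 'a
    by (rule measurable_compose[OF measurable_fst borel_measurable_component(2)],
        rule measurable_compose[OF measurable_snd borel_measurable_component(2)])
  let ?m = "\<lambda>x y. Min (range (\<lambda>i. if 0 < y $ i then x $ i / y $ i else 1)) :: real"
  have "(\<lambda>p. 1 - sqrt (?m (fst p) (snd p) * ?m (snd p) (fst p)))
      \<in> borel_measurable (borel_Splus \<Otimes>\<^sub>M borel_Splus)"
    by measurable
  then show ?thesis
    by (rule measurable_cong[THEN iffD2, rotated]) (auto simp: space_pair_measure hdist_def mratio_eq_Min)
qed

lemma measurable_ratio [measurable]: "ratio \<in> borel_measurable borel_G"
  unfolding ratio_def[abs_def] entmin_def entmax_def split_beta by measurable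

lemma measurable_Nsize: "Nsize \<in> borel_measurable borel_G"
proof -
  have "(\<lambda>g. max (colmax g) (1 / colmin g)) \<in> borel_measurable borel_G"
    unfolding colmax_def colmin_def colsum_def by measurable
  then show ?thesis by (rule measurable_cong[THEN iffD2, rotated]) (simp add: Nsize_eq)
qed


section \<open>Averaging the distance along the walk\<close>

text \<open>Both points are moved by the same matrix: this is the transition operator of the coupled
  pair.\<close>

definition avg :: "(real ^ 'd ^ 'd) measure \<Rightarrow> (real ^ 'd \<Rightarrow> real ^ 'd \<Rightarrow> real) \<Rightarrow> real ^ 'd \<Rightarrow> real ^ 'd \<Rightarrow> real"
    where
  "avg \<mu> w x y = (\<integral>g. w (act g x) (act g y) \<partial>\<mu>)"

locale matrix_law =
  fixes \<mu> :: "(real ^ 'd ^ 'd) measure"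
  assumes prob_\<mu>: "prob_space \<mu>" and sets_\<mu> [measurable_cong]: "sets \<mu> = sets borel_G"
begin

sublocale prob_space \<mu> by (rule prob_\<mu>)

lemma space_\<mu> [simp]: "space \<mu> = G"
  using sets_eq_imp_space_eq[OF sets_\<mu>] by simp

definition kernel :: "(real ^ 'd \<Rightarrow> real ^ 'd \<Rightarrow> real) \<Rightarrow> bool" where
  "kernel w \<longleftrightarrow> (\<lambda>(x, y). w x y) \<in> borel_measurable (borel_Splus \<Otimes>\<^sub>M borel_Splus)
     \<and> (\<forall>x\<in>Splus. \<forall>y\<in>Splus. 0 \<le> w x y \<and> w x y \<le> 1)"

lemma act_measurable' [measurable (raw)]:
  "f \<in> measurable N borel_G \<Longrightarrow> h \<in> measurable N borel_Splus \<Longrightarrow> (\<lambda>z. act (f z) (h z))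
      \<in> measurable N borel_Splus"
  using measurable_compose[OF measurable_Pair measurable_act] by (simp add: split_beta)

lemma kernel_measurable:
  "kernel w \<Longrightarrow> f \<in> measurable N borel_Splus \<Longrightarrow> h \<in> measurable N borel_Splus \<Longrightarrow> (\<lambda>z. w (f z) (h z))
      \<in> borel_measurable N"
  using measurable_compose[OF measurable_Pair, of f N borel_Splus h borel_Splus "\<lambda>(x, y). w x y" borel]
  by (simp add: kernel_def)

lemma kernel_abs_le: "kernel w \<Longrightarrow> x \<in> Splus \<Longrightarrow> y \<in> Splus \<Longrightarrow> \<bar>w x y\<bar> \<le> 1"
  by (simp add: kernel_def)

lemma kernel_act_measurable:
  assumes "kernel w" "x \<in> Splus" "y \<in> Splus"
  shows "(\<lambda>g. w (act g x) (act g y)) \<in> borel_measurable borel_G"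
  by (rule kernel_measurable[OF assms(1)]; rule act_measurable'; use assms in simp)

lemma kernel_integrable:
  assumes w: "kernel w" and x: "x \<in> Splus" "y \<in> Splus" and k: "prob_space \<kappa>" "sets \<kappa> = sets borel_G"
  shows "integrable \<kappa> (\<lambda>g. w (act g x) (act g y))"
proof -
  interpret k: prob_space \<kappa> by fact
  have "space \<kappa> = G" using sets_eq_imp_space_eq[OF k(2)] by simp
  then show ?thesis
    using w x kernel_act_measurable[OF w x, folded measurable_cong_sets[OF k(2) refl]]
    by (intro k.integrable_const_bound[where B=1]) (auto intro!: AE_I2 kernel_abs_le act_in_Splus)
qed

lemma avg_kernel:
  assumes w: "kernel w"
  shows "kernel (avg \<mu> w)"
  unfolding kernel_def
proof (intro conjI ballI)
  have "(\<lambda>(p, g). w (act g (fst p)) (act g (snd p)))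
      \<in> borel_measurable ((borel_Splus \<Otimes>\<^sub>M borel_Splus) \<Otimes>\<^sub>M \<mu>)"
    unfolding split_beta by (rule kernel_measurable[OF w]) measurable
  then have "(\<lambda>p. \<integral>g. w (act g (fst p)) (act g (snd p)) \<partial>\<mu>)
      \<in> borel_measurable (borel_Splus \<Otimes>\<^sub>M borel_Splus)"
    by (rule borel_measurable_lebesgue_integral)
  then show "(\<lambda>(x, y). avg \<mu> w x y) \<in> borel_measurable (borel_Splus \<Otimes>\<^sub>M borel_Splus)"
    by (simp only: avg_def case_prod_beta')
  fix x y :: "real ^ 'd" assume xy: "x \<in> Splus" "y \<in> Splus"
  note i = kernel_integrable[OF w xy prob_\<mu> sets_\<mu>]
  have b: "0 \<le> w (act g x) (act g y) \<and> w (act g x) (act g y) \<le> 1" if "g \<in> G" for g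
    using w that xy by (auto simp: kernel_def act_in_Splus)
  show "0 \<le> avg \<mu> w x y" unfolding avg_def by (intro integral_nonneg_AE AE_I2) (simp add: b)
  have "avg \<mu> w x y \<le> (\<integral>g. 1 \<partial>\<mu>)" unfolding avg_def by (rule integral_mono[OF i]) (use b in auto)
  then show "avg \<mu> w x y \<le> 1" using prob_space by simp
qed

lemma avg_pow_kernel: "kernel w \<Longrightarrow> kernel ((avg \<mu> ^^ k) w)"
  by (induction k) (auto intro: avg_kernel)

lemma mconv_pow: "prob_space (mconv_pow \<mu> k) \<and> sets (mconv_pow \<mu> k) = sets borel_G"
proof (induction k)
  case 0
  show ?case by (simp add: one_in_G prob_space_return)
next
  case (Suc k)
  interpret k: prob_space "mconv_pow \<mu> k" using Suc by simp
  interpret P: pair_prob_space \<mu> "mconv_pow \<mu> k" ..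
  have "(\<lambda>(g, h). g ** h) \<in> measurable (\<mu> \<Otimes>\<^sub>M mconv_pow \<mu> k) borel_G"
    using measurable_matrix_mult Suc
    by (simp only: measurable_cong_sets[OF sets_pair_measure_cong[OF sets_\<mu>, of "mconv_pow \<mu> k" borel_G]
        refl])
  then show ?case by (simp add: mconv_def P.prob_space_distr)
qed

text \<open>In \<open>g ** h\<close> the factor \<open>g\<close> acts last. Integrating it out first
  replaces \<open>w\<close> by \<open>avg \<mu> w\<close>, which is why the induction varies
  \<open>w\<close>.\<close>

lemma avg_pow_eq:
  assumes w: "kernel w" and x: "x \<in> Splus" and y: "y \<in> Splus"
  shows "(avg \<mu> ^^ k) w x y = (\<integral>g. w (act g x) (act g y) \<partial>mconv_pow \<mu> k)"
  using w
proof (induction k arbitrary: w)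
  case 0
  have "(\<integral>g. w (act g x) (act g y) \<partial>return borel_G (mat 1)) = w (act (mat 1) x) (act (mat 1) y)"
    by (rule integral_return) (auto simp: one_in_G intro: kernel_act_measurable[OF 0 x y])
  then show ?case by (simp add: act_one x y)
next
  case (Suc k)
  let ?k = "mconv_pow \<mu> k"
  have sk: "sets ?k = sets borel_G" and pk: "prob_space ?k" using mconv_pow by auto
  have spk: "space ?k = G" using sets_eq_imp_space_eq[OF sk] by simp
  interpret k: prob_space ?k by (rule pk)
  interpret P: pair_prob_space \<mu> ?k ..
  have mm: "(\<lambda>(g, h). g ** h) \<in> measurable (\<mu> \<Otimes>\<^sub>M ?k) borel_G"
    using measurable_matrix_mult
      by (simp only: measurable_cong_sets[OF sets_pair_measure_cong[OF sets_\<mu> sk] refl])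
  let ?f = "\<lambda>g. w (act g x) (act g y)"
  have fm: "?f \<in> borel_measurable borel_G" by (rule kernel_act_measurable[OF Suc.prems x y])
  have int: "integrable (\<mu> \<Otimes>\<^sub>M ?k) (\<lambda>(g, h). ?f (g ** h))"
  proof (rule P.integrable_const_bound[where B=1])
    show "(\<lambda>(g, h). ?f (g ** h)) \<in> borel_measurable (\<mu> \<Otimes>\<^sub>M ?k)"
      using measurable_compose[OF mm fm] by (simp add: split_beta)
    show "AE p in \<mu> \<Otimes>\<^sub>M ?k. norm ((\<lambda>(g, h). ?f (g ** h)) p) \<le> 1"
      using Suc.prems x y by (intro AE_I2) (auto simp: space_pair_measure spk intro!: kernel_abs_le
          act_in_Splus G_mult)
  qed
  have "(\<integral>g. ?f g \<partial>mconv_pow \<mu> (Suc k)) = (\<integral>p. ?f ((\<lambda>(g, h). g ** h) p) \<partial>(\<mu> \<Otimes>\<^sub>M ?k))"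
    unfolding mconv_pow.simps mconv_def by (rule integral_distr[OF mm fm])
  also have "\<dots> = (\<integral>(g, h). ?f (g ** h) \<partial>(\<mu> \<Otimes>\<^sub>M ?k))" by (simp only: case_prod_beta')
  also have "\<dots> = (\<integral>h. \<integral>g. ?f (g ** h) \<partial>\<mu> \<partial>?k)" by (rule P.integral_snd[OF int, symmetric])
  also have "\<dots> = (\<integral>h. avg \<mu> w (act h x) (act h y) \<partial>?k)"
    unfolding avg_def by (intro Bochner_Integration.integral_cong refl) (auto simp: spk act_mult x y)
  also have "\<dots> = (avg \<mu> ^^ k) (avg \<mu> w) x y" by (rule Suc.IH[OF avg_kernel[OF Suc.prems], symmetric])
  finally show ?case by (simp only: funpow_Suc_right o_apply)
qed

lemma kernel_hdist: "kernel hdist"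
  using measurable_hdist by (simp add: kernel_def hdist_bounds)

lemma hdist_act_le': "g \<in> G \<Longrightarrow> x \<in> Splus \<Longrightarrow> y \<in> Splus \<Longrightarrow> hdist (act g x) (act g y) \<le> hdist x y"
  using hdist_act_le[of g x y] ratio_bounds[of g] hdist_bounds[of x y] mult_right_mono[of "1
      - ratio g" 1 "hdist x y"] by simp

lemma avg_pow_hdist_le: "x \<in> Splus \<Longrightarrow> y \<in> Splus \<Longrightarrow> (avg \<mu> ^^ k) hdist x y \<le> hdist x y"
proof -
  assume xy: "x \<in> Splus" "y \<in> Splus"
  interpret k: prob_space "mconv_pow \<mu> k" using mconv_pow by blast
  have "space (mconv_pow \<mu> k) = G" using mconv_pow sets_eq_imp_space_eq[of "mconv_pow \<mu> k" borel_G] by simp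
  then have "(avg \<mu> ^^ k) hdist x y \<le> (\<integral>g. hdist x y \<partial>mconv_pow \<mu> k)"
    unfolding avg_pow_eq[OF kernel_hdist xy] using mconv_pow
    by (intro integral_mono kernel_integrable[OF kernel_hdist xy]) (auto intro: hdist_act_le' xy)
  then show ?thesis by (simp add: k.prob_space)
qed

text \<open>No matrix expands \<open>hdist\<close>, and those in \<open>Gplus\<close> contract it
  strictly; the gain is the mean of \<open>ratio\<close>, positive because \<open>Gplus\<close> has
  positive measure.\<close>

lemma avg_pow_hdist_contracts:
  assumes "0 < measure (mconv_pow \<mu> r) Gplus"
  obtains \<theta>\<^sub>0 where "\<theta>\<^sub>0 < 1" "\<And>x y. x \<in> Splus \<Longrightarrow> y \<in> Splus \<Longrightarrow> (avg \<mu> ^^ r) hdist x y \<le> \<theta>\<^sub>0 * hdist x y"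
proof -
  let ?k = "mconv_pow \<mu> r"
  have sk: "sets ?k = sets borel_G" and pk: "prob_space ?k" using mconv_pow by auto
  interpret k: prob_space ?k by (rule pk)
  have spk: "space ?k = G" using sets_eq_imp_space_eq[OF sk] by simp
  have rm [measurable]: "ratio \<in> borel_measurable ?k" using measurable_ratio
    by (simp only: measurable_cong_sets[OF sk refl])
  have rb: "\<bar>ratio g\<bar> \<le> 1" if "g \<in> G" for g :: "real ^ 'd ^ 'd"
    using ratio_bounds[OF that] by simp
  have ri: "integrable ?k ratio"
    by (rule k.integrable_const_bound[where B=1]) (auto intro!: AE_I2 rb simp: spk)
  have "(\<integral>g. ratio g \<partial>?k) \<noteq> 0"
  proof
    assume "(\<integral>g. ratio g \<partial>?k) = 0"
    then have "AE g in ?k. ratio g = 0"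
      by (subst (asm) integral_nonneg_eq_0_iff_AE[OF ri]) (use ratio_bounds in \<open>auto intro!: AE_I2 simp: spk\<close>)
    then have "AE g in ?k. g \<notin> Gplus" by eventually_elim (use ratio_pos in fastforce)
    \<comment> \<open>Measurability is read off from the positive measure, since sets outside the
      sigma-algebra have measure 0 by convention.\<close>
    moreover have "Gplus \<in> sets ?k" using assms by (metis measure_notin_sets less_irrefl)
    ultimately have "measure ?k Gplus = 0"
      using k.prob_eq_0[of Gplus] by simp
    then show False using assms by simp
  qed
  moreover have "0 \<le> (\<integral>g. ratio g \<partial>?k)" by (intro integral_nonneg_AE AE_I2) (simp add: spk ratio_bounds)
  ultimately have pos: "0 < (\<integral>g. ratio g \<partial>?k)" by simp
  show thesis
  proof (rule that[of "1 - (\<integral>g. ratio g \<partial>?k)"])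
    show "1 - (\<integral>g. ratio g \<partial>?k) < 1" using pos by simp
    fix x y :: "real ^ 'd" assume xy: "x \<in> Splus" "y \<in> Splus"
    have "(avg \<mu> ^^ r) hdist x y \<le> (\<integral>g. (1 - ratio g) * hdist x y \<partial>?k)"
      unfolding avg_pow_eq[OF kernel_hdist xy]
      by (intro integral_mono kernel_integrable[OF kernel_hdist xy pk sk])
         (use ri in \<open>auto simp: spk xy hdist_act_le\<close>)
    also have "\<dots> = (1 - (\<integral>g. ratio g \<partial>?k)) * hdist x y" using ri by (simp add: k.prob_space)
    finally show "(avg \<mu> ^^ r) hdist x y \<le> (1 - (\<integral>g. ratio g \<partial>?k)) * hdist x y" .
  qed
qed

end

lemma one_plus_powr_le:
  fixes z p :: real
  assumes "0 \<le> z" "0 \<le> p"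
  shows "(1 + z) powr p \<le> 2 powr p * (1 + z powr p)"
proof -
  have "(1 + z) powr p \<le> (2 * max 1 z) powr p" using assms by (intro powr_mono2) auto
  also have "\<dots> = 2 powr p * (max 1 z) powr p" by (rule powr_mult)
  also have "\<dots> \<le> 2 powr p * (1 + z powr p)" by (intro mult_left_mono) (auto simp: max_def)
  finally show ?thesis .
qed

text \<open>The averaged distance satisfies \<open>D \<le> hdist\<close> and
  \<open>hdist \<le> C * D\<close>. The first keeps \<open>D\<close> at most 1, the second transfers
  the Lipschitz bound of the cocycle at the price of a factor \<open>C\<close>, and together they
  show that no matrix expands \<open>D\<close> by more than \<open>C\<close>, which therefore serves
  as \<open>K\<close>.\<close>

lemma (in matrix_law) contracting_ifs_ex:
  assumes sc: "strictly_contracting \<mu>" and mom: "has_moment \<mu> p" and p: "2 < p" "p \<le> 3"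
  obtains D \<theta> K l where "contracting_ifs \<mu> borel_Splus act D \<theta> K cocycle l p"
proof -
  obtain r where r: "1 \<le> r" "0 < measure (mconv_pow \<mu> r) Gplus" using sc
    by (auto simp: strictly_contracting_def)
  obtain \<theta>0 where th0: "\<theta>0 < 1" "\<And>x y. x \<in> Splus \<Longrightarrow> y \<in> Splus \<Longrightarrow> (avg \<mu> ^^ r) hdist x y \<le> \<theta>0 * hdist x y"
    by (rule avg_pow_hdist_contracts[OF r(2)]) blast
  \<comment> \<open>The maximum with \<open>1 / 2\<close> keeps \<open>\<theta>\<close> positive, so
    that its inverse powers can serve as weights.\<close>
  define \<theta> where "\<theta> = root r (max \<theta>0 (1 / 2))"
  have thr: "\<theta> ^ r = max \<theta>0 (1 / 2)" unfolding \<theta>_def using r by (intro real_root_pow_pos2) auto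
  have th: "0 < \<theta>" "\<theta> < 1" unfolding \<theta>_def using r th0 by auto
  \<comment> \<open>With these weights a further averaging shifts the sum, so the contraction after \<open>r\<close> steps
    becomes a contraction in one step.\<close>
  define c where "c k = (1 / \<theta>) ^ k" for k :: nat
  have c: "0 < c k" for k using th by (simp add: c_def)
  have c_Suc: "c k = \<theta> * c (Suc k)" for k using th by (simp add: c_def)
  have c_0: "c 0 = 1" by (simp add: c_def)
  define C where "C = (\<Sum>k<r. c k)"
  have "c 0 \<le> C" unfolding C_def using r c by (intro member_le_sum) (auto intro: less_imp_le)
  then have C: "1 \<le> C" by (simp add: c_0)
  let ?A = "\<lambda>k. (avg \<mu> ^^ k) hdist"
  note ker = avg_pow_kernel[OF kernel_hdist]
  define D where "D x y = (\<Sum>k<r. c k * ?A k x y) / C" for x y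
  have A0: "0 \<le> ?A k x y" if "x \<in> Splus" "y \<in> Splus" for k x y using ker[of k] that
    by (auto simp: kernel_def)
  have D_le: "D x y \<le> hdist x y" if "x \<in> Splus" "y \<in> Splus" for x y
  proof -
    have "(\<Sum>k<r. c k * ?A k x y) \<le> (\<Sum>k<r. c k * hdist x y)"
      using c by (intro sum_mono mult_left_mono avg_pow_hdist_le that) (auto intro: less_imp_le)
    then show ?thesis using C by (simp add: D_def C_def field_simps flip: sum_distrib_right)
  qed
  have D_ge: "hdist x y \<le> C * D x y" if "x \<in> Splus" "y \<in> Splus" for x y
  proof -
    have "c 0 * ?A 0 x y \<le> (\<Sum>k<r. c k * ?A k x y)"
      using r less_imp_le[OF c] A0[OF that] by (intro member_le_sum) (auto intro!: mult_nonneg_nonneg)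
    then show ?thesis using C by (simp add: D_def c_0)
  qed
  \<comment> \<open>The 4 and the logarithm come from \<open>cocycle_Lipschitz\<close>,
    \<open>C\<close> from the passage from \<open>hdist\<close> to \<open>D\<close>; the summand 1
    also secures \<open>1 \<le> l g\<close>.\<close>
  define l where "l g = 4 * C * (1 + ln (Nsize g))" for g :: "real ^ 'd ^ 'd"
  have lN: "0 \<le> ln (Nsize g)" if "g \<in> G" for g :: "real ^ 'd ^ 'd" using Nsize_ge_1[OF that] by simp
  have Nm [measurable]: "Nsize \<in> borel_measurable \<mu>" using measurable_Nsize
    by (simp only: measurable_cong_sets[OF sets_\<mu> refl])
  have "contracting_ifs \<mu> borel_Splus act D \<theta> C cocycle l p"
  proof (rule contracting_ifs.intro)
    show "prob_space \<mu>" by (rule prob_\<mu>)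
    show "(\<lambda>(g, x). act g x) \<in> measurable (\<mu> \<Otimes>\<^sub>M borel_Splus) borel_Splus"
      using measurable_act by (simp only: measurable_cong_sets[OF sets_pair_measure_cong[OF sets_\<mu> refl]
          refl])
    show "(\<lambda>(g, x). cocycle g x) \<in> borel_measurable (\<mu> \<Otimes>\<^sub>M borel_Splus)"
      using measurable_cocycle
        by (simp only: measurable_cong_sets[OF sets_pair_measure_cong[OF sets_\<mu> refl] refl])
    show "space borel_Splus \<noteq> {}" using axis_in_Splus by auto
    show "0 \<le> \<theta>" "\<theta> < 1" "0 \<le> C" "2 < p" "p \<le> 3" using th C p by auto
    show "l \<in> borel_measurable \<mu>" unfolding l_def by measurable
    show "integrable \<mu> (\<lambda>g. l g powr p)"
    proof -
      have "integrable \<mu> (\<lambda>g. ln (Nsize g) powr p)"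
        using mom unfolding has_moment_def by (intro integrableI_bounded) (auto simp: powr_ge_zero)
      then have i: "integrable \<mu> (\<lambda>g. (4 * C) powr p * (2 powr p * (1 + ln (Nsize g) powr p)))" by simp
      show ?thesis
      proof (rule Bochner_Integration.integrable_bound[OF i])
        show "(\<lambda>g. l g powr p) \<in> borel_measurable \<mu>" unfolding l_def by measurable
        show "AE g in \<mu>. norm (l g powr p) \<le> norm ((4 * C) powr p * (2 powr p * (1 + ln (Nsize g) powr p)))"
        proof (rule AE_I2)
          fix g assume "g \<in> space \<mu>"
          then have "0 \<le> ln (Nsize g)" by (simp add: lN)
          then have "l g powr p = (4 * C) powr p * (1 + ln (Nsize g)) powr p" unfolding l_def
            by (simp add: powr_mult)
          also have "\<dots> \<le> (4 * C) powr p * (2 powr p * (1 + ln (Nsize g) powr p))"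
            using \<open>0 \<le> ln (Nsize g)\<close> p by (intro mult_left_mono one_plus_powr_le) auto
          finally show "norm (l g powr p) \<le> norm ((4 * C) powr p * (2 powr p * (1 + ln (Nsize g) powr p)))"
            by simp
        qed
      qed
    qed
    show "1 \<le> l g" if "g \<in> space \<mu>" for g
      unfolding l_def using C lN[of g] that mult_mono[of 1 "4 * C" 1 "1 + ln (Nsize g)"] by simp
    show "\<bar>cocycle g x\<bar> \<le> l g" if "g \<in> space \<mu>" "x \<in> space borel_Splus" for g x
    proof -
      have "1 * ln (Nsize g) \<le> (4 * C) * (1 + ln (Nsize g))" using C lN[of g] that by (intro mult_mono) auto
      then show ?thesis using cocycle_bound[of g x] that by (simp add: l_def)
    qed
    fix x y :: "real ^ 'd" assume "x \<in> space borel_Splus" "y \<in> space borel_Splus"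
    then have xy: "x \<in> Splus" "y \<in> Splus" by auto
    show "0 \<le> D x y" unfolding D_def using A0[OF xy] c C
      by (intro divide_nonneg_nonneg sum_nonneg mult_nonneg_nonneg) (auto intro: less_imp_le)
    show "D x y \<le> 1" using D_le[OF xy] hdist_bounds(2)[OF xy] by simp
    have iA: "integrable \<mu> (\<lambda>g. ?A k (act g x) (act g y))" for k
      by (rule kernel_integrable[OF ker xy prob_\<mu> sets_\<mu>])
    then show "(\<lambda>g. D (act g x) (act g y)) \<in> borel_measurable \<mu>" unfolding D_def by measurable
    show "(\<integral>g. D (act g x) (act g y) \<partial>\<mu>) \<le> \<theta> * D x y"
    proof -
      have "(\<integral>g. D (act g x) (act g y) \<partial>\<mu>) = (\<Sum>k<r. c k * (\<integral>g. ?A k (act g x) (act g y) \<partial>\<mu>)) / C"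
        unfolding D_def using iA by simp
      also have "\<dots> = (\<Sum>k<r. c k * ?A (Suc k) x y) / C" by (simp add: avg_def)
      also have "(\<Sum>k<r. c k * ?A (Suc k) x y) = \<theta> * (\<Sum>k<r. c (Suc k) * ?A (Suc k) x y)"
        unfolding sum_distrib_left by (intro sum.cong refl) (subst c_Suc, simp only: mult.assoc)
      \<comment> \<open>The shifted sum gains the term of index \<open>r\<close> and loses that of
        index 0, and the contraction over \<open>r\<close> steps makes the gain at most the
        loss.\<close>
      also have "(\<Sum>k<r. c (Suc k) * ?A (Suc k) x y) = (\<Sum>k<r. c k * ?A k x y) + (c r * ?A r x y - hdist x y)"
        using sum_lessThan_telescope[of "\<lambda>k. c k * ?A k x y" r] by (simp add: sum_subtractf c_0)
      also have "\<theta> * ((\<Sum>k<r. c k * ?A k x y) + (c r * ?A r x y - hdist x y)) \<le> \<theta> * (\<Sum>k<r. c k * ?A k x y)"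
      proof -
        have "?A r x y \<le> \<theta> ^ r * hdist x y"
          using th0(2)[OF xy] mult_right_mono[of \<theta>0 "\<theta> ^ r" "hdist x y"] hdist_bounds(1)[OF xy] thr by simp
        then have "c r * ?A r x y \<le> c r * (\<theta> ^ r * hdist x y)" using c[of r] by (intro mult_left_mono) auto
        also have "\<dots> = hdist x y" using th by (simp add: c_def power_divide)
        finally show ?thesis using th by (intro mult_left_mono) auto
      qed
      finally show ?thesis using C by (simp add: D_def divide_right_mono)
    qed
    fix g assume "g \<in> space \<mu>"
    then have g: "g \<in> G" by simp
    show "D (act g x) (act g y) \<le> C * D x y"
      using D_le[OF act_in_Splus[OF g xy(1)] act_in_Splus[OF g xy(2)]] hdist_act_le'[OF g xy] D_ge[OF xy]
        by linarith
    have "\<bar>cocycle g x - cocycle g y\<bar> \<le> 4 * (1 + ln (Nsize g)) * (C * D x y)"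
      using lN[OF g] by (intro order_trans[OF cocycle_Lipschitz[OF g xy]] mult_left_mono D_ge xy) auto
    then show "\<bar>cocycle g x - cocycle g y\<bar> \<le> l g * D x y" by (simp add: l_def mult_ac)
  qed
  then show thesis by (rule that)
qed

section \<open>Berry-Esseen bounds for matrix products\<close>

text \<open>Coordinates are at most 1, so they differ by at most \<open>1 - a b\<close> for the two
  ratios \<open>a\<close> and \<open>b\<close>, and \<open>1 + a b \<le> 2\<close> turns this into
  twice \<open>phi (a * b)\<close>. Lipschitz coordinates make Euclidean open sets open for
  \<open>dist_S\<close>.\<close>

lemma component_diff_le_dist_S:
  assumes x: "x \<in> Splus" and y: "y \<in> Splus"
  shows "\<bar>x $ i - y $ i\<bar> \<le> 2 * dist_S x y"
proof -
  let ?a = "mratio x y" and ?b = "mratio y x"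
  note ab = mratio_nonneg[OF x y] mratio_nonneg[OF y x] mratio_le_one[OF x y] mratio_le_one[OF y x]
  have ab1: "?a * ?b \<le> ?a" "?a * ?b \<le> ?b" "0 \<le> ?a * ?b" using ab
    by (auto intro: mult_left_le mult_left_le_one_le)
  have le1: "z $ i \<le> 1" if "z \<in> Splus" for z :: "real ^ 'a"
    using member_le_sum[of i UNIV "\<lambda>i. z $ i"] Splus_nonneg[OF that] Splus_sum[OF that] by simp
  have "(1 - ?a) * y $ i \<le> (1 - ?a) * 1" "(1 - ?b) * x $ i \<le> (1 - ?b) * 1"
    using ab le1[OF x] le1[OF y] by (intro mult_left_mono; simp)+
  then have "\<bar>x $ i - y $ i\<bar> \<le> 1 - ?a * ?b"
    using mratio_mult_le[OF x y, of i] mratio_mult_le[OF y x, of i] ab1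
      by (simp add: algebra_simps abs_le_iff)
  also have "\<dots> \<le> 2 * ((1 - ?a * ?b) / (1 + ?a * ?b))"
  proof -
    have "1 - c \<le> 2 * ((1 - c) / (1 + c))" if "0 \<le> c" "c \<le> 1" for c :: real
      using that mult_left_mono[of "1 + c" 2 "1 - c"] by (simp add: pos_le_divide_eq mult.commute)
    then show ?thesis using ab1 ab(3) by simp
  qed
  finally show ?thesis using x y by (simp add: dist_S_def phi_def)
qed

lemma space_borel_S: "space borel_S = Splus"
proof -
  have "{U. openin (Metric_space.mtopology Splus dist_S) U} \<subseteq> Pow (Splus :: (real ^ 'd) set)"
    using openin_subset Metric_space.topspace_mtopology[OF Metric_space_dist_S] by fastforce
  then show "space (borel_S :: (real ^ 'd) measure) = Splus"
    unfolding borel_S_def by (rule space_measure_of)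
qed

text \<open>This carries \<open>W0\<close>, which is measurable for \<open>borel_S\<close>, into the
  setting in which the iterated function system lives.\<close>

lemma measurable_borel_S_Splus: "(\<lambda>x. x) \<in> measurable borel_S (borel_Splus :: (real ^ 'd) measure)"
  unfolding borel_Splus_def
proof (rule measurable_restrict_space2)
  interpret S: Metric_space "Splus :: (real ^ 'd) set" dist_S by (rule Metric_space_dist_S)
  show "(\<lambda>x. x) \<in> space borel_S \<rightarrow> (Splus :: (real ^ 'd) set)" by (simp add: space_borel_S)
  show "(\<lambda>x :: real ^ 'd. x) \<in> borel_measurable borel_S"
  proof (intro borel_measurable_vecI borel_measurableI)
    fix i :: 'd and A :: "real set" assume A: "open A"
    let ?U = "(\<lambda>x :: real ^ 'd. x $ i) -` A \<inter> space borel_S"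
    have "openin S.mtopology ?U"
      unfolding S.openin_mtopology
    proof (intro conjI allI impI)
      show "?U \<subseteq> Splus" by (simp add: space_borel_S)
      fix x assume x: "x \<in> ?U"
      then have xS: "x \<in> Splus" by (simp add: space_borel_S)
      obtain e where e: "0 < e" "\<And>z. dist z (x $ i) < e \<Longrightarrow> z \<in> A"
        using A x unfolding open_dist by auto
      have "S.mball x (e / 2) \<subseteq> ?U"
      proof
        fix y assume "y \<in> S.mball x (e / 2)"
        then have y: "y \<in> Splus" "dist_S x y < e / 2" by (auto simp: S.in_mball)
        then have "dist (y $ i) (x $ i) < e"
          using component_diff_le_dist_S[OF xS y(1), of i] by (simp add: dist_real_def abs_minus_commute)
        then show "y \<in> ?U" using e(2) y(1) by (simp add: space_borel_S)
      qed
      then show "\<exists>r>0. S.mball x r \<subseteq> ?U" using e(1) by (intro exI[of _ "e / 2"]) auto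
    qed
    then show "?U \<in> sets borel_S"
      unfolding borel_S_def using openin_subset[of S.mtopology] S.topspace_mtopology
      by (subst sets_measure_of) (auto intro: sigma_sets.Basic)
  qed
qed

section \<open>Random starting point and operator norm\<close>

text \<open>Freezing the independent variable: a bound that is uniform over deterministic starting
  points survives averaging over a random one.\<close>

lemma (in prob_space) indep_average_le:
  fixes F :: "'b \<times> 'c \<Rightarrow> real"
  assumes X: "X \<in> measurable M S" and Y: "Y \<in> measurable M T"
    and indep: "\<And>A B. A \<in> sets S \<Longrightarrow> B \<in> sets T \<Longrightarrow>
      prob ((X -` A \<inter> space M) \<inter> (Y -` B \<inter> space M)) = prob (X -` A \<inter> space M) * prob (Y -` B \<inter> space M)"
    and F: "F \<in> borel_measurable (S \<Otimes>\<^sub>M T)" and int: "integrable M (\<lambda>w. F (X w, Y w))"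
    and le: "\<And>x. x \<in> space S \<Longrightarrow> \<bar>(\<integral>w. F (x, Y w) \<partial>M) - a\<bar> \<le> b"
  shows "\<bar>(\<integral>w. F (X w, Y w) \<partial>M) - a\<bar> \<le> b"
proof -
  let ?q = "\<lambda>w. \<integral>w'. F (X w, Y w') \<partial>M"
  have le': "\<bar>?q w - a\<bar> \<le> b" if "w \<in> space M" for w by (rule le[OF measurable_space[OF X that]])
  have "(\<lambda>(w, w'). (X w, Y w')) \<in> measurable (M \<Otimes>\<^sub>M M) (S \<Otimes>\<^sub>M T)" using X Y by measurable
  from measurable_compose[OF this F] have "(\<lambda>(w, w'). F (X w, Y w')) \<in> borel_measurable (M \<Otimes>\<^sub>M M)"
    by (simp only: case_prod_beta' fst_conv snd_conv)
  then have qm: "?q \<in> borel_measurable M" by (rule borel_measurable_lebesgue_integral)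
  have qi: "integrable M ?q"
  proof (rule integrable_const_bound[OF _ qm])
    show "AE w in M. norm (?q w) \<le> \<bar>a\<bar> + b"
    proof (rule AE_I2)
      fix w assume "w \<in> space M"
      from le'[OF this] show "norm (?q w) \<le> \<bar>a\<bar> + b" unfolding real_norm_def by linarith
    qed
  qed
  have "\<bar>(\<integral>w. F (X w, Y w) \<partial>M) - a\<bar> = norm (\<integral>w. ?q w - a \<partial>M)"
    using qi by (simp add: indep_expectation[OF X Y indep F int] prob_space)
  also have "\<dots> \<le> (\<integral>w. b \<partial>M)"
    by (rule norm_integral_le) (use qi le' in auto)
  finally show ?thesis by (simp add: prob_space)
qed

lemma (in prob_space) integral_indicator_le:
  fixes f :: "'a \<Rightarrow> real"
  assumes [measurable]: "f \<in> borel_measurable M"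
  shows "(\<integral>w. indicator {..z} (f w) \<partial>M) = prob {w \<in> space M. f w \<le> z}"
proof -
  have "(\<integral>w. indicator {..z} (f w) \<partial>M) = (\<integral>w. indicator {w \<in> space M. f w \<le> z} w \<partial>M :: real)"
    by (intro Bochner_Integration.integral_cong) (auto simp: indicator_def)
  then show ?thesis by simp
qed

text \<open>A supremum of reals is an upper bound only for a bounded family, so the uniform bound
  \<open>B\<close> is used for nonnegativity as well.\<close>

lemma SUP_bounds:
  fixes f :: "'b \<Rightarrow> real"
  assumes "A \<noteq> {}" "\<And>t. t \<in> A \<Longrightarrow> 0 \<le> f t" "\<And>t. t \<in> A \<Longrightarrow> f t \<le> B"
  shows "0 \<le> (SUP t\<in>A. f t)" "(SUP t\<in>A. f t) \<le> B"
proof -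
  obtain t where t: "t \<in> A" using assms(1) by blast
  have "f t \<le> (SUP t\<in>A. f t)" by (rule cSUP_upper[OF t bdd_aboveI2[OF assms(3)]])
  then show "0 \<le> (SUP t\<in>A. f t)" using assms(2)[OF t] by linarith
  show "(SUP t\<in>A. f t) \<le> B" by (rule cSUP_least[OF assms(1,3)])
qed

lemma bigo_of_bounds:
  fixes f :: "nat \<Rightarrow> real"
  assumes "\<And>n. 1 \<le> n \<Longrightarrow> 0 \<le> f n" "\<And>n. 1 \<le> n \<Longrightarrow> f n \<le> C * (1 / real n) powr q"
  shows "f \<in> O(\<lambda>n. (1 / real n) powr q)"
  by (rule bigoI[of _ C]) (use assms in \<open>auto intro!: eventually_sequentiallyI[of 1]\<close>)

lemma walk_in_G: "(\<And>i. 1 \<le> i \<Longrightarrow> Y i w \<in> G) \<Longrightarrow> walk Y n w \<in> G"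
  by (induction n) (auto intro: G_mult one_in_G)

lemma trajectory_walk:
  assumes "\<And>i. 1 \<le> i \<Longrightarrow> Y i w \<in> G" and x: "x \<in> Splus"
  shows "trajectory act (\<lambda>i. Y i w) x n = act (walk Y n w) x"
    and "birkhoff cocycle act (\<lambda>i. Y i w) x n = cocycle (walk Y n w) x"
proof -
  have G: "walk Y n w \<in> G" for n by (rule walk_in_G) (rule assms(1))
  show tr: "trajectory act (\<lambda>i. Y i w) x n = act (walk Y n w) x" for n
    by (induction n) (simp_all add: act_one x act_mult G assms(1))
  show "birkhoff cocycle act (\<lambda>i. Y i w) x n = cocycle (walk Y n w) x"
    by (induction n) (simp_all add: birkhoff_def cocycle_one x act_mult G assms(1) tr)
qed

text \<open>At the barycenter \<open>u\<close> the norm of the image is the average of the column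
  sums, which lies between the largest one divided by the dimension and the largest one. So the
  logarithm of the operator norm is a bounded perturbation of the cocycle at a fixed deterministic
  point.\<close>

lemma ln_opnorm1_cocycle:
  fixes g :: "real ^ 'd ^ 'd"
  assumes g: "g \<in> G"
  defines "u \<equiv> (\<chi> i. 1 / real CARD('d)) :: real ^ 'd"
  shows "u \<in> Splus" "\<bar>ln (opnorm1 g) - cocycle g u\<bar> \<le> ln (real CARD('d))"
proof -
  have d: "1 \<le> real CARD('d)" by (simp add: Suc_leI)
  show u: "u \<in> Splus" by (simp add: u_def Splus_def norm1_def)
  have "colmax g \<in> range (colsum g)" unfolding colmax_def by (intro Max_in) auto
  then obtain j where j: "colmax g = colsum g j" by blast
  have eq: "norm1 (g *v u) = (\<Sum>j\<in>UNIV. colsum g j) / real CARD('d)"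
    unfolding norm1_mv[OF g u] by (simp add: u_def sum_divide_distrib)
  have "colsum g j \<le> (\<Sum>j\<in>UNIV. colsum g j)"
    using colsum_pos[OF g] by (intro member_le_sum) (auto intro: less_imp_le)
  then have "colmax g / real CARD('d) \<le> norm1 (g *v u)"
    unfolding eq j by (intro divide_right_mono) auto
  then have "ln (colmax g / real CARD('d)) \<le> cocycle g u"
    unfolding cocycle_def using colsum_pos[OF g, of j] j d norm1_mv_pos[OF g u]
      by (subst ln_le_cancel_iff) auto
  moreover have "cocycle g u \<le> ln (colmax g)"
    unfolding cocycle_def using norm1_mv_bounds[OF g u] norm1_mv_pos[OF g u]
      by (subst ln_le_cancel_iff) auto
  moreover have "0 < colmax g" using colsum_pos[OF g, of j] j by simp
  moreover have "0 \<le> ln (real CARD('d))" using d by simp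
  ultimately show "\<bar>ln (opnorm1 g) - cocycle g u\<bar> \<le> ln (real CARD('d))"
    using d by (simp add: opnorm1_eq[OF g] ln_div)
qed

theorem theorem7p1:
  fixes \<mu> :: "(real ^ 'd ^ 'd) measure"
    and \<nu> :: "(real ^ 'd) measure"
    and M :: "'w measure"
    and Y :: "nat \<Rightarrow> 'w \<Rightarrow> real ^ 'd ^ 'd"
    and W0 :: "'w \<Rightarrow> real ^ 'd"
    and p lam s2 :: real
  assumes d: "CARD('d) \<ge> 2"
    and p: "2 < p" "p \<le> 3"
    and mu: "prob_space \<mu>" "sets \<mu> = sets borel_G"
    and contracting: "strictly_contracting \<mu>"
    and moment: "has_moment \<mu> p"
    and nu: "prob_space \<nu>" "sets \<nu> = sets borel_S" "invariant_measure \<mu> \<nu>"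
    and M: "prob_space M"
    and Y_indep: "prob_space.indep_vars M (\<lambda>_. borel_G) Y {1..}"
    and Y_law: "\<And>n. n \<ge> 1 \<Longrightarrow> distr M borel_G (Y n) = \<mu>"
    and W0_law: "W0 \<in> measurable M borel_S" "distr M borel_S W0 = \<nu>"
    and W0_indep: "prob_space.indep_set M
          (sets (vimage_algebra (space M) W0 borel_S))
          (sets (vimage_algebra (space M) (\<lambda>\<omega>. \<lambda>n\<in>{1..}. Y n \<omega>) (\<Pi>\<^sub>M n\<in>{1..}. borel_G)))"
    and lam: "AE \<omega> in M. (\<lambda>n. ln (opnorm1 (walk Y n \<omega>)) / real n) \<longlonglongrightarrow> lam"
    and s2: "(\<lambda>n. (\<integral>\<omega>. (cocycle (walk Y n \<omega>) (W0 \<omega>) - real n * lam)\<^sup>2 \<partial>M) / real n) \<longlonglongrightarrow> s2"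
    and s2_pos: "s2 > 0"
  shows
    "(\<lambda>n. SUP t. \<bar>measure M {\<omega> \<in> space M.
          cocycle (walk Y n \<omega>) (W0 \<omega>) - real n * lam \<le> t * sqrt (real n)} - Phi (t / sqrt s2)\<bar>)
        \<in> O(\<lambda>n. (1 / real n) powr (p / 2 - 1))
     \<and> (\<lambda>n. SUP x\<in>Splus. SUP t. \<bar>measure M {\<omega> \<in> space M.
          cocycle (walk Y n \<omega>) x - real n * lam \<le> t * sqrt (real n)} - Phi (t / sqrt s2)\<bar>)
        \<in> O(\<lambda>n. (1 / real n) powr (p / 2 - 1))
     \<and> (\<lambda>n. SUP t. \<bar>measure M {\<omega> \<in> space M.
          ln (opnorm1 (walk Y n \<omega>)) - real n * lam \<le> t * sqrt (real n)} - Phi (t / sqrt s2)\<bar>)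
        \<in> O(\<lambda>n. (1 / real n) powr (p / 2 - 1))"
proof -
  interpret M: prob_space M by (rule M)
  interpret L: matrix_law \<mu> using mu by (rule matrix_law.intro)
  obtain D \<theta> K l where "contracting_ifs \<mu> borel_Splus act D \<theta> K cocycle l p"
    by (rule L.contracting_ifs_ex[OF contracting moment p]) blast
  then interpret I: contracting_ifs \<mu> borel_Splus act D \<theta> K cocycle l p .
  have Ym: "Y n \<in> measurable M borel_G" if "1 \<le> n" for n
    using Y_indep that by (auto simp: M.indep_vars_def2)
  have YG: "Y n w \<in> G" if "1 \<le> n" "w \<in> space M" for n w
    using measurable_space[OF Ym[OF that(1)] that(2)] by simp
  have iid: "iid_seq M \<mu> Y"
    unfolding iid_seq_def
  proof (intro conjI allI impI)
    show "prob_space M" by (rule M)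
    have "M.indep_vars (\<lambda>_. \<mu>) Y {1..} = M.indep_vars (\<lambda>_. borel_G) Y {1..}"
      unfolding M.indep_vars_def2 mu(2) measurable_cong_sets[OF refl mu(2)] ..
    then show "M.indep_vars (\<lambda>_. \<mu>) Y {1..}" using Y_indep by simp
    fix n :: nat assume "1 \<le> n"
    have "distr M \<mu> (Y n) = distr M borel_G (Y n)" by (rule distr_cong) (auto simp: mu(2))
    then show "distr M \<mu> (Y n) = \<mu>" using Y_law[OF \<open>1 \<le> n\<close>] by simp
  qed
  obtain m v C where v: "0 \<le> v" and C: "0 \<le> C"
    and mom: "\<And>M' :: 'w measure. \<And>Y n x. iid_seq M' \<mu> Y \<Longrightarrow> x \<in> space borel_Splus \<Longrightarrow>
       \<bar>(\<integral>w. (birkhoff cocycle act (\<lambda>i. Y i w) x n - real n * m)\<^sup>2 \<partial>M') - real n * v\<bar> \<le> C * (1 + sqrt (real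
           n))"
    and be: "\<And>M' :: 'w measure. \<And>Y n x t. 0 < v \<Longrightarrow> iid_seq M' \<mu> Y \<Longrightarrow> 1 \<le> n \<Longrightarrow> x \<in> space borel_Splus \<Longrightarrow>
       \<bar>measure M' {w \<in> space M'. birkhoff cocycle act (\<lambda>i. Y i w) x n - real n * m \<le> t * sqrt (real n)}
         - cdf std_normal_distribution (t / sqrt v)\<bar> \<le> C * (1 / real n) powr (p / 2 - 1)"
    by (rule I.birkhoff_limit_theorems) blast
  note mom = mom[OF iid, unfolded space_borel_Splus] and be = be[OF _ iid, unfolded space_borel_Splus]
  note Wm [measurable] = measurable_compose[OF W0_law(1) measurable_borel_S_Splus]
  have WS: "W0 w \<in> Splus" if "w \<in> space M" for w using measurable_space[OF Wm that] by simp
  let ?P = "PiM {1..} (\<lambda>_::nat. borel_G :: (real ^ 'd ^ 'd) measure)"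
  \<comment> \<open>The whole sequence becomes one random element of the product space, the form in
    which its independence of \<open>W0\<close> is assumed.\<close>
  define V where "V w = (\<lambda>n\<in>{1..}. Y n w)" for w
  have Vm [measurable]: "V \<in> measurable M ?P" unfolding V_def by (rule measurable_restrict) (rule Ym, simp)
  have indep: "M.prob ((W0 -` A \<inter> space M) \<inter> (V -` B \<inter> space M))
      = M.prob (W0 -` A \<inter> space M) * M.prob (V -` B \<inter> space M)"
    if A: "A \<in> sets borel_Splus" and B: "B \<in> sets ?P" for A B
  proof -
    have "(\<lambda>x. x) -` A \<inter> space borel_S \<in> sets borel_S"
      by (rule measurable_sets[OF measurable_borel_S_Splus A])
    moreover have "(\<lambda>x. x) -` A \<inter> space borel_S = A"
      using sets.sets_into_space[OF A] by (auto simp: space_borel_S)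
    ultimately have "A \<in> sets borel_S" by simp
    then show ?thesis
      unfolding V_def using B by (intro M.indep_setD[OF W0_indep] in_vimage_algebra)
  qed
  let ?b = "\<lambda>n x w. birkhoff cocycle act (\<lambda>i. Y i w) x n"
  have bV: "birkhoff cocycle act (V w) x n = ?b n x w" for n x w
    by (rule birkhoff_cong) (simp add: V_def)
  have bP [measurable]: "(\<lambda>(x, f). birkhoff cocycle act f x n) \<in> borel_measurable (borel_Splus \<Otimes>\<^sub>M ?P)"
    for n
    unfolding case_prod_beta'
  proof (rule I.birkhoff_measurable[OF measurable_fst])
    fix i :: nat assume "1 \<le> i"
    then have "(\<lambda>w. snd w i) \<in> measurable (borel_Splus \<Otimes>\<^sub>M ?P) borel_G"
      by (intro measurable_compose[OF measurable_snd measurable_component_singleton]) auto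
    then show "(\<lambda>w. snd w i) \<in> measurable (borel_Splus \<Otimes>\<^sub>M ?P) \<mu>"
      by (simp only: measurable_cong_sets[OF refl mu(2)])
  qed
  have bx [measurable]: "?b n x \<in> borel_measurable M" if "x \<in> Splus" for n x
    by (rule I.birkhoff_measurable[OF measurable_const iid_seq_measurable[OF iid]]) (use that in auto)
  have bW [measurable]: "(\<lambda>w. ?b n (W0 w) w) \<in> borel_measurable M" for n
    by (rule I.birkhoff_measurable[OF Wm iid_seq_measurable[OF iid]])
  have cW: "cocycle (walk Y n w) (W0 w) = ?b n (W0 w) w" if "w \<in> space M" for n w
    using trajectory_walk(2)[of Y w "W0 w" n] YG WS that by simp
  have cx: "cocycle (walk Y n w) x = ?b n x w" if "w \<in> space M" "x \<in> Splus" for n w x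
    using trajectory_walk(2)[of Y w x n] YG that by simp
  have sqi: "integrable M (\<lambda>w. (?b n (W0 w) w - z)\<^sup>2)" for n z
  proof -
    have i2: "integrable M (\<lambda>w. (?b n (W0 w) w)\<^sup>2)" by (rule I.birkhoff_square_integrable[OF iid Wm])
    then have "integrable M (\<lambda>w. ?b n (W0 w) w)" by (rule M.square_integrable_imp_integrable[OF bW])
    then have "integrable M (\<lambda>w. (?b n (W0 w) w)\<^sup>2 + z\<^sup>2 - 2 * z * ?b n (W0 w) w)" using i2 by simp
    then show ?thesis by (simp add: power2_diff mult_ac)
  qed
  \<comment> \<open>Second moment about \<open>n * c\<close> from the random start, through which
    the centerings \<open>m\<close> and \<open>lam\<close> are compared.\<close>
  define S where "S c n = (\<integral>w. (?b n (W0 w) w - real n * c)\<^sup>2 \<partial>M)" for c n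
  have S_m: "\<bar>S m n - real n * v\<bar> \<le> C * (1 + sqrt (real n))" for n
  proof -
    let ?F = "\<lambda>(x, f). (birkhoff cocycle act f x n - real n * m)\<^sup>2"
    have "\<bar>(\<integral>w. ?F (W0 w, V w) \<partial>M) - real n * v\<bar> \<le> C * (1 + sqrt (real n))"
    proof (rule M.indep_average_le[OF Wm Vm indep])
      have "(\<lambda>q. ((\<lambda>(x, f). birkhoff cocycle act f x n) q - real n * m)\<^sup>2)
          \<in> borel_measurable (borel_Splus \<Otimes>\<^sub>M ?P)"
        by (intro borel_measurable_power borel_measurable_diff bP borel_measurable_const)
      then show "?F \<in> borel_measurable (borel_Splus \<Otimes>\<^sub>M ?P)" by (simp only: case_prod_beta')
      show "integrable M (\<lambda>w. ?F (W0 w, V w))" using sqi by (simp add: bV)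
      show "\<bar>(\<integral>w. ?F (x, V w) \<partial>M) - real n * v\<bar> \<le> C * (1 + sqrt (real n))" if "x \<in> space borel_Splus" for x
        using mom[of x n] that by (simp add: bV)
    qed
    then show ?thesis by (simp add: bV S_def)
  qed
  have S_lam: "S lam n = (\<integral>\<omega>. (cocycle (walk Y n \<omega>) (W0 \<omega>) - real n * lam)\<^sup>2 \<partial>M)" for n
    unfolding S_def by (intro Bochner_Integration.integral_cong) (auto simp: cW)
  have lim_lam: "(\<lambda>n. S lam n / real n) \<longlonglongrightarrow> s2" using s2 by (simp only: S_lam)
  have lim_m: "(\<lambda>n. S m n / real n) \<longlonglongrightarrow> v"
  proof (rule LIM_zero_cancel, rule Lim_null_comparison)
    show "eventually (\<lambda>n. norm (S m n / real n - v) \<le> C * ((1 + sqrt (real n)) / real n)) sequentially"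
      using eventually_gt_at_top[of 0]
    proof eventually_elim
      fix n :: nat assume n: "0 < n"
      have "S m n / real n - v = (S m n - real n * v) / real n" using n by (simp add: field_simps)
      then have "norm (S m n / real n - v) = \<bar>S m n - real n * v\<bar> / real n" by simp
      also have "\<dots> \<le> C * (1 + sqrt (real n)) / real n" by (intro divide_right_mono S_m) simp
      finally show "norm (S m n / real n - v) \<le> C * ((1 + sqrt (real n)) / real n)" by simp
    qed
    have "(\<lambda>n. inverse (sqrt (real n))) \<longlonglongrightarrow> 0"
      by (rule tendsto_inverse_0_at_top[OF filterlim_compose[OF sqrt_at_top filterlim_real_sequentially]])
    from tendsto_add[OF lim_1_over_n this]
    have "(\<lambda>n. (1 + sqrt (real n)) / real n) \<longlonglongrightarrow> 0"
      by (simp add: add_divide_distrib sqrt_divide_self_eq)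
    then show "(\<lambda>n. C * ((1 + sqrt (real n)) / real n)) \<longlonglongrightarrow> 0" by (rule tendsto_mult_right_zero)
  qed
  \<comment> \<open>If \<open>m\<close> and \<open>lam\<close> differed, the two second moments
    could not both be of order \<open>n\<close>, as their sum is at least
    \<open>n^2 (m - lam)^2 / 2\<close>. Once the centerings agree, uniqueness of limits identifies
    \<open>v\<close> with \<open>s2\<close>.\<close>
  have "(m - lam)\<^sup>2 \<le> 0"
  proof (rule tendsto_lowerbound)
    have "(\<lambda>n. 2 * (S m n / real n * (1 / real n)) + 2 * (S lam n / real n * (1 / real n)))
        \<longlonglongrightarrow> 2 * (v * 0) + 2 * (s2 * 0)"
      by (intro tendsto_intros lim_m lim_lam lim_1_over_n)
    then show "(\<lambda>n. 2 * (S m n / real n * (1 / real n)) + 2 * (S lam n / real n * (1 / real n))) \<longlonglongrightarrow> 0"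
      by simp
    show "eventually (\<lambda>n. (m - lam)\<^sup>2
        \<le> 2 * (S m n / real n * (1 / real n)) + 2 * (S lam n / real n * (1 / real n))) sequentially"
      using eventually_gt_at_top[of 0]
    proof eventually_elim
      fix n :: nat assume n: "0 < n"
      have "(\<integral>w. (real n * (m - lam))\<^sup>2 \<partial>M)
          \<le> (\<integral>w. 2 * (?b n (W0 w) w - real n * m)\<^sup>2 + 2 * (?b n (W0 w) w - real n * lam)\<^sup>2 \<partial>M)"
      proof (rule integral_mono)
        fix w
        have "(y - x)\<^sup>2 \<le> 2 * (z - x)\<^sup>2 + 2 * (z - y)\<^sup>2" for x y z :: real
          using zero_le_power2[of "2 * z - x - y"] by (simp add: power2_eq_square algebra_simps)
        from this[of "real n * m" "real n * lam" "?b n (W0 w) w"]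
        show "(real n * (m - lam))\<^sup>2 \<le> 2 * (?b n (W0 w) w - real n * m)\<^sup>2 + 2 * (?b n (W0 w) w - real n
            * lam)\<^sup>2"
          unfolding right_diff_distrib by linarith
      qed (use sqi in auto)
      also have "\<dots> = 2 * S m n + 2 * S lam n" using sqi by (simp add: S_def)
      finally have "(real n)\<^sup>2 * (m - lam)\<^sup>2 \<le> 2 * S m n + 2 * S lam n"
        by (simp add: M.prob_space power_mult_distrib)
      then show "(m - lam)\<^sup>2 \<le> 2 * (S m n / real n * (1 / real n)) + 2 * (S lam n / real n * (1 / real n))"
        using n by (simp add: field_simps power2_eq_square)
    qed
  qed simp
  then have ml: "m = lam" by simp
  then have vs: "v = s2" using LIMSEQ_unique[OF lim_m] lim_lam by simp
  have v0: "0 < v" using s2_pos vs by simp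
  let ?r = "\<lambda>n. (1 / real n) powr (p / 2 - 1)"
  have bound2: "\<bar>measure M {w \<in> space M. cocycle (walk Y n w) x - real n * lam
      \<le> t * sqrt (real n)} - Phi (t / sqrt s2)\<bar> \<le> C * ?r n"
    if n: "1 \<le> n" and x: "x \<in> Splus" for n x t
  proof -
    have "{w \<in> space M. cocycle (walk Y n w) x - real n * lam \<le> t * sqrt (real n)} = {w
        \<in> space M. ?b n x w - real n * m \<le> t * sqrt (real n)}"
      using cx x ml by auto
    then show ?thesis using be[OF v0 n x, of t] by (simp add: Phi_def vs)
  qed
  have bound1: "\<bar>measure M {w \<in> space M. cocycle (walk Y n w) (W0 w) - real n * lam
      \<le> t * sqrt (real n)} - Phi (t / sqrt s2)\<bar> \<le> C * ?r n"
    if n: "1 \<le> n" for n t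
  proof -
    define z where "z = t * sqrt (real n) + real n * lam"
    have e: "u - real n * lam \<le> t * sqrt (real n) \<longleftrightarrow> u \<le> z" for u by (auto simp: z_def)
    \<comment> \<open>Probabilities are written as expectations of an indicator depending on the
      start and the letters, so that the bound for fixed starting points can be averaged over
      \<open>W0\<close>.\<close>
    let ?F = "\<lambda>(x, f). indicator {..z} (birkhoff cocycle act f x n) :: real"
    have "\<bar>(\<integral>w. ?F (W0 w, V w) \<partial>M) - Phi (t / sqrt s2)\<bar> \<le> C * ?r n"
    proof (rule M.indep_average_le[OF Wm Vm indep])
      have "(\<lambda>q. indicator {..z} ((\<lambda>(x, f). birkhoff cocycle act f x n) q) :: real)
          \<in> borel_measurable (borel_Splus \<Otimes>\<^sub>M ?P)"
        by measurable
      then show "?F \<in> borel_measurable (borel_Splus \<Otimes>\<^sub>M ?P)" by (simp only: case_prod_beta')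
      show "integrable M (\<lambda>w. ?F (W0 w, V w))"
        unfolding prod.case bV by (rule M.integrable_const_bound[where B=1]) (auto simp: indicator_def)
      fix x :: "real ^ 'd" assume "x \<in> space borel_Splus"
      then have x: "x \<in> Splus" by simp
      have "(\<integral>w. ?F (x, V w) \<partial>M) = measure M {w \<in> space M. ?b n x w \<le> z}"
        unfolding prod.case bV by (rule M.integral_indicator_le[OF bx[OF x]])
      also have "{w \<in> space M. ?b n x w \<le> z} = {w \<in> space M. cocycle (walk Y n w) x - real n * lam
          \<le> t * sqrt (real n)}"
        using x by (auto simp: e cx)
      finally show "\<bar>(\<integral>w. ?F (x, V w) \<partial>M) - Phi (t / sqrt s2)\<bar> \<le> C * ?r n" using bound2[OF n x, of t]
        by simp
    qed
    also have "(\<integral>w. ?F (W0 w, V w) \<partial>M) = measure M {w \<in> space M. ?b n (W0 w) w \<le> z}"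
      unfolding prod.case bV by (rule M.integral_indicator_le[OF bW])
    also have "{w \<in> space M. ?b n (W0 w) w \<le> z} = {w \<in> space M. cocycle (walk Y n w) (W0 w) - real n * lam
        \<le> t * sqrt (real n)}"
      by (auto simp: e cW)
    finally show ?thesis .
  qed
  let ?d = "real CARD('d)"
  define u :: "real ^ 'd" where "u = (\<chi> i. 1 / ?d)"
  have uS: "u \<in> Splus" unfolding u_def by (rule ln_opnorm1_cocycle(1)[OF one_in_G])
  have wG: "walk Y n w \<in> G" if "w \<in> space M" for n w using YG that by (intro walk_in_G) auto
  have wm: "walk Y n \<in> measurable M borel_G" for n
  proof (induction n)
    case 0
    have "(\<lambda>w. mat 1) \<in> measurable M (borel_G :: (real ^ 'd ^ 'd) measure)"
      by (rule measurable_const) (simp add: one_in_G)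
    then show ?case by (simp cong: measurable_cong)
  next
    case (Suc n)
    have "(\<lambda>w. (\<lambda>(g, h). g ** h) (Y (Suc n) w, walk Y n w)) \<in> measurable M borel_G"
      by (rule measurable_compose[OF measurable_Pair measurable_matrix_mult]) (use Suc Ym[of "Suc n"] in
          auto)
    then show ?case by (simp cong: measurable_cong)
  qed
  have lm: "(\<lambda>w. ln (opnorm1 (walk Y n w))) \<in> borel_measurable M" for n
  proof -
    have "(\<lambda>g. ln (colmax g)) \<in> borel_measurable borel_G"
      unfolding colmax_def colsum_def by measurable
    from measurable_compose[OF wm this] have "(\<lambda>w. ln (colmax (walk Y n w))) \<in> borel_measurable M" .
    then show ?thesis by (rule measurable_cong[THEN iffD2, rotated]) (simp add: opnorm1_eq wG)
  qed
  \<comment> \<open>The extra constant is the price of passing from the cocycle at \<open>u\<close>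
    to the operator norm: the error \<open>ln ?d\<close> enters divided by
    \<open>sqrt n * sqrt s2\<close>, and \<open>1 / sqrt n\<close> is at most the rate.\<close>
  define C' where "C' = C + ln ?d / sqrt s2"
  have bound3: "\<bar>measure M {w \<in> space M. ln (opnorm1 (walk Y n w)) - real n * lam
      \<le> t * sqrt (real n)} - Phi (t / sqrt s2)\<bar> \<le> C' * ?r n"
    if n: "1 \<le> n" for n t
  proof -
    have "\<bar>measure M {w \<in> space M. ln (opnorm1 (walk Y n w)) - real n * lam
        \<le> t * sqrt (real n)} - cdf std_normal_distribution (t / sqrt s2)\<bar>
      \<le> C * ?r n + ln ?d / (sqrt (real n) * sqrt s2)"
    proof (rule kolmogorov_shift[OF M])
      show "(\<lambda>w. ln (opnorm1 (walk Y n w)) - real n * lam) \<in> borel_measurable M" using lm by measurable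
      have "(\<lambda>w. cocycle (walk Y n w) u) \<in> borel_measurable M"
        using bx[OF uS, of n] by (rule measurable_cong[THEN iffD2, rotated]) (simp add: cx uS)
      then show "(\<lambda>w. cocycle (walk Y n w) u - real n * lam) \<in> borel_measurable M" by measurable
      show "\<bar>(ln (opnorm1 (walk Y n w)) - real n * lam) - (cocycle (walk Y n w) u - real n * lam)\<bar> \<le> ln ?d"
        if "w \<in> space M" for w
        using ln_opnorm1_cocycle(2)[OF wG[OF that, of n]] by (simp add: u_def)
      show "\<bar>measure M {w \<in> space M. cocycle (walk Y n w) u - real n * lam
          \<le> t * sqrt (real n)} - cdf std_normal_distribution (t / sqrt s2)\<bar> \<le> C * ?r n" for t
        using bound2[OF n uS, of t] by (simp add: Phi_def)
    qed (use n s2_pos in auto)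
    also have "ln ?d / (sqrt (real n) * sqrt s2) = ln ?d / sqrt s2 * (1 / sqrt (real n))" by simp
    also have "C * ?r n + ln ?d / sqrt s2 * (1 / sqrt (real n)) \<le> C' * ?r n"
    proof -
      have "(1 / real n) powr (1 / 2) \<le> ?r n" using n p by (intro powr_mono') auto
      then have "1 / sqrt (real n) \<le> ?r n" using n by (simp add: powr_half_sqrt real_sqrt_divide)
      moreover have "0 \<le> ln ?d / sqrt s2" using d s2_pos by (intro divide_nonneg_nonneg) auto
      ultimately have "ln ?d / sqrt s2 * (1 / sqrt (real n)) \<le> ln ?d / sqrt s2 * ?r n"
        by (rule mult_left_mono)
      then show ?thesis by (simp only: C'_def distrib_right add_left_mono)
    qed
    finally show ?thesis by (simp add: Phi_def)
  qed
  have ne: "(Splus :: (real ^ 'd) set) \<noteq> {}" using uS by blast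
  show ?thesis
  proof (intro conjI)
    show "(\<lambda>n. SUP t. \<bar>measure M {\<omega> \<in> space M.
          cocycle (walk Y n \<omega>) (W0 \<omega>) - real n * lam \<le> t * sqrt (real n)} - Phi (t / sqrt s2)\<bar>) \<in> O(?r)"
      by (rule bigo_of_bounds[where C=C]; rule SUP_bounds[OF UNIV_not_empty abs_ge_zero bound1])
    show "(\<lambda>n. SUP x\<in>Splus. SUP t. \<bar>measure M {\<omega> \<in> space M.
          cocycle (walk Y n \<omega>) x - real n * lam \<le> t * sqrt (real n)} - Phi (t / sqrt s2)\<bar>) \<in> O(?r)"
      by (rule bigo_of_bounds[where C=C]; rule SUP_bounds[OF ne]; rule SUP_bounds[OF UNIV_not_empty
          abs_ge_zero bound2])
    show "(\<lambda>n. SUP t. \<bar>measure M {\<omega> \<in> space M.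
          ln (opnorm1 (walk Y n \<omega>)) - real n * lam \<le> t * sqrt (real n)} - Phi (t / sqrt s2)\<bar>) \<in> O(?r)"
      by (rule bigo_of_bounds[where C=C']; rule SUP_bounds[OF UNIV_not_empty abs_ge_zero bound3])
  qed
qed

end
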